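(* Let $G$ be a hyperrigid subset of a unital $C^*$-algebra $\mathcal{A}$. Suppose that $\mathcal{H}$ and $\mathcal{K}$ are separable Hilbert spaces, $\pi\colon\mathcal{A}\to B(\mathcal{H})$ and $\rho\colon\mathcal{A}\to B(\mathcal{K})$ are representations, and $R\in B(\mathcal{H},\mathcal{K})$ is a non-isometric contraction such that $\pi(g)=R^*\rho(g)R$ for all $g\in G$. Set $J=\{a\in\mathcal{A}:\pi(a)=R^*\rho(a)R\}$. Then the following dichotomy holds: ($\alpha$) either there exists a state $\phi$ on $\mathcal{A}$ such that $G\subseteq\ker\phi$, in which case $R\pi(a)=\rho(a)R$ for all $a\in\mathcal{A}$ and $J$ is a closed ideal in $\mathcal{A}$; ($\beta$) or, for every state $\phi$ on $\mathcal{A}$, $G\nsubseteq\ker\phi$, in which case it is not true that $R\pi(a)=\rho(a)R$ for all $a\in\mathcal{A}$, and $J$ is not an ideal in $\mathcal{A}$. Moreover, if ($\alpha$) holds (with a state $\phi$ on $\mathcal{A}$ such that $G\subseteq\ker\phi$), then $\ker\phi=J$, $\phi$ is a character of $\mathcal{A}$, and $$\pi(a)=R^*\rho(a)R+\phi(a)(I-R^*R),\qquad a\in\mathcal{A}.$$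
   Context: All Hilbert spaces are complex. $B(\mathcal{H},\mathcal{K})$ is the space of bounded linear operators from $\mathcal{H}$ to $\mathcal{K}$, $B(\mathcal{H})=B(\mathcal{H},\mathcal{H})$, and $I$ is the identity operator. A representation of a unital $C^*$-algebra $\mathcal{A}$ is a unital $*$-homomorphism $\mathcal{A}\to B(\mathcal{H})$; a character is a one-dimensional representation $\chi\colon\mathcal{A}\to\mathbb{C}$. A contraction is an operator $R$ with $\|R\|\le 1$; $R$ is isometric if $R^*R=I$. Ideals are two-sided. A set $G$ generates the unital $C^*$-algebra $\mathcal{A}$ if $\mathcal{A}$ is the smallest $C^*$-subalgebra of $\mathcal{A}$ containing $G$ and the unit. UCP means unital completely positive. A finite or countably infinite set $G$ of generators of $\mathcal{A}$ is hyperrigid if for every faithful representation $\pi\colon\mathcal{A}\to B(\mathcal{H})$ on a separable Hilbert space $\mathcal{H}$ and every sequence of UCP maps $\Phi_k\colon B(\mathcal{H})\to B(\mathcal{H})$ ($k\in\mathbb{N}$): if $\lim_{k}\|\Phi_k(\pi(g))-\pi(g)\|=0$ for all $g\in G$, then $\lim_k\|\Phi_k(\pi(a))-\pi(a)\|=0$ for all $a\in\mathcal{A}$. A "hyperrigid subset" of $\mathcal{A}$ is always a finite or countably infinite generating set of $\mathcal{A}$. *)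

theory Defs
  imports "HOL-Analysis.Analysis"
begin

section \<open>Complex vector spaces and inner product spaces\<close>

class complex_vector = real_vector +
  fixes scaleC :: "complex \<Rightarrow> 'a \<Rightarrow> 'a"  (infixr \<open>*\<^sub>C\<close> 75)
  assumes scaleC_add_right: "c *\<^sub>C (x + y) = c *\<^sub>C x + c *\<^sub>C y"
    and scaleC_add_left: "(c + d) *\<^sub>C x = c *\<^sub>C x + d *\<^sub>C x"
    and scaleC_scaleC: "c *\<^sub>C (d *\<^sub>C x) = (c * d) *\<^sub>C x"
    and scaleR_scaleC: "r *\<^sub>R x = complex_of_real r *\<^sub>C x"

text \<open>The complex inner product is linear in its first argument; its real part is the inner
  product of the library class, which supplies positive definiteness, norm and topology.\<close>

class complex_inner = complex_vector + real_inner +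
  fixes cinner :: "'a \<Rightarrow> 'a \<Rightarrow> complex"
  assumes cinner_commute: "cinner x y = cnj (cinner y x)"
    and cinner_add_left: "cinner (x + y) z = cinner x z + cinner y z"
    and cinner_scaleC_left: "cinner (c *\<^sub>C x) y = c * cinner x y"
    and inner_eq_Re_cinner: "inner x y = Re (cinner x y)"

definition csubspace :: "'a::complex_vector set \<Rightarrow> bool" where
  "csubspace S \<longleftrightarrow> 0 \<in> S \<and> (\<forall>x\<in>S. \<forall>y\<in>S. x + y \<in> S) \<and> (\<forall>c. \<forall>x\<in>S. c *\<^sub>C x \<in> S)"

text \<open>A Hilbert space is given by its carrier \<open>H\<close>, a complete linear subspace of some complex
  inner product space (\<open>H = UNIV\<close> when the ambient space is itself complete). Carriers,
  rather than whole types, are needed because the definition of hyperrigidity quantifies over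
  Hilbert spaces.\<close>

definition hilbert_space :: "'h::complex_inner set \<Rightarrow> bool" where
  "hilbert_space H \<longleftrightarrow> csubspace H \<and> complete H"

definition separable_hilbert_space :: "'h::complex_inner set \<Rightarrow> bool" where
  "separable_hilbert_space H \<longleftrightarrow> hilbert_space H \<and> separable_space (top_of_set H)"


section \<open>Bounded operators\<close>

text \<open>Operators from \<open>H\<close> to \<open>K\<close> are extensional functions (\<open>undefined\<close> off \<open>H\<close>), so that
  equality of operators is equality of functions. Composition is \<open>compose H\<close>.\<close>

definition bounded_ops :: "'h::complex_inner set \<Rightarrow> 'k::complex_inner set \<Rightarrow> ('h \<Rightarrow> 'k) set" where
  "bounded_ops H K = {T \<in> H \<rightarrow>\<^sub>E K.
     (\<forall>x\<in>H. \<forall>y\<in>H. T (x + y) = T x + T y) \<and>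
     (\<forall>c. \<forall>x\<in>H. T (c *\<^sub>C x) = c *\<^sub>C T x) \<and>
     (\<exists>C. \<forall>x\<in>H. norm (T x) \<le> C * norm x)}"

definition op_norm :: "'h::complex_inner set \<Rightarrow> ('h \<Rightarrow> 'k::complex_inner) \<Rightarrow> real" where
  "op_norm H T = (SUP x\<in>{x\<in>H. norm x \<le> 1}. norm (T x))"

definition op_id :: "'h set \<Rightarrow> 'h \<Rightarrow> 'h" where
  "op_id H = (\<lambda>x\<in>H. x)"

definition op_add :: "'h set \<Rightarrow> ('h \<Rightarrow> 'k::complex_inner) \<Rightarrow> ('h \<Rightarrow> 'k) \<Rightarrow> ('h \<Rightarrow> 'k)" where
  "op_add H S T = (\<lambda>x\<in>H. S x + T x)"

definition op_diff :: "'h set \<Rightarrow> ('h \<Rightarrow> 'k::complex_inner) \<Rightarrow> ('h \<Rightarrow> 'k) \<Rightarrow> ('h \<Rightarrow> 'k)" where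
  "op_diff H S T = (\<lambda>x\<in>H. S x - T x)"

definition op_scale :: "'h set \<Rightarrow> complex \<Rightarrow> ('h \<Rightarrow> 'k::complex_inner) \<Rightarrow> ('h \<Rightarrow> 'k)" where
  "op_scale H c T = (\<lambda>x\<in>H. c *\<^sub>C T x)"

definition adjoint_op ::
    "'h::complex_inner set \<Rightarrow> 'k::complex_inner set \<Rightarrow> ('h \<Rightarrow> 'k) \<Rightarrow> ('k \<Rightarrow> 'h)" where
  "adjoint_op H K T =
     (THE S. S \<in> bounded_ops K H \<and> (\<forall>x\<in>H. \<forall>y\<in>K. cinner (T x) y = cinner x (S y)))"

definition contraction :: "'h::complex_inner set \<Rightarrow> 'k::complex_inner set \<Rightarrow> ('h \<Rightarrow> 'k) \<Rightarrow> bool" where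
  "contraction H K R \<longleftrightarrow> R \<in> bounded_ops H K \<and> op_norm H R \<le> 1"

definition isometric :: "'h::complex_inner set \<Rightarrow> 'k::complex_inner set \<Rightarrow> ('h \<Rightarrow> 'k) \<Rightarrow> bool" where
  "isometric H K R \<longleftrightarrow> compose H (adjoint_op H K R) R = op_id H"


section \<open>Unital completely positive maps\<close>

text \<open>Positivity of an \<open>n \<times> n\<close> operator matrix \<open>(T i j)\<close>, \<open>i, j < n\<close>, as an operator on the
  direct sum of \<open>n\<close> copies of \<open>H\<close>.\<close>

definition positive_matrix :: "'h::complex_inner set \<Rightarrow> nat \<Rightarrow> (nat \<Rightarrow> nat \<Rightarrow> 'h \<Rightarrow> 'h) \<Rightarrow> bool" where
  "positive_matrix H n T \<longleftrightarrow>
     (\<forall>x. (\<forall>i<n. x i \<in> H) \<longrightarrow> (\<Sum>i<n. \<Sum>j<n. cinner (T i j (x j)) (x i)) \<in> \<real>\<^sub>\<ge>\<^sub>0)"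

definition ucp :: "'h::complex_inner set \<Rightarrow> (('h \<Rightarrow> 'h) \<Rightarrow> ('h \<Rightarrow> 'h)) \<Rightarrow> bool" where
  "ucp H \<Phi> \<longleftrightarrow>
     (\<forall>T\<in>bounded_ops H H. \<Phi> T \<in> bounded_ops H H) \<and>
     (\<forall>S\<in>bounded_ops H H. \<forall>T\<in>bounded_ops H H. \<Phi> (op_add H S T) = op_add H (\<Phi> S) (\<Phi> T)) \<and>
     (\<forall>c. \<forall>T\<in>bounded_ops H H. \<Phi> (op_scale H c T) = op_scale H c (\<Phi> T)) \<and>
     \<Phi> (op_id H) = op_id H \<and>
     (\<forall>n T. (\<forall>i<n. \<forall>j<n. T i j \<in> bounded_ops H H) \<longrightarrow> positive_matrix H n T \<longrightarrow>
        positive_matrix H n (\<lambda>i j. \<Phi> (T i j)))"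


section \<open>Unital C*-algebras\<close>

class unital_cstar_algebra = complex_vector + real_normed_algebra_1 + banach +
  fixes star :: "'a \<Rightarrow> 'a"
  assumes mult_scaleC_left: "(c *\<^sub>C a) * b = c *\<^sub>C (a * b)"
    and mult_scaleC_right: "a * (c *\<^sub>C b) = c *\<^sub>C (a * b)"
    and norm_scaleC: "norm (c *\<^sub>C a) = cmod c * norm a"
    and star_star: "star (star a) = a"
    and star_add: "star (a + b) = star a + star b"
    and star_scaleC: "star (c *\<^sub>C a) = cnj c *\<^sub>C star a"
    and star_mult: "star (a * b) = star b * star a"
    and cstar_identity: "norm (star a * a) = (norm a)\<^sup>2"

definition cstar_subalgebra :: "'a::unital_cstar_algebra set \<Rightarrow> bool" where
  "cstar_subalgebra B \<longleftrightarrow> csubspace B \<and> closed B \<and>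
     (\<forall>a\<in>B. \<forall>b\<in>B. a * b \<in> B) \<and> (\<forall>a\<in>B. star a \<in> B)"

definition generates :: "'a::unital_cstar_algebra set \<Rightarrow> bool" where
  "generates G \<longleftrightarrow> \<Inter>{B. cstar_subalgebra B \<and> G \<subseteq> B \<and> 1 \<in> B} = UNIV"

definition two_sided_ideal :: "'a::unital_cstar_algebra set \<Rightarrow> bool" where
  "two_sided_ideal J \<longleftrightarrow> csubspace J \<and> (\<forall>a. \<forall>b\<in>J. a * b \<in> J \<and> b * a \<in> J)"

definition clinear_functional :: "('a::unital_cstar_algebra \<Rightarrow> complex) \<Rightarrow> bool" where
  "clinear_functional \<phi> \<longleftrightarrow>
     (\<forall>a b. \<phi> (a + b) = \<phi> a + \<phi> b) \<and> (\<forall>c a. \<phi> (c *\<^sub>C a) = c * \<phi> a)"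

definition state :: "('a::unital_cstar_algebra \<Rightarrow> complex) \<Rightarrow> bool" where
  "state \<phi> \<longleftrightarrow> clinear_functional \<phi> \<and> (\<forall>a. \<phi> (star a * a) \<in> \<real>\<^sub>\<ge>\<^sub>0) \<and> \<phi> 1 = 1"

definition ker :: "('a::unital_cstar_algebra \<Rightarrow> complex) \<Rightarrow> 'a set" where
  "ker \<phi> = {a. \<phi> a = 0}"

definition character :: "('a::unital_cstar_algebra \<Rightarrow> complex) \<Rightarrow> bool" where
  "character \<phi> \<longleftrightarrow> clinear_functional \<phi> \<and> (\<forall>a b. \<phi> (a * b) = \<phi> a * \<phi> b) \<and>
     (\<forall>a. \<phi> (star a) = cnj (\<phi> a)) \<and> \<phi> 1 = 1"

definition representation ::
    "'h::complex_inner set \<Rightarrow> ('a::unital_cstar_algebra \<Rightarrow> 'h \<Rightarrow> 'h) \<Rightarrow> bool" where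
  "representation H \<pi> \<longleftrightarrow>
     (\<forall>a. \<pi> a \<in> bounded_ops H H) \<and>
     (\<forall>a b. \<pi> (a + b) = op_add H (\<pi> a) (\<pi> b)) \<and>
     (\<forall>c a. \<pi> (c *\<^sub>C a) = op_scale H c (\<pi> a)) \<and>
     (\<forall>a b. \<pi> (a * b) = compose H (\<pi> a) (\<pi> b)) \<and>
     (\<forall>a. \<pi> (star a) = adjoint_op H H (\<pi> a)) \<and>
     \<pi> 1 = op_id H"


section \<open>The sequence space \<open>\<ell>\<^sup>2\<close>\<close>

typedef ell2 = "{x :: nat \<Rightarrow> complex. summable (\<lambda>n. (cmod (x n))\<^sup>2)}"
  morphisms ell2_nth Abs_ell2
  by (rule exI[of _ "\<lambda>_. 0"]) simp

setup_lifting type_definition_ell2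

lemma ell2_summable_mult:
  fixes x y :: "nat \<Rightarrow> complex"
  assumes "summable (\<lambda>n. (cmod (x n))\<^sup>2)" "summable (\<lambda>n. (cmod (y n))\<^sup>2)"
  shows "summable (\<lambda>n. x n * cnj (y n))"
proof (rule summable_comparison_test)
  show "summable (\<lambda>n. (cmod (x n))\<^sup>2 + (cmod (y n))\<^sup>2)"
    using assms by (rule summable_add)
  have "norm (x n * cnj (y n)) \<le> (cmod (x n))\<^sup>2 + (cmod (y n))\<^sup>2" for n
  proof -
    have "2 * (cmod (x n) * cmod (y n)) \<le> (cmod (x n))\<^sup>2 + (cmod (y n))\<^sup>2"
      using sum_squares_bound[of "cmod (x n)" "cmod (y n)"] by (simp add: algebra_simps)
    moreover have "0 \<le> cmod (x n) * cmod (y n)" by simp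
    ultimately show ?thesis unfolding norm_mult complex_mod_cnj by linarith
  qed
  then show "\<exists>N. \<forall>n\<ge>N. norm (x n * cnj (y n)) \<le> (cmod (x n))\<^sup>2 + (cmod (y n))\<^sup>2"
    by blast
qed

lemma ell2_summable_add:
  fixes x y :: "nat \<Rightarrow> complex"
  assumes "summable (\<lambda>n. (cmod (x n))\<^sup>2)" "summable (\<lambda>n. (cmod (y n))\<^sup>2)"
  shows "summable (\<lambda>n. (cmod (x n + y n))\<^sup>2)"
proof (rule summable_comparison_test)
  show "summable (\<lambda>n. 2 * (cmod (x n))\<^sup>2 + 2 * (cmod (y n))\<^sup>2)"
    using assms by (intro summable_add summable_mult)
  have "(cmod (x n + y n))\<^sup>2 \<le> 2 * (cmod (x n))\<^sup>2 + 2 * (cmod (y n))\<^sup>2" for n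
  proof -
    have "(cmod (x n + y n))\<^sup>2 \<le> (cmod (x n) + cmod (y n))\<^sup>2"
      by (intro power_mono norm_triangle_ineq) simp
    also have "\<dots> \<le> 2 * (cmod (x n))\<^sup>2 + 2 * (cmod (y n))\<^sup>2"
      using sum_squares_bound[of "cmod (x n)" "cmod (y n)"]
      by (simp add: power2_sum algebra_simps)
    finally show ?thesis .
  qed
  then show "\<exists>N. \<forall>n\<ge>N. norm ((cmod (x n + y n))\<^sup>2) \<le> 2 * (cmod (x n))\<^sup>2 + 2 * (cmod (y n))\<^sup>2"
    by simp
qed

lemma ell2_summable_scale:
  fixes x :: "nat \<Rightarrow> complex"
  assumes "summable (\<lambda>n. (cmod (x n))\<^sup>2)"
  shows "summable (\<lambda>n. (cmod (c * x n))\<^sup>2)"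
  using summable_mult[OF assms, of "(cmod c)\<^sup>2"] by (simp add: norm_mult power_mult_distrib)

instantiation ell2 :: complex_vector
begin

lift_definition zero_ell2 :: ell2 is "\<lambda>_. 0" by simp

lift_definition plus_ell2 :: "ell2 \<Rightarrow> ell2 \<Rightarrow> ell2" is "\<lambda>x y n. x n + y n"
  by (rule ell2_summable_add)

lift_definition uminus_ell2 :: "ell2 \<Rightarrow> ell2" is "\<lambda>x n. - x n" by simp

lift_definition scaleC_ell2 :: "complex \<Rightarrow> ell2 \<Rightarrow> ell2" is "\<lambda>c x n. c * x n"
  by (rule ell2_summable_scale)

definition minus_ell2 :: "ell2 \<Rightarrow> ell2 \<Rightarrow> ell2" where
  "minus_ell2 x y = x + - y"

definition scaleR_ell2 :: "real \<Rightarrow> ell2 \<Rightarrow> ell2" where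
  "scaleR_ell2 r x = complex_of_real r *\<^sub>C x"

instance
  by standard
    (simp_all add: minus_ell2_def scaleR_ell2_def plus_ell2.rep_eq uminus_ell2.rep_eq
      zero_ell2.rep_eq scaleC_ell2.rep_eq fun_eq_iff algebra_simps flip: ell2_nth_inject)

end

lemma ell2_nth_summable: "summable (\<lambda>n. (cmod (ell2_nth x n))\<^sup>2)"
  using ell2_nth[of x] by simp

instantiation ell2 :: complex_inner
begin

definition cinner_ell2 :: "ell2 \<Rightarrow> ell2 \<Rightarrow> complex" where
  "cinner_ell2 x y = (\<Sum>n. ell2_nth x n * cnj (ell2_nth y n))"

definition inner_ell2 :: "ell2 \<Rightarrow> ell2 \<Rightarrow> real" where
  "inner_ell2 x y = Re (cinner x y)"

definition norm_ell2 :: "ell2 \<Rightarrow> real" where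
  "norm_ell2 x = sqrt (inner x x)"

definition sgn_ell2 :: "ell2 \<Rightarrow> ell2" where
  "sgn_ell2 x = inverse (norm x) *\<^sub>R x"

definition dist_ell2 :: "ell2 \<Rightarrow> ell2 \<Rightarrow> real" where
  "dist_ell2 x y = norm (x - y)"

definition uniformity_ell2 :: "(ell2 \<times> ell2) filter" where
  "uniformity_ell2 = (INF e\<in>{0<..}. principal {(x, y). dist x y < e})"

definition open_ell2 :: "ell2 set \<Rightarrow> bool" where
  "open_ell2 U = (\<forall>x\<in>U. \<forall>\<^sub>F (x', y) in uniformity. x' = x \<longrightarrow> y \<in> U)"

instance
proof
  fix x y z :: ell2 and c :: complex and r :: real and U :: "ell2 set"
  show "dist x y = norm (x - y)" by (rule dist_ell2_def)
  show "sgn x = x /\<^sub>R norm x" by (rule sgn_ell2_def)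
  show "uniformity = (INF e\<in>{0<..}. principal {(x::ell2, y). dist x y < e})"
    by (rule uniformity_ell2_def)
  show "open U = (\<forall>x\<in>U. \<forall>\<^sub>F (x', y) in uniformity. x' = x \<longrightarrow> y \<in> U)"
    by (rule open_ell2_def)
  show re: "inner x y = Re (cinner x y)" by (rule inner_ell2_def)
  show "norm x = sqrt (inner x x)" by (rule norm_ell2_def)
  have sm: "summable (\<lambda>n. ell2_nth u n * cnj (ell2_nth v n))" for u v
    by (intro ell2_summable_mult ell2_nth_summable)
  show comm: "cinner x y = cnj (cinner y x)" for x y :: ell2
  proof -
    have "(\<lambda>n. cnj (ell2_nth y n * cnj (ell2_nth x n))) sums cnj (cinner y x)"
      unfolding cinner_ell2_def sums_cnj by (rule summable_sums[OF sm])
    then show ?thesis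
      unfolding cinner_ell2_def[of x y] by (simp add: sums_iff mult.commute)
  qed
  show add: "cinner (x + y) z = cinner x z + cinner y z"
    using suminf_add[OF sm[of x z] sm[of y z]]
    by (simp add: cinner_ell2_def plus_ell2.rep_eq distrib_right)
  show sc: "cinner (c *\<^sub>C x) y = c * cinner x y" for c
    using suminf_mult[OF sm[of x y], of c]
    by (simp add: cinner_ell2_def scaleC_ell2.rep_eq mult.assoc)
  show "inner x y = inner y x"
    using comm[of x y] by (simp add: inner_ell2_def)
  show "inner (x + y) z = inner x z + inner y z"
    by (simp add: inner_ell2_def add)
  show "inner (r *\<^sub>R x) y = r * inner x y"
    by (simp add: inner_ell2_def scaleR_scaleC sc)
  have self: "inner x x = (\<Sum>n. (cmod (ell2_nth x n))\<^sup>2)"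
    unfolding inner_ell2_def cinner_ell2_def
    using bounded_linear.suminf[OF bounded_linear_Re sm[of x x]]
    by (simp add: complex_mult_cnj cmod_power2)
  show "0 \<le> inner x x"
    unfolding self by (intro suminf_nonneg ell2_nth_summable) simp
  show "inner x x = 0 \<longleftrightarrow> x = 0"
    unfolding self using suminf_eq_zero_iff[OF ell2_nth_summable[of x]]
    by (auto simp: zero_ell2.rep_eq simp flip: ell2_nth_inject)
qed

end


section \<open>Hyperrigidity\<close>

text \<open>The Hilbert spaces quantified over are the complete subspaces of \<open>\<ell>\<^sup>2\<close>. Every separable
  Hilbert space, of finite or infinite dimension, is unitarily equivalent to one of them, and
  faithfulness, complete positivity and norm convergence are unitarily invariant.\<close>

definition hyperrigid :: "'a::unital_cstar_algebra set \<Rightarrow> bool" where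
  "hyperrigid G \<longleftrightarrow> countable G \<and> generates G \<and>
     (\<forall>(H :: ell2 set) \<pi> \<Phi>.
        separable_hilbert_space H \<longrightarrow> representation H \<pi> \<longrightarrow> inj \<pi> \<longrightarrow> (\<forall>k::nat. ucp H (\<Phi> k)) \<longrightarrow>
        (\<forall>g\<in>G. (\<lambda>k. op_norm H (op_diff H (\<Phi> k (\<pi> g)) (\<pi> g))) \<longlonglongrightarrow> 0) \<longrightarrow>
        (\<forall>a. (\<lambda>k. op_norm H (op_diff H (\<Phi> k (\<pi> a)) (\<pi> a))) \<longlonglongrightarrow> 0))"

end

theory Submission
  imports Defs
begin

text \<open>
  Suppose first that a state \<open>\<phi>\<close> vanishes on \<open>G\<close>. The unital completely positive map
  \<open>a \<mapsto> R\<^sup>*\<rho>(a)R + \<phi>(a)(I - R\<^sup>*R)\<close> then agrees with \<open>\<pi>\<close> on \<open>G\<close>, and hyperrigidity forces it to be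
  \<open>\<pi>\<close> (\<open>hyperrigid_extension\<close>). The other claims about \<open>\<phi>\<close> follow from the multiplicativity of \<open>\<pi>\<close>
  (\<open>consequences_of_extension\<close>). Write \<open>q(x, y) = \<langle>(I - R\<^sup>*R)x, y\<rangle>\<close> and expand
  \<open>\<langle>\<pi>(a\<^sup>*a)x, x\<rangle> = \<langle>\<pi>(a)x, \<pi>(a)x\<rangle>\<close> by the formula for \<open>\<pi>\<close>; the outcome is that the three nonnegative numbers
  \<open>\<parallel>\<rho>(a)Rx - R\<pi>(a)x\<parallel>\<^sup>2\<close>, \<open>(\<phi>(a\<^sup>*a) - \<bar>\<phi>(a)\<bar>\<^sup>2) q(x, x)\<close> and \<open>q(y, y)\<close>, where \<open>y = \<phi>(a)x - \<pi>(a)x\<close>, add up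
  to 0. So \<open>R\<close> intertwines, and because \<open>q\<close> is not 0, \<open>\<phi>\<close> is a character with kernel \<open>J\<close>.

  Suppose next that no state vanishes on \<open>G\<close>. If \<open>R\<close> intertwined \<open>\<pi>\<close> and \<open>\<rho>\<close>, then \<open>J\<close> would be the
  ideal of all \<open>a\<close> with \<open>(I - R\<^sup>*R)\<pi>(a) = 0\<close> (\<open>ideal_of_intertwining\<close>). If \<open>J\<close> were an ideal, then
  \<open>J + \<complex>1\<close> would be a C*-algebra that contains \<open>G\<close>, hence the whole algebra, and the projection
  to \<open>\<complex>1\<close> along \<open>J\<close> would be a character that vanishes on \<open>G\<close> (\<open>state_of_ideal\<close>).

  The labour lies in \<open>hyperrigid_extension\<close>. Hyperrigidity speaks of a faithful representation on a closed
  subspace of the sequence space and of completely positive maps on all its operators, and both have to be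
  constructed. A faithful representation rests on the Gelfand-Naimark argument: elements \<open>x\<^sup>*x\<close> are positive
  (\<open>cpos_star_mult\<close>), so the Hahn-Banach theorem gives a state that attains the norm of \<open>x\<close>
  (\<open>state_attaining_norm\<close>), and since the algebra is separable, countably many such states combine to a
  faithful one (\<open>faithful_state_exists\<close>). The GNS spaces of this state and of \<open>\<phi>\<close>, together with \<open>H\<close> and \<open>K\<close>,
  make one semidefinite form, which Gram-Schmidt orthogonalisation realises in the sequence space
  (\<open>ell2_embedding\<close>). On the closure of its range, operators come from bounded forms (\<open>form_operator\<close>);
  this provides the representation (\<open>representation_of_action\<close>) and the completely positive map
  (\<open>compression_ucp\<close>). Its positivity uses that entrywise products of positive matrices are positive.
\<close>

section \<open>Elementary algebra in a C*-algebra\<close>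

lemma scaleC_one [simp]: "1 *\<^sub>C (x :: 'a::complex_vector) = x"
  using scaleR_scaleC[of 1 x] by simp

lemma scaleC_zero_left [simp]: "0 *\<^sub>C (x :: 'a::complex_vector) = 0"
  using scaleR_scaleC[of 0 x] by simp

lemma scaleC_zero_right [simp]: "c *\<^sub>C (0 :: 'a::complex_vector) = 0"
  using scaleC_add_right[of c 0 0] by simp

lemma scaleC_minus1: "- (x :: 'a::complex_vector) = (-1) *\<^sub>C x"
  using scaleR_scaleC[of "-1" x] by simp

lemma scaleC_minus_right: "c *\<^sub>C (- (x :: 'a::complex_vector)) = - (c *\<^sub>C x)"
  by (simp add: scaleC_minus1 scaleC_scaleC)

lemma scaleC_minus_left: "(- c) *\<^sub>C (x :: 'a::complex_vector) = - (c *\<^sub>C x)"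
  by (simp add: scaleC_minus1 scaleC_scaleC)

lemma scaleC_diff_right: "c *\<^sub>C (x - y :: 'a::complex_vector) = c *\<^sub>C x - c *\<^sub>C y"
  using scaleC_add_right[of c x "- y"] by (simp add: scaleC_minus_right)

lemma scaleC_diff_left: "(c - d) *\<^sub>C (x :: 'a::complex_vector) = c *\<^sub>C x - d *\<^sub>C x"
  using scaleC_add_left[of c "- d" x] by (simp add: scaleC_minus_left)

lemma star_scaleR [simp]: "star (r *\<^sub>R x) = r *\<^sub>R star (x :: 'a::unital_cstar_algebra)"
  by (simp add: scaleR_scaleC star_scaleC)

lemma star_zero [simp]: "star (0 :: 'a::unital_cstar_algebra) = 0"
  using star_add[of "0::'a" 0] by simp

lemma star_minus [simp]: "star (- x :: 'a::unital_cstar_algebra) = - star x"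
  using star_scaleR[of "-1" x] by simp

lemma star_diff: "star (x - y :: 'a::unital_cstar_algebra) = star x - star y"
  using star_add[of x "- y"] by simp

lemma star_one [simp]: "star (1 :: 'a::unital_cstar_algebra) = 1"
  by (metis mult.right_neutral star_mult star_star)

lemma star_of_real [simp]: "star (of_real r :: 'a::unital_cstar_algebra) = of_real r"
  by (simp add: of_real_def)

lemma star_power: "star (x ^ n :: 'a::unital_cstar_algebra) = star x ^ n"
  by (induction n) (simp_all add: star_mult power_commutes)

lemma norm_star [simp]: "norm (star x) = norm (x :: 'a::unital_cstar_algebra)"
proof -
  have *: "norm y \<le> norm (star y)" for y :: 'a
  proof (cases "y = 0")
    case False
    have "norm y * norm y \<le> norm (star y) * norm y"
      using norm_mult_ineq[of "star y" y] by (simp add: cstar_identity power2_eq_square)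
    with False show ?thesis by simp
  qed simp
  show ?thesis using *[of x] *[of "star x"] by (simp add: star_star)
qed

lemma bounded_linear_star: "bounded_linear (star :: 'a::unital_cstar_algebra \<Rightarrow> 'a)"
  by (rule bounded_linear_intro[where K=1]) (simp_all add: star_add)

lemma norm_square_selfadjoint:
  "star x = x \<Longrightarrow> norm (x * x) = (norm (x :: 'a::unital_cstar_algebra))\<^sup>2"
  using cstar_identity[of x] by simp

lemma norm_isometry:
  "star u * u = 1 \<Longrightarrow> norm (u :: 'a::unital_cstar_algebra) = 1"
  using cstar_identity[of u] power2_eq_1_iff[of "norm u"] norm_ge_zero[of u] by fastforce


section \<open>Square roots of \<open>1 - x\<close>\<close>

text \<open>The coefficients of the power series of \<open>sqrt (1 - x)\<close>.\<close>

definition sqrt_coeff :: "nat \<Rightarrow> real" where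
  "sqrt_coeff n = (-1) ^ n * ((1/2) gchoose n)"

lemma sqrt_coeff_0 [simp]: "sqrt_coeff 0 = 1"
  by (simp add: sqrt_coeff_def)

lemma sqrt_coeff_nonpos: "n \<noteq> 0 \<Longrightarrow> sqrt_coeff n \<le> 0"
proof -
  assume "n \<noteq> 0"
  then obtain m where n: "n = Suc m" by (cases n) auto
  have "sqrt_coeff n = pochhammer (- (1/2)) n / fact n"
    by (simp add: sqrt_coeff_def gbinomial_pochhammer flip: power_mult_distrib mult.assoc)
  also have "pochhammer (- (1/2 :: real)) n = - (1/2) * pochhammer (1/2) m"
    by (simp add: n pochhammer_rec)
  finally show ?thesis
    using pochhammer_nonneg[of "1/2 :: real" m] by (simp add: divide_nonpos_pos)
qed

lemma sqrt_coeff_partial_sum: "(\<Sum>k\<le>n. sqrt_coeff k) \<ge> 0"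
proof -
  have "(\<Sum>k\<le>n. sqrt_coeff k) = (-1) ^ n * (- (1/2) gchoose n)"
    using gbinomial_sum_lower_neg[of "1/2 :: real" n]
    by (simp add: sqrt_coeff_def mult.commute)
  also have "\<dots> = pochhammer (1/2) n / fact n"
    by (simp add: gbinomial_pochhammer flip: power_mult_distrib mult.assoc)
  finally show ?thesis
    using pochhammer_nonneg[of "1/2 :: real" n] by simp
qed

text \<open>All coefficients but the first are negative and the partial sums stay nonnegative, so the
  absolute values sum to at most 2. The series therefore still converges on the boundary
  \<open>norm x = 1\<close>, which gives square roots of elements that are positive but not invertible.\<close>

lemma sqrt_coeff_tail:
  shows summable_sqrt_coeff: "summable (\<lambda>n. \<bar>sqrt_coeff n\<bar>)"
    and suminf_sqrt_coeff_tail: "(\<Sum>n. \<bar>sqrt_coeff (Suc n)\<bar>) \<le> 1"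
proof -
  have bd: "(\<Sum>k<n. \<bar>sqrt_coeff (Suc k)\<bar>) \<le> 1" for n
  proof -
    have "(\<Sum>k<n. \<bar>sqrt_coeff (Suc k)\<bar>) = - (\<Sum>k<n. sqrt_coeff (Suc k))"
      unfolding sum_negf[symmetric] using sqrt_coeff_nonpos by (intro sum.cong) auto
    also have "(\<Sum>k<n. sqrt_coeff (Suc k)) = (\<Sum>k\<le>n. sqrt_coeff k) - 1"
      by (simp add: sum.atMost_shift)
    finally show ?thesis using sqrt_coeff_partial_sum[of n] by linarith
  qed
  have s: "summable (\<lambda>n. \<bar>sqrt_coeff (Suc n)\<bar>)"
    by (rule summableI_nonneg_bounded[where x=1]) (use bd in auto)
  then show "summable (\<lambda>n. \<bar>sqrt_coeff n\<bar>)" by (subst (asm) summable_Suc_iff)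
  show "(\<Sum>n. \<bar>sqrt_coeff (Suc n)\<bar>) \<le> 1"
    by (rule suminf_le_const[OF s bd])
qed

text \<open>Vandermonde's identity for \<open>1/2 + 1/2 = 1\<close>: the square of the series is \<open>1 - x\<close>.\<close>

lemma sqrt_coeff_convolution:
  "(\<Sum>i\<le>k. sqrt_coeff i * sqrt_coeff (k - i)) = (if k = 0 then 1 else if k = 1 then -1 else 0)"
proof -
  have "(\<Sum>i\<le>k. sqrt_coeff i * sqrt_coeff (k - i)) =
      (\<Sum>i\<le>k. (-1) ^ k * ((1/2 gchoose i) * (1/2 gchoose (k - i))))"
  proof (intro sum.cong refl)
    fix i assume "i \<in> {..k}"
    then have "(-1 :: real) ^ k = (-1) ^ i * (-1) ^ (k - i)"
      by (simp flip: power_add)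
    then show "sqrt_coeff i * sqrt_coeff (k - i) = (-1) ^ k * ((1/2 gchoose i) * (1/2 gchoose (k - i)))"
      by (simp add: sqrt_coeff_def)
  qed
  also have "\<dots> = (-1) ^ k * (1 gchoose k)"
    using gbinomial_Vandermonde[of "1/2 :: real" "1/2" k]
    by (simp add: atMost_atLeast0 flip: sum_distrib_left)
  also have "(1 gchoose k :: real) = of_nat (1 choose k)"
    by (simp add: binomial_gbinomial)
  finally show ?thesis by (cases k rule: nat.exhaust) (auto simp: binomial_eq_0)
qed

text \<open>The root is a norm limit of polynomials in \<open>x\<close>, hence commutes with the commutant of \<open>x\<close>.
  The bound on \<open>1 - b\<close> is what makes the root itself positive.\<close>

lemma sqrt_one_minus:
  fixes x :: "'a::unital_cstar_algebra"
  assumes x: "norm x \<le> 1" and sa: "star x = x"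
  obtains b where "star b = b" "b * b = 1 - x" "norm (1 - b) \<le> 1"
    "\<And>y. x * y = y * x \<Longrightarrow> b * y = y * b"
proof -
  define f where "f n = sqrt_coeff n *\<^sub>R x ^ n" for n
  have fn: "norm (f n) \<le> \<bar>sqrt_coeff n\<bar>" for n
  proof -
    have "norm (x ^ n) \<le> 1"
      using norm_power_ineq[of x n] power_le_one[OF norm_ge_zero x, of n] by linarith
    then show ?thesis
      using mult_left_le[of "norm (x ^ n)" "\<bar>sqrt_coeff n\<bar>"] by (simp add: f_def)
  qed
  have sn: "summable (\<lambda>n. norm (f n))"
    by (rule summable_comparison_test'[OF summable_sqrt_coeff, of 0]) (use fn in auto)
  then have sf: "summable f" by (rule summable_norm_cancel)
  define b where "b = suminf f"
  have 1: "star b = b"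
    unfolding b_def bounded_linear.suminf[OF bounded_linear_star sf]
    by (intro arg_cong[of _ _ suminf] ext) (simp add: f_def star_power sa)
  have conv: "(\<Sum>i\<le>k. f i * f (k - i)) = (if k = 0 then 1 else if k = 1 then - x else 0)" for k
  proof -
    have "(\<Sum>i\<le>k. f i * f (k - i)) = (\<Sum>i\<le>k. (sqrt_coeff i * sqrt_coeff (k - i)) *\<^sub>R x ^ k)"
      by (intro sum.cong) (auto simp: f_def simp flip: power_add)
    also have "\<dots> = (if k = 0 then 1 else if k = 1 then -1 else 0) *\<^sub>R x ^ k"
      by (simp only: scaleR_sum_left[symmetric] sqrt_coeff_convolution)
    finally show ?thesis by simp
  qed
  have "(\<lambda>k. \<Sum>i\<le>k. f i * f (k - i)) sums (b * b)"
    unfolding b_def by (rule Cauchy_product_sums[OF sn sn])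
  moreover have "(\<lambda>k. \<Sum>i\<le>k. f i * f (k - i)) sums (1 - x)"
    unfolding conv using sums_finite[of "{0,1}" "\<lambda>k. if k = 0 then 1 else if k = 1 then - x else 0"]
    by simp
  ultimately have 2: "b * b = 1 - x" by (rule sums_unique2)
  have "b = f 0 + (\<Sum>n. f (Suc n))"
    using suminf_split_head[OF sf] by (simp add: b_def)
  then have "norm (1 - b) = norm (\<Sum>n. f (Suc n))" by (simp add: f_def)
  also have "\<dots> \<le> (\<Sum>n. norm (f (Suc n)))"
    by (rule summable_norm) (use sn in \<open>subst summable_Suc_iff\<close>)
  also have "\<dots> \<le> (\<Sum>n. \<bar>sqrt_coeff (Suc n)\<bar>)"
    by (rule suminf_le[OF fn])
      (use sn summable_sqrt_coeff in \<open>simp_all add: summable_Suc_iff[of "\<lambda>n. norm (f n)"]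
        summable_Suc_iff[of "\<lambda>n. \<bar>sqrt_coeff n\<bar>"]\<close>)
  also have "\<dots> \<le> 1" by (rule suminf_sqrt_coeff_tail)
  finally have 3: "norm (1 - b) \<le> 1" .
  have 4: "b * y = y * b" if "x * y = y * x" for y
  proof -
    have "x ^ n * y = y * x ^ n" for n
      using that by (metis power_commuting_commutes)
    then have "f n * y = y * f n" for n by (simp add: f_def)
    then show ?thesis
      unfolding b_def suminf_mult[OF sf, symmetric] suminf_mult2[OF sf] by simp
  qed
  show ?thesis by (rule that[OF 1 2 3 4])
qed


section \<open>The positive cone\<close>

text \<open>For a self-adjoint element this says that the spectrum lies in \<open>[0, 2t]\<close>. Positivity stated through
  the norm (after Kelley and Vaught) gives a closed convex cone without any spectral theory.\<close>

definition cpos :: "'a::unital_cstar_algebra \<Rightarrow> bool" where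
  "cpos h \<longleftrightarrow> star h = h \<and> (\<exists>t. norm (of_real t - h) \<le> t)"

lemma cpos_selfadjoint: "cpos h \<Longrightarrow> star h = h"
  by (simp add: cpos_def)

lemma cpos_scale: "cpos h \<Longrightarrow> 0 \<le> r \<Longrightarrow> cpos (r *\<^sub>R h)"
proof -
  assume h: "cpos h" and r: "0 \<le> r"
  then obtain t where t: "norm (of_real t - h) \<le> t" by (auto simp: cpos_def)
  have "of_real (r * t) - r *\<^sub>R h = r *\<^sub>R (of_real t - h)"
    by (simp add: of_real_def scaleR_right_diff_distrib)
  then have "norm (of_real (r * t) - r *\<^sub>R h) \<le> r * t"
    using t r by (simp add: mult_left_mono)
  then show ?thesis using h unfolding cpos_def by (metis star_scaleR)
qed

lemma cpos_add: "cpos g \<Longrightarrow> cpos h \<Longrightarrow> cpos (g + h)"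
proof -
  assume g: "cpos g" and h: "cpos h"
  obtain s t where "norm (of_real s - g) \<le> s" "norm (of_real t - h) \<le> t"
    using g h by (auto simp: cpos_def)
  then have "norm (of_real (s + t) - (g + h)) \<le> s + t"
    using norm_triangle_ineq[of "of_real s - g" "of_real t - h"] by (simp add: algebra_simps)
  then show ?thesis using g h unfolding cpos_def by (metis star_add)
qed

lemma cpos_of_real: "0 \<le> r \<Longrightarrow> cpos (of_real r)"
  unfolding cpos_def by (auto intro: exI[of _ r])

lemma cpos_sqrt:
  fixes h :: "'a::unital_cstar_algebra"
  assumes "cpos h"
  obtains k where "cpos k" "k * k = h" "\<And>y. h * y = y * h \<Longrightarrow> k * y = y * k"
proof -
  obtain t where t: "norm (of_real t - h) \<le> t" and sa: "star h = h"
    using assms by (auto simp: cpos_def)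
  have "t \<ge> 0" using t norm_ge_zero order_trans by blast
  show ?thesis
  proof (cases "t = 0")
    case True
    then have "h = 0" using t by simp
    then show ?thesis
      using that[of 0] cpos_of_real[of 0] by simp
  next
    case False
    then have t0: "t > 0" using \<open>t \<ge> 0\<close> by simp
    define x where "x = 1 - (1/t) *\<^sub>R h"
    have "x = (1/t) *\<^sub>R (of_real t - h)"
      using t0 by (simp add: x_def of_real_def scaleR_right_diff_distrib)
    then have "norm x \<le> 1" using t t0 by simp
    moreover have "star x = x" by (simp add: x_def star_diff sa)
    ultimately obtain b where b: "star b = b" "b * b = 1 - x" "norm (1 - b) \<le> 1"
      and comm: "\<And>y. x * y = y * x \<Longrightarrow> b * y = y * b"
      using sqrt_one_minus by blast
    have "cpos b" unfolding cpos_def using b by (auto intro: exI[of _ 1])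
    show ?thesis
    proof (rule that[of "sqrt t *\<^sub>R b"])
      show "cpos (sqrt t *\<^sub>R b)" using \<open>cpos b\<close> t0 by (intro cpos_scale) auto
      show "sqrt t *\<^sub>R b * sqrt t *\<^sub>R b = h" using t0 b by (simp add: x_def)
      show "sqrt t *\<^sub>R b * y = y * sqrt t *\<^sub>R b" if "h * y = y * h" for y
        using comm[of y] that by (simp add: x_def algebra_simps)
    qed
  qed
qed

text \<open>With \<open>b\<close> the square root of \<open>1 - h\<^sup>2\<close>, the element \<open>u = h + ib\<close> is unitary, and \<open>b\<close> is its
  imaginary part. So \<open>b\<close> is a contraction and \<open>norm (1 - h\<^sup>2) = (norm b)\<^sup>2\<close> is at most 1. This is the
  substitute for the fact that a self-adjoint element has real spectrum.\<close>

lemma norm_one_minus_square_le: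
  fixes h :: "'a::unital_cstar_algebra"
  assumes sa: "star h = h" and h: "norm h \<le> 1"
  shows "norm (1 - h * h) \<le> 1"
proof -
  have "norm (h * h) \<le> 1"
    using h by (simp add: norm_square_selfadjoint[OF sa] power_le_one)
  moreover have "star (h * h) = h * h" by (simp add: star_mult sa)
  ultimately obtain b where b: "star b = b" "b * b = 1 - h * h"
    and comm: "\<And>y. h * h * y = y * (h * h) \<Longrightarrow> b * y = y * b"
    using sqrt_one_minus by blast
  have bh: "b * h = h * b" by (rule comm) (simp add: mult.assoc)
  define u where "u = h + \<i> *\<^sub>C b"
  have su: "star u = h - \<i> *\<^sub>C b"
    by (simp add: u_def star_add star_scaleC sa b scaleC_minus_left)
  have "star u * u = h * h + b * b"
    unfolding su unfolding u_def
    by (simp add: algebra_simps mult_scaleC_left mult_scaleC_right scaleC_scaleC bh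
        scaleC_diff_right scaleC_add_right flip: scaleC_minus1)
  then have "norm u = 1" using b norm_isometry by simp
  moreover have "2 *\<^sub>R b = (- \<i>) *\<^sub>C (u - star u)"
    unfolding su unfolding u_def
    by (simp add: scaleR_scaleC scaleC_diff_right scaleC_add_right scaleC_scaleC flip: scaleC_add_left)
      (simp add: complex_eq_iff arg_cong[where f="\<lambda>c. c *\<^sub>C b"])
  then have "2 * norm b = norm (u - star u)" 
    by (metis norm_scaleR norm_scaleC abs_numeral norm_minus_cancel norm_ii mult_1)
  ultimately have "norm b \<le> 1"
    using norm_triangle_ineq4[of u "star u"] by simp
  then have "norm (b * b) \<le> 1"
    by (simp add: norm_square_selfadjoint[OF b(1)] power_le_one)
  then show ?thesis by (simp add: b)
qed

lemma norm_of_real_minus_square_le: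
  fixes h :: "'a::unital_cstar_algebra"
  assumes sa: "star h = h" and h: "(norm h)\<^sup>2 \<le> t"
  shows "norm (of_real t - h * h) \<le> t"
proof (cases "t = 0")
  case True
  then show ?thesis using h by simp
next
  case False
  then have t: "t > 0" using h zero_le_power2[of "norm h"] by linarith
  define g where "g = (1 / sqrt t) *\<^sub>R h"
  have "star g = g" by (simp add: g_def sa)
  moreover have "norm g \<le> 1"
    using h t real_le_rsqrt[OF h] by (simp add: g_def)
  ultimately have "norm (1 - g * g) \<le> 1" by (rule norm_one_minus_square_le)
  moreover have "of_real t - h * h = t *\<^sub>R (1 - g * g)"
    using t by (simp add: g_def scaleR_right_diff_distrib of_real_def)
  ultimately show ?thesis using t by (simp add: mult_left_le)
qed

lemma cpos_square: "star h = h \<Longrightarrow> cpos (h * h)"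
  unfolding cpos_def using norm_of_real_minus_square_le[of h "(norm h)\<^sup>2"]
  by (metis order_refl star_mult)

lemma cpos_of_real_minus:
  fixes h :: "'a::unital_cstar_algebra"
  shows "star h = h \<Longrightarrow> norm h \<le> t \<Longrightarrow> cpos (of_real t - h)"
  unfolding cpos_def by (auto simp: star_diff intro: exI[of _ t])

lemma cpos_norm_bound:
  fixes h :: "'a::unital_cstar_algebra"
  assumes "cpos h" "norm h \<le> t"
  shows "norm (of_real t - h) \<le> t"
proof -
  obtain k where k: "cpos k" "k * k = h" using cpos_sqrt[OF assms(1)] by blast
  then have "(norm k)\<^sup>2 \<le> t"
    using assms(2) norm_square_selfadjoint[OF cpos_selfadjoint[OF k(1)]] by simp
  then show ?thesis
    using norm_of_real_minus_square_le[OF cpos_selfadjoint[OF k(1)]] k by simp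
qed

text \<open>The same device: if \<open>h = k\<^sup>2\<close> and \<open>t - h = l\<^sup>2\<close> with commuting \<open>k\<close>, \<open>l\<close>, then \<open>w = k + il\<close>
  satisfies \<open>star w * w = t\<close>, and \<open>k\<close> is the real part of \<open>w\<close>.\<close>

lemma norm_le_of_cpos_diff:
  fixes h :: "'a::unital_cstar_algebra"
  assumes h: "cpos h" and d: "cpos (of_real t - h)" and t: "0 \<le> t"
  shows "norm h \<le> t"
proof -
  obtain k where k: "cpos k" "k * k = h" and kc: "\<And>y. h * y = y * h \<Longrightarrow> k * y = y * k"
    using cpos_sqrt[OF h] by blast
  obtain l where l: "cpos l" "l * l = of_real t - h"
    and lc: "\<And>y. (of_real t - h) * y = y * (of_real t - h) \<Longrightarrow> l * y = y * l"
    using cpos_sqrt[OF d] by blast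
  have sk: "star k = k" and sl: "star l = l" using k l cpos_selfadjoint by auto
  have hk: "h * k = k * h" using k(2) by (metis mult.assoc)
  have lk: "l * k = k * l"
    by (rule lc) (simp add: algebra_simps hk of_real_def)
  define w where "w = k + \<i> *\<^sub>C l"
  have sw: "star w = k - \<i> *\<^sub>C l"
    by (simp add: w_def star_add star_scaleC sk sl scaleC_minus_left)
  have "star w * w = k * k + l * l"
    unfolding sw unfolding w_def
    by (simp add: algebra_simps mult_scaleC_left mult_scaleC_right scaleC_scaleC lk
        scaleC_diff_right scaleC_add_right flip: scaleC_minus1)
  then have "star w * w = of_real t" by (simp add: k l)
  then have nw: "(norm w)\<^sup>2 = t" using cstar_identity[of w] t by simp
  have "2 *\<^sub>R k = w + star w"
    unfolding sw unfolding w_def by (simp add: scaleR_2)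
  then have "2 * norm k = norm (w + star w)" by (metis norm_scaleR abs_numeral)
  then have "norm k \<le> norm w" using norm_triangle_ineq[of w "star w"] by simp
  then have "(norm k)\<^sup>2 \<le> (norm w)\<^sup>2" by (simp add: power_mono)
  then show ?thesis using nw k norm_square_selfadjoint[OF sk] by simp
qed

lemma cpos_norm_mono:
  fixes u :: "'a::unital_cstar_algebra"
  assumes u: "cpos u" and v: "cpos v"
  shows "norm u \<le> norm (u + v)"
proof -
  have "cpos (of_real (norm (u + v)) - (u + v))"
    using cpos_of_real_minus cpos_selfadjoint[OF cpos_add[OF u v]] by blast
  from cpos_add[OF this v] have "cpos (of_real (norm (u + v)) - u)"
    by (simp add: algebra_simps)
  then show ?thesis using norm_le_of_cpos_diff[OF u] by simp
qed

lemma cpos_mult: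
  fixes x :: "'a::unital_cstar_algebra"
  assumes x: "cpos x" and y: "cpos y" and xy: "x * y = y * x"
  shows "cpos (x * y)"
proof -
  obtain k where k: "cpos k" "k * k = x" and kc: "\<And>z. x * z = z * x \<Longrightarrow> k * z = z * k"
    using cpos_sqrt[OF x] by blast
  obtain l where l: "cpos l" "l * l = y" and lc: "\<And>z. y * z = z * y \<Longrightarrow> l * z = z * l"
    using cpos_sqrt[OF y] by blast
  have lk: "l * k = k * l" using lc kc[OF xy] by simp
  have "star (k * l) = k * l"
    using k l lk by (simp add: star_mult cpos_selfadjoint)
  then have "cpos ((k * l) * (k * l))" by (rule cpos_square)
  moreover have "(k * l) * (k * l) = x * y"
    using lk k l by (metis mult.assoc)
  ultimately show ?thesis by simp
qed

lemma real_imag_parts: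
  fixes y :: "'a::unital_cstar_algebra"
  obtains a b where "star a = a" "star b = b" "y = a + \<i> *\<^sub>C b"
proof
  let ?a = "(1/2) *\<^sub>R (y + star y)" and ?b = "(1/2) *\<^sub>R ((- \<i>) *\<^sub>C (y - star y))"
  show "star ?a = ?a" by (simp add: star_add star_star add.commute)
  show "star ?b = ?b"
    by (simp add: star_scaleC star_diff star_star scaleC_minus_left scaleC_diff_right)
  show "y = ?a + \<i> *\<^sub>C ?b"
    by (simp add: scaleR_scaleC scaleC_scaleC scaleC_diff_right scaleC_add_right
        flip: scaleC_add_left)
qed


lemma star_mult_imag_parts:
  fixes a b :: "'a::unital_cstar_algebra"
  assumes "star a = a" "star b = b" and y: "y = a + \<i> *\<^sub>C b"
  shows "star y * y + y * star y = 2 *\<^sub>R (a * a) + 2 *\<^sub>R (b * b)"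
proof -
  have sy: "star y = a - \<i> *\<^sub>C b"
    by (simp add: y star_add star_scaleC assms scaleC_minus_left)
  show ?thesis
    unfolding sy unfolding y by (simp add: algebra_simps mult_scaleC_left mult_scaleC_right scaleC_scaleC
        scaleC_diff_right scaleC_add_right scaleR_2 flip: scaleC_minus1)
qed

text \<open>The first two terms of the binomial expansion of \<open>(1 + c) ^ n * c\<close>; the remaining terms are
  nonnegative multiples of powers of \<open>c\<close>. For \<open>c \<noteq> 0\<close> this expression must grow with \<open>n\<close>.\<close>

lemma cpos_power_lower_bound:
  fixes c :: "'a::unital_cstar_algebra"
  assumes c: "cpos c"
  shows "\<exists>q. cpos q \<and> q * c = c * q \<and> (1 + c) ^ n * c = c + of_nat n * (c * c) + q"
proof (induction n)
  case 0
  show ?case using cpos_of_real[of 0] by (auto intro!: exI[of _ 0])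
next
  case (Suc n)
  then obtain q where q: "cpos q" "q * c = c * q"
    and eq: "(1 + c) ^ n * c = c + of_nat n * (c * c) + q" by blast
  have cc: "cpos (c * c)" by (rule cpos_mult[OF c c refl])
  have ccc: "cpos (c * (c * c))" by (rule cpos_mult[OF c cc]) (simp add: mult.assoc)
  let ?q = "real n *\<^sub>R (c * (c * c)) + q + c * q"
  have "cpos ?q"
    by (intro cpos_add cpos_scale ccc q cpos_mult c) (simp_all add: q)
  moreover have "?q * c = c * ?q"
    using q by (simp add: algebra_simps)
  moreover have "(1 + c) ^ Suc n * c = c + of_nat (Suc n) * (c * c) + ?q"
  proof -
    have on: "of_nat n * z = real n *\<^sub>R z" for z :: 'a
      by (metis of_real_of_nat_eq scaleR_conv_of_real)
    have "(1 + c) ^ Suc n * c = (1 + c) * ((1 + c) ^ n * c)" by (simp add: mult.assoc)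
    also have "\<dots> = (1 + c) * (c + real n *\<^sub>R (c * c) + q)" by (simp only: eq on)
    finally show ?thesis by (simp add: algebra_simps on)
  qed
  ultimately show ?case by blast
qed

text \<open>The nonzero spectra of \<open>y\<^sup>*y\<close> and \<open>yy\<^sup>*\<close> agree, while here the first is nonpositive and the
  second nonnegative, because \<open>y\<^sup>*y + yy\<^sup>*\<close> is a sum of squares. Powers replace spectra: \<open>1 + d\<close> and \<open>z\<close> below are \<open>1 - y\<^sup>*y/t\<close> and
  \<open>1 - yy\<^sup>*/t\<close>, so \<open>y\<^sup>*\<close> intertwines them and \<open>(1 + d) ^ n y\<^sup>* = y\<^sup>* z ^ n\<close> stays bounded because
  \<open>z\<close> is a contraction. Growth of \<open>(1 + d) ^ n d\<close> then forces \<open>d = 0\<close>.\<close>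

lemma negative_star_mult_zero:
  fixes y :: "'a::unital_cstar_algebra"
  assumes c: "cpos c" and yc: "star y * y = - c"
  shows "y = 0"
proof -
  obtain a b where ab: "star a = a" "star b = b" "y = a + \<i> *\<^sub>C b"
    by (rule real_imag_parts)
  define p where "p = y * star y"
  have "p = 2 *\<^sub>R (a * a) + 2 *\<^sub>R (b * b) + c"
    using star_mult_imag_parts[OF ab] yc by (simp add: p_def algebra_simps)
  then have p: "cpos p"
    by (simp add: cpos_add cpos_scale cpos_square ab c)
  \<comment> \<open>the summand 1 only ensures that \<open>t\<close> is positive\<close>
  define t where "t = norm p + 1"
  have t: "t > 0" by (simp add: t_def add_nonneg_pos)
  define d where "d = (1 / t) *\<^sub>R c"
  define z where "z = 1 - (1 / t) *\<^sub>R p"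
  have d: "cpos d" unfolding d_def using c t by (simp add: cpos_scale)
  have "z = (1 / t) *\<^sub>R (of_real t - p)"
    using t by (simp add: z_def scaleR_right_diff_distrib of_real_def)
  moreover have "norm (of_real t - p) \<le> t"
    by (rule cpos_norm_bound[OF p]) (simp add: t_def)
  ultimately have z: "norm z \<le> 1" using t by simp
  have "c * star y = - (star y * p)"
    unfolding p_def using yc by (metis minus_mult_left minus_minus mult.assoc)
  then have inter: "(1 + d) * star y = star y * z"
    by (simp add: d_def z_def algebra_simps)
  have pow: "(1 + d) ^ n * star y = star y * z ^ n" for n
  proof (induction n)
    case (Suc n)
    have "(1 + d) ^ Suc n * star y = (1 + d) * ((1 + d) ^ n * star y)" by (simp add: mult.assoc)
    also have "\<dots> = (1 + d) * star y * z ^ n" by (simp add: Suc mult.assoc)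
    finally show ?case by (simp add: inter mult.assoc)
  qed simp
  have bound: "real n * norm (d * d) \<le> (norm y)\<^sup>2 / t" for n
  proof -
    obtain q where q: "cpos q" "(1 + d) ^ n * d = d + of_nat n * (d * d) + q"
      using cpos_power_lower_bound[OF d] by blast
    have nd: "of_nat n * (d * d) = real n *\<^sub>R (d * d)"
      by (metis of_real_of_nat_eq scaleR_conv_of_real)
    have "real n * norm (d * d) = norm (real n *\<^sub>R (d * d))" by simp
    also have "\<dots> \<le> norm (real n *\<^sub>R (d * d) + (d + q))"
      by (intro cpos_norm_mono cpos_scale cpos_add d q cpos_mult) auto
    also have "real n *\<^sub>R (d * d) + (d + q) = (1 + d) ^ n * d"
      by (simp add: q nd algebra_simps)
    also have "\<dots> = (1 + d) ^ n * (- (1 / t) *\<^sub>R (star y * y))"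
      by (simp add: yc d_def)
    also have "\<dots> = - (1 / t) *\<^sub>R ((1 + d) ^ n * star y * y)"
      by (simp add: mult.assoc)
    also have "\<dots> = - (1 / t) *\<^sub>R (star y * z ^ n * y)" by (simp only: pow)
    also have "norm \<dots> \<le> (1 / t) * (norm y * 1 * norm y)"
    proof -
      have "norm (z ^ n) \<le> 1"
        using norm_power_ineq[of z n] power_le_one[OF norm_ge_zero z, of n] by linarith
      then have "norm (star y * z ^ n * y) \<le> norm y * 1 * norm y"
        by (intro order_trans[OF norm_mult_ineq] mult_mono order_trans[OF norm_mult_ineq]) auto
      then show ?thesis using t by (simp add: divide_right_mono)
    qed
    finally show ?thesis by (simp add: power2_eq_square)
  qed
  have "norm (d * d) = 0"
  proof (rule ccontr)
    assume "norm (d * d) \<noteq> 0"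
    then have "norm (d * d) > 0" by simp
    then obtain n where "(norm y)\<^sup>2 / t < real n * norm (d * d)"
      using reals_Archimedean3 by blast
    with bound[of n] show False by simp
  qed
  then have "d = 0"
    using norm_square_selfadjoint[OF cpos_selfadjoint[OF d]] by simp
  then have "c = 0" using t by (simp add: d_def)
  then show "y = 0" using yc cstar_identity[of y] by simp
qed

text \<open>This is Kaplansky's theorem. With \<open>m = \<bar>h\<bar>\<close> the element \<open>a = (m - h)/2\<close> is the negative part of
  \<open>h = x\<^sup>*x\<close>, and \<open>y = 2xa\<close> satisfies \<open>y\<^sup>*y = 4aha = -4ma\<^sup>2\<close>, the negative of a positive element. So
  the previous lemma kills the negative part.\<close>

theorem cpos_star_mult:
  fixes x :: "'a::unital_cstar_algebra"
  shows "cpos (star x * x)"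
proof -
  define h where "h = star x * x"
  have sh: "star h = h" by (simp add: h_def star_mult star_star)
  obtain m where m: "cpos m" "m * m = h * h"
    and mc: "\<And>y. h * h * y = y * (h * h) \<Longrightarrow> m * y = y * m"
    using cpos_sqrt[OF cpos_square[OF sh]] by blast
  obtain n where n: "cpos n" "n * n = m" and nc: "\<And>y. m * y = y * m \<Longrightarrow> n * y = y * n"
    using cpos_sqrt[OF m(1)] by blast
  have mh: "m * h = h * m" by (rule mc) (simp add: mult.assoc)
  define a where "a = (1/2) *\<^sub>R (m - h)"
  have sa: "star a = a" by (simp add: a_def star_diff sh cpos_selfadjoint[OF m(1)])
  have ma: "m * a = a * m" by (simp add: a_def algebra_simps mh)
  have na: "n * a = a * n" by (rule nc[OF ma])
  have h: "h = m - 2 *\<^sub>R a" by (simp add: a_def)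
  have aa: "a * a = m * a"
  proof -
    have "4 *\<^sub>R (a * a) = (m - h) * (m - h)" by (simp add: a_def)
    also have "\<dots> = 2 *\<^sub>R (m * (m - h))" by (simp add: algebra_simps mh m scaleR_2)
    also have "\<dots> = 4 *\<^sub>R (m * a)" by (simp add: a_def)
    finally show ?thesis by simp
  qed
  define c where "c = 4 *\<^sub>R ((n * a) * (n * a))"
  have sna: "star (n * a) = n * a"
    by (simp add: star_mult sa cpos_selfadjoint[OF n(1)] na)
  have c: "cpos c" unfolding c_def by (intro cpos_scale cpos_square sna) simp
  define y where "y = 2 *\<^sub>R (x * a)"
  have "star y * y = 4 *\<^sub>R (a * (h * a))"
    by (simp add: y_def star_mult sa h_def mult.assoc)
  also have "h * a = - (m * a)" by (simp add: h algebra_simps aa scaleR_2)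
  also have "a * - (m * a) = - ((n * a) * (n * a))"
    by (simp add: n(2)[symmetric] mult.assoc) (metis mult.assoc na)
  finally have "star y * y = - c" by (simp add: c_def)
  from negative_star_mult_zero[OF c this] have "y = 0" .
  with \<open>star y * y = - c\<close> have "(n * a) * (n * a) = 0" by (simp add: c_def)
  then have "n * a = 0" using norm_square_selfadjoint[OF sna] by simp
  then have "m * a = 0" by (simp add: n(2)[symmetric] mult.assoc)
  then have "a = 0" using aa norm_square_selfadjoint[OF sa] by simp
  then show ?thesis using h m by (simp add: h_def)
qed

text \<open>The source of every automatic norm bound: a linear functional that is nonnegative on the
  elements \<open>star k * k\<close> is bounded.\<close>

lemma norm_square_minus_star_mult:
  fixes a :: "'a::unital_cstar_algebra"
  obtains k where "of_real ((norm a)\<^sup>2) - star a * a = star k * k"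
proof -
  have "cpos (of_real ((norm a)\<^sup>2) - star a * a)"
    by (rule cpos_of_real_minus) (simp_all add: star_mult star_star cstar_identity)
  then obtain k where "cpos k" "k * k = of_real ((norm a)\<^sup>2) - star a * a"
    using cpos_sqrt by blast
  then show ?thesis using that[of k] by (simp add: cpos_selfadjoint)
qed


section \<open>The Hahn-Banach theorem\<close>

definition sublinear :: "('v::real_vector \<Rightarrow> real) \<Rightarrow> bool" where
  "sublinear p \<longleftrightarrow> (\<forall>x y. p (x + y) \<le> p x + p y) \<and> (\<forall>r>0. \<forall>x. p (r *\<^sub>R x) \<le> r * p x)"

lemma sublinear_zero: "sublinear p \<Longrightarrow> p 0 = 0"
proof -
  assume p: "sublinear p"
  have "p (0 + 0) \<le> p 0 + p 0" using p unfolding sublinear_def by blast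
  moreover have "p ((1/2) *\<^sub>R 0) \<le> (1/2) * p 0"
    using p unfolding sublinear_def by (meson half_gt_zero zero_less_one)
  ultimately
  show ?thesis by simp
qed

lemma sublinear_minus: "sublinear p \<Longrightarrow> - p (- x) \<le> p x"
proof -
  assume p: "sublinear p"
  have "p (x + - x) \<le> p x + p (- x)" using p unfolding sublinear_def by blast
  then show ?thesis using sublinear_zero[OF p] by simp
qed

text \<open>Among the sublinear functionals below \<open>q\<close>, one with \<open>tilt q y (- y) \<le> - q y\<close>. A functional that
  cannot be lowered by any tilt is linear.\<close>

definition tilt :: "('v::real_vector \<Rightarrow> real) \<Rightarrow> 'v \<Rightarrow> 'v \<Rightarrow> real" where
  "tilt q y x = (INF s\<in>{0..}. q (x + s *\<^sub>R y) - s * q y)"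

lemma sublinear_tilt:
  assumes q: "sublinear q"
  shows "sublinear (tilt q y)" "tilt q y x \<le> q x" "tilt q y (- y) \<le> - q y"
proof -
  have add: "q (x + y) \<le> q x + q y" for x y using q by (simp add: sublinear_def)
  have sc: "q (r *\<^sub>R x) \<le> r * q x" if "r > 0" for r x using q that by (simp add: sublinear_def)
  have sc0: "q (s *\<^sub>R y) \<le> s * q y" if "s \<ge> 0" for s
    using sc[of s y] sublinear_zero[OF q] that by (cases "s = 0") auto
  \<comment> \<open>the infimum is over a set bounded below, so it is not a default value\<close>
  have low: "- q (- x) \<le> q (x + s *\<^sub>R y) - s * q y" if "s \<ge> 0" for x s
  proof -
    have "s * q y \<le> q (s *\<^sub>R y)"
    proof (cases "s = 0")
      case False
      then have "q ((1/s) *\<^sub>R (s *\<^sub>R y)) \<le> (1/s) * q (s *\<^sub>R y)" using that by (intro sc) simp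
      then show ?thesis using False that by (simp add: field_simps)
    qed (simp add: sublinear_zero[OF q])
    also have "\<dots> \<le> q (x + s *\<^sub>R y) + q (- x)" using add[of "x + s *\<^sub>R y" "- x"] by simp
    finally show ?thesis by simp
  qed
  have bdd: "bdd_below ((\<lambda>s. q (x + s *\<^sub>R y) - s * q y) ` {0..})" for x
    by (rule bdd_belowI2[where m="- q (- x)"]) (use low in auto)
  have up: "tilt q y x \<le> q (x + s *\<^sub>R y) - s * q y" if "s \<ge> 0" for x s
    unfolding tilt_def by (rule cINF_lower[OF bdd]) (use that in auto)
  have ge: "c \<le> tilt q y x" if "\<And>s. s \<ge> 0 \<Longrightarrow> c \<le> q (x + s *\<^sub>R y) - s * q y" for c x
    unfolding tilt_def by (rule cINF_greatest) (use that in auto)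
  show "tilt q y x \<le> q x" using up[of 0 x] by simp
  show "tilt q y (- y) \<le> - q y" using up[of 1 "- y"] sublinear_zero[OF q] by simp
  have sub: "tilt q y (x + x') \<le> tilt q y x + tilt q y x'" for x x'
  proof -
    have *: "tilt q y (x + x') \<le> (q (x + s *\<^sub>R y) - s * q y) + (q (x' + s' *\<^sub>R y) - s' * q y)"
      if "s \<ge> 0" "s' \<ge> 0" for s s'
      using up[of "s + s'" "x + x'"] add[of "x + s *\<^sub>R y" "x' + s' *\<^sub>R y"] that
      by (simp add: algebra_simps)
    have "tilt q y (x + x') - (q (x + s *\<^sub>R y) - s * q y) \<le> tilt q y x'" if "s \<ge> 0" for s
      by (rule ge) (use *[OF that] in \<open>simp add: algebra_simps\<close>)
    then have "tilt q y (x + x') - tilt q y x' \<le> tilt q y x"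
      by (intro ge) (simp add: algebra_simps)
    then show ?thesis by simp
  qed
  have hom: "tilt q y (r *\<^sub>R x) \<le> r * tilt q y x" if r: "r > 0" for r x
  proof -
    have "tilt q y (r *\<^sub>R x) / r \<le> tilt q y x"
    proof (rule ge)
      fix s :: real assume s: "s \<ge> 0"
      have "tilt q y (r *\<^sub>R x) \<le> q (r *\<^sub>R x + (r * s) *\<^sub>R y) - (r * s) * q y"
        using r s by (intro up) simp
      also have "\<dots> \<le> r * q (x + s *\<^sub>R y) - (r * s) * q y"
        using sc[OF r, of "x + s *\<^sub>R y"] by (simp add: scaleR_add_right)
      finally show "tilt q y (r *\<^sub>R x) / r \<le> q (x + s *\<^sub>R y) - s * q y"
        using r by (simp add: field_simps)
    qed
    then show ?thesis using r by (simp add: field_simps)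
  qed
  show "sublinear (tilt q y)" unfolding sublinear_def using sub hom by blast
qed

lemma minimal_sublinear_linear:
  assumes q: "sublinear q"
    and min: "\<And>q'. sublinear q' \<Longrightarrow> (\<And>x. q' x \<le> q x) \<Longrightarrow> q' = q"
  shows "linear q"
proof -
  have odd: "q (- y) = - q y" for y
  proof -
    have "tilt q y = q" using sublinear_tilt[OF q] by (intro min) auto
    then have "q (- y) \<le> - q y" using sublinear_tilt(3)[OF q, of y] by simp
    then show ?thesis using sublinear_minus[OF q, of y] by simp
  qed
  have add: "q (x + y) \<le> q x + q y" for x y using q by (simp add: sublinear_def)
  have sc: "q (r *\<^sub>R x) \<le> r * q x" if "r > 0" for r x using q that by (simp add: sublinear_def)
  have "q (x + y) = q x + q y" for x y
    using add[of x y] add[of "- x" "- y"] odd[of x] odd[of y] odd[of "x + y"] by simp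
  moreover have pos: "q (r *\<^sub>R x) = r * q x" if "r > 0" for r x
    using sc[OF that, of x] sc[OF that, of "- x"] odd[of x] odd[of "r *\<^sub>R x"] by simp
  moreover have "q (r *\<^sub>R x) = r * q x" for r x
  proof (cases r "0::real" rule: linorder_cases)
    case less
    then show ?thesis using pos[of "- r" x] odd[of "r *\<^sub>R x"] by simp
  qed (use pos sublinear_zero[OF q] in auto)
  ultimately show ?thesis by (intro linearI) auto
qed

lemma minimal_sublinear_exists:
  fixes p :: "'v::real_vector \<Rightarrow> real"
  assumes p: "sublinear p"
  obtains q where "sublinear q" "\<And>x. q x \<le> p x"
    "\<And>q'. sublinear q' \<Longrightarrow> (\<And>x. q' x \<le> q x) \<Longrightarrow> q' = q"
proof -
  define A where "A = {q. sublinear q \<and> q \<le> p}"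
  define P where "P q q' \<longleftrightarrow> q' \<le> q" for q q' :: "'v \<Rightarrow> real"
  have "\<exists>m\<in>A. \<forall>a\<in>A. P m a \<longrightarrow> a = m"
  proof (rule predicate_Zorn)
    show "partial_order_on A (relation_of P A)"
      unfolding partial_order_on_def preorder_on_def refl_on_def trans_def antisym_def
        relation_of_def P_def by auto
  next
    fix C assume C: "C \<in> Chains (relation_of P A)"
    then have CA: "q \<in> A" if "q \<in> C" for q
      using that unfolding Chains_def relation_of_def by blast
    have tot: "q \<le> q' \<or> q' \<le> q" if "q \<in> C" "q' \<in> C" for q q'
      using C that unfolding Chains_def relation_of_def P_def by blast
    show "\<exists>u\<in>A. \<forall>a\<in>C. P a u"
    proof (cases "C = {}")
      case True
      then show ?thesis using p by (auto simp: A_def)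
    next
      case False
      define u where "u x = (INF q\<in>C. q x)" for x
      have low: "- p (- x) \<le> q x" if "q \<in> C" for q x
      proof -
        have "sublinear q" "q (- x) \<le> p (- x)" using CA[OF that] by (auto simp: A_def le_fun_def)
        then show ?thesis using sublinear_minus[of q x] by linarith
      qed
      have bdd: "bdd_below ((\<lambda>q. q x) ` C)" for x
        by (rule bdd_belowI2[where m="- p (- x)"]) (use low in auto)
      have up: "u x \<le> q x" if "q \<in> C" for q x
        unfolding u_def by (rule cINF_lower[OF bdd that])
      have ge: "c \<le> u x" if "\<And>q. q \<in> C \<Longrightarrow> c \<le> q x" for c x
        unfolding u_def by (rule cINF_greatest[OF False]) (use that in auto)
      have "u (x + y) \<le> u x + u y" for x y
      proof -
        have *: "u (x + y) \<le> q x + q' y" if q: "q \<in> C" "q' \<in> C" for q q'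
        proof -
          \<comment> \<open>in a chain, the smaller of the two functionals serves for both arguments\<close>
          obtain q0 where q0: "q0 \<in> C" "q0 \<le> q" "q0 \<le> q'"
            using tot[OF q] q by blast
          then have "u (x + y) \<le> q0 x + q0 y"
            using up[OF q0(1), of "x + y"] CA[OF q0(1)]
            by (force simp: A_def sublinear_def intro: order_trans)
          then show ?thesis using q0 by (meson add_mono le_funD order_trans)
        qed
        have "u (x + y) - q x \<le> u y" if "q \<in> C" for q
          by (rule ge) (use *[OF that] in \<open>simp add: algebra_simps\<close>)
        then have "u (x + y) - u y \<le> u x" by (intro ge) (simp add: algebra_simps)
        then show ?thesis by simp
      qed
      moreover have "u (r *\<^sub>R x) \<le> r * u x" if r: "r > 0" for r x
      proof -
        have "u (r *\<^sub>R x) / r \<le> u x"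
        proof (rule ge)
          fix q assume q: "q \<in> C"
          have "u (r *\<^sub>R x) \<le> q (r *\<^sub>R x)" by (rule up[OF q])
          also have "\<dots> \<le> r * q x" using CA[OF q] r by (simp add: A_def sublinear_def)
          finally show "u (r *\<^sub>R x) / r \<le> q x" using r by (simp add: field_simps)
        qed
        then show ?thesis using r by (simp add: field_simps)
      qed
      ultimately have "sublinear u" unfolding sublinear_def by blast
      moreover obtain q where "q \<in> C" using False by blast
      then have "u \<le> p" using up[of q] CA[of q] by (auto simp: A_def le_fun_def intro: order_trans)
      ultimately have "u \<in> A" by (simp add: A_def)
      then show ?thesis using up by (auto simp: P_def le_fun_def)
    qed
  qed
  then obtain q where "q \<in> A" and "\<And>q'. q' \<in> A \<Longrightarrow> q' \<le> q \<Longrightarrow> q' = q"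
    unfolding P_def by blast
  then show ?thesis
    by (intro that[of q]) (auto simp: A_def le_fun_def intro: order_trans)
qed

text \<open>A minimal sublinear functional exists by Zorn's lemma and is linear. Starting from the tilt of
  \<open>p\<close> in direction \<open>h\<close> makes it attain \<open>p\<close> at \<open>h\<close>.\<close>

theorem hahn_banach_sublinear:
  fixes p :: "'v::real_vector \<Rightarrow> real"
  assumes p: "sublinear p"
  obtains f where "linear f" "\<And>x. f x \<le> p x" "f h = p h"
proof -
  obtain f where f: "sublinear f" "\<And>x. f x \<le> tilt p h x"
    and min: "\<And>q'. sublinear q' \<Longrightarrow> (\<And>x. q' x \<le> f x) \<Longrightarrow> q' = f"
    using minimal_sublinear_exists[OF sublinear_tilt(1)[OF p, of h]] by blast
  have lin: "linear f" by (rule minimal_sublinear_linear[OF f(1) min])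
  have le: "f x \<le> p x" for x using f(2) sublinear_tilt(2)[OF p] order_trans by blast
  have "f (- h) \<le> - p h" using f(2) sublinear_tilt(3)[OF p] order_trans by blast
  then have "f h \<ge> p h" by (simp add: linear_neg[OF lin])
  with le[of h] show ?thesis by (intro that[OF lin le]) simp
qed


section \<open>States\<close>

definition real_part :: "'a::unital_cstar_algebra \<Rightarrow> 'a" where
  "real_part x = (1/2) *\<^sub>R (x + star x)"

lemma real_part_simps:
  fixes x y :: "'a::unital_cstar_algebra"
  shows star_real_part: "star (real_part x) = real_part x"
    and real_part_add: "real_part (x + y) = real_part x + real_part y"
    and real_part_scaleR: "real_part (r *\<^sub>R x) = r *\<^sub>R real_part x"
    and real_part_selfadjoint: "star x = x \<Longrightarrow> real_part x = x"
  by (simp_all add: real_part_def star_add star_star algebra_simps flip: scaleR_add_left)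

lemma real_part_scaleC:
  "real_part (c *\<^sub>C x) = Re c *\<^sub>R real_part x - Im c *\<^sub>R real_part ((- \<i>) *\<^sub>C (x :: 'a::unital_cstar_algebra))"
proof -
  have "c *\<^sub>C x = Re c *\<^sub>R x + (- Im c) *\<^sub>R ((- \<i>) *\<^sub>C x)"
    by (simp add: scaleR_scaleC scaleC_scaleC complex_eq_iff flip: scaleC_add_left)
      (rule arg_cong[where f="\<lambda>c. c *\<^sub>C x"], simp add: complex_eq_iff)
  then show ?thesis by (simp only: real_part_add real_part_scaleR) simp
qed

text \<open>The largest value at \<open>x\<close> that positivity and normalisation allow the real part of a state.\<close>

definition order_gauge :: "'a::unital_cstar_algebra \<Rightarrow> real" where
  "order_gauge x = Inf {t. cpos (of_real t - real_part x)}"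

lemma order_gauge_props:
  fixes x :: "'a::unital_cstar_algebra"
  shows order_gauge_upper: "cpos (of_real t - real_part x) \<Longrightarrow> order_gauge x \<le> t"
    and order_gauge_greatest:
      "(\<And>t. cpos (of_real t - real_part x) \<Longrightarrow> c \<le> t) \<Longrightarrow> c \<le> order_gauge x"
proof -
  have ne: "cpos (of_real (norm (real_part x)) - real_part x)"
    by (intro cpos_of_real_minus star_real_part order_refl)
  have low: "- norm (real_part x) \<le> t" if "cpos (of_real t - real_part x)" for t
  proof (rule ccontr)
    assume "\<not> - norm (real_part x) \<le> t"
    define s where "s = - (t + norm (real_part x))"
    have s: "s > 0" using \<open>\<not> _\<close> by (simp add: s_def)
    have "cpos (of_real (norm (real_part x)) - - real_part x)"
      by (intro cpos_of_real_minus) (simp_all add: star_real_part)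
    from cpos_add[OF that this] have "cpos (- of_real s :: 'a)"
      by (simp add: s_def algebra_simps)
    from cpos_norm_mono[OF cpos_of_real this, of s] s show False by simp
  qed
  show "cpos (of_real t - real_part x) \<Longrightarrow> order_gauge x \<le> t"
    unfolding order_gauge_def by (rule cInf_lower) (auto intro!: bdd_belowI low)
  show "(\<And>t. cpos (of_real t - real_part x) \<Longrightarrow> c \<le> t) \<Longrightarrow> c \<le> order_gauge x"
    unfolding order_gauge_def using ne by (intro cInf_greatest) auto
qed

lemma sublinear_order_gauge: "sublinear (order_gauge :: 'a::unital_cstar_algebra \<Rightarrow> real)"
proof -
  have "order_gauge (x + y) \<le> order_gauge x + order_gauge y" for x y :: 'a
  proof -
    have *: "order_gauge (x + y) \<le> s + t"
      if "cpos (of_real s - real_part x)" "cpos (of_real t - real_part y)" for s t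
      using cpos_add[OF that] by (intro order_gauge_upper) (simp add: real_part_add algebra_simps)
    have "order_gauge (x + y) - s \<le> order_gauge y" if "cpos (of_real s - real_part x)" for s
      using *[OF that] by (intro order_gauge_greatest) (simp add: algebra_simps)
    then have "order_gauge (x + y) - order_gauge y \<le> order_gauge x"
      by (intro order_gauge_greatest) (simp add: algebra_simps)
    then show ?thesis by simp
  qed
  moreover have "order_gauge (r *\<^sub>R x) \<le> r * order_gauge x" if r: "r > 0" for r and x :: 'a
  proof -
    have "order_gauge (r *\<^sub>R x) / r \<le> order_gauge x"
    proof (rule order_gauge_greatest)
      fix t assume "cpos (of_real t - real_part x)"
      then have "cpos (r *\<^sub>R (of_real t - real_part x))" using r by (intro cpos_scale) auto
      then have "order_gauge (r *\<^sub>R x) \<le> r * t"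
        by (intro order_gauge_upper)
          (simp add: real_part_scaleR scaleR_right_diff_distrib of_real_def)
      then show "order_gauge (r *\<^sub>R x) / r \<le> t" using r by (simp add: field_simps)
    qed
    then show ?thesis using r by (simp add: field_simps)
  qed
  ultimately show ?thesis unfolding sublinear_def by blast
qed

lemma complexify_linear:
  fixes f :: "'a::unital_cstar_algebra \<Rightarrow> real"
  assumes f: "linear f"
  defines "\<phi> \<equiv> \<lambda>x. Complex (f (real_part x)) (f (real_part ((- \<i>) *\<^sub>C x)))"
  shows "clinear_functional \<phi>"
proof -
  have "\<phi> (c *\<^sub>C x) = c * \<phi> x" for c x
  proof -
    have 1: "f (real_part (c *\<^sub>C x)) = Re c * f (real_part x) - Im c * f (real_part ((- \<i>) *\<^sub>C x))"
      by (subst real_part_scaleC) (simp add: linear_diff[OF f] linear_add[OF f] linear_scale[OF f])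
    have "f (real_part ((- \<i> * c) *\<^sub>C x)) =
        Re (- \<i> * c) * f (real_part x) - Im (- \<i> * c) * f (real_part ((- \<i>) *\<^sub>C x))"
      by (subst real_part_scaleC) (simp add: linear_diff[OF f] linear_add[OF f] linear_scale[OF f])
    then show ?thesis using 1
      by (simp add: \<phi>_def complex_eq_iff scaleC_scaleC)
  qed
  moreover have "\<phi> (x + y) = \<phi> x + \<phi> y" for x y
    by (simp add: \<phi>_def scaleC_add_right real_part_add linear_add[OF f] complex_eq_iff)
  ultimately show ?thesis unfolding clinear_functional_def by blast
qed

text \<open>A linear functional below the order gauge is positive and unital. On the positive element
  \<open>h = star x * x\<close> the gauge equals the norm, so Hahn-Banach at \<open>h\<close> gives the state.\<close>

theorem state_attaining_norm:
  fixes x :: "'a::unital_cstar_algebra"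
  obtains \<phi> where "state \<phi>" "\<phi> (star x * x) = of_real ((norm x)\<^sup>2)"
proof -
  define h where "h = star x * x"
  obtain f where f: "linear f" "\<And>y. f y \<le> order_gauge y" "f h = order_gauge h"
    using hahn_banach_sublinear[OF sublinear_order_gauge] by blast
  define \<phi> where "\<phi> y = Complex (f (real_part y)) (f (real_part ((- \<i>) *\<^sub>C y)))" for y
  have lin: "clinear_functional \<phi>"
    using complexify_linear[OF f(1)] by (simp add: \<phi>_def[abs_def])
  have sa: "\<phi> y = of_real (f y)" if "star y = y" for y
  proof -
    have "real_part ((- \<i>) *\<^sub>C y) = 0"
      by (simp add: real_part_def star_scaleC that scaleC_minus_left)
    then show ?thesis
      by (simp add: \<phi>_def real_part_selfadjoint[OF that] linear_0[OF f(1)] complex_eq_iff)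
  qed
  have pos: "f y \<ge> 0" if "cpos y" for y
  proof -
    have "order_gauge (- y) \<le> 0"
      using that by (intro order_gauge_upper)
        (simp add: real_part_selfadjoint cpos_selfadjoint)
    then show ?thesis using f(2)[of "- y"] by (simp add: linear_neg[OF f(1)])
  qed
  have c0: "cpos (0 :: 'a)" using cpos_of_real[of 0] by simp
  have "f 1 \<le> 1"
    using f(2)[of 1] order_gauge_upper[of 1 "1 :: 'a"] c0
    by (simp add: real_part_selfadjoint)
  moreover have "f (- 1) \<le> - 1"
    using f(2)[of "- 1"] order_gauge_upper[of "-1" "-1 :: 'a"] c0
    by (simp add: real_part_selfadjoint)
  ultimately have f1: "f 1 = 1" by (simp add: linear_neg[OF f(1)])
  have h: "cpos h" unfolding h_def by (rule cpos_star_mult)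
  have nh: "norm h = (norm x)\<^sup>2" by (simp add: h_def cstar_identity)
  have "norm h \<le> order_gauge h"
  proof (rule order_gauge_greatest)
    fix t assume t: "cpos (of_real t - real_part h)"
    then have t': "cpos (of_real t - h)"
      by (simp add: real_part_selfadjoint cpos_selfadjoint[OF h])
    have "f (of_real t - h) \<ge> 0" "f h \<ge> 0" using pos t' h by auto
    moreover have "f (of_real t - h) = t - f h"
      by (simp add: linear_diff[OF f(1)] of_real_def linear_scale[OF f(1)] f1)
    ultimately have "t \<ge> 0" by simp
    then show "norm h \<le> t" by (rule norm_le_of_cpos_diff[OF h t'])
  qed
  moreover have "order_gauge h \<le> norm h"
    using cpos_of_real_minus[OF cpos_selfadjoint[OF h] order_refl]
    by (intro order_gauge_upper) (simp add: real_part_selfadjoint cpos_selfadjoint[OF h])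
  ultimately have "f h = (norm x)\<^sup>2" using f(3) nh by simp
  then have "\<phi> (star x * x) = of_real ((norm x)\<^sup>2)"
    using sa[OF cpos_selfadjoint[OF h]] by (simp add: h_def)
  moreover have "state \<phi>"
    unfolding state_def
  proof (intro conjI allI)
    show "clinear_functional \<phi>" by (rule lin)
    show "\<phi> (star y * y) \<in> \<real>\<^sub>\<ge>\<^sub>0" for y
      using sa[OF cpos_selfadjoint[OF cpos_star_mult[of y]]] pos[OF cpos_star_mult[of y]] by simp
    show "\<phi> 1 = 1" using sa[of 1] f1 by simp
  qed
  ultimately show ?thesis using that by blast
qed


section \<open>Positive semidefinite forms\<close>

locale psd_form =
  fixes V :: "'v::complex_vector set" and s :: "'v \<Rightarrow> 'v \<Rightarrow> complex"
  assumes V: "csubspace V"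
    and add_left: "x \<in> V \<Longrightarrow> y \<in> V \<Longrightarrow> z \<in> V \<Longrightarrow> s (x + y) z = s x z + s y z"
    and scale_left: "x \<in> V \<Longrightarrow> y \<in> V \<Longrightarrow> s (c *\<^sub>C x) y = c * s x y"
    and hermitian: "x \<in> V \<Longrightarrow> y \<in> V \<Longrightarrow> s x y = cnj (s y x)"
    and nonneg: "x \<in> V \<Longrightarrow> 0 \<le> Re (s x x)"
begin

lemma closed_ops:
  shows zero_mem: "0 \<in> V" and add_mem: "x \<in> V \<Longrightarrow> y \<in> V \<Longrightarrow> x + y \<in> V"
    and scale_mem: "x \<in> V \<Longrightarrow> c *\<^sub>C x \<in> V"
    and minus_mem: "x \<in> V \<Longrightarrow> - x \<in> V"
    and diff_mem: "x \<in> V \<Longrightarrow> y \<in> V \<Longrightarrow> x - y \<in> V"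
proof -
  show "0 \<in> V" and a: "x \<in> V \<Longrightarrow> y \<in> V \<Longrightarrow> x + y \<in> V" and m: "x \<in> V \<Longrightarrow> c *\<^sub>C x \<in> V" for x y c
    using V unfolding csubspace_def by auto
  show n: "x \<in> V \<Longrightarrow> - x \<in> V" for x using m[of x "-1"] by (simp add: scaleC_minus1)
  show "x \<in> V \<Longrightarrow> y \<in> V \<Longrightarrow> x - y \<in> V" using a[of x "- y"] n[of y] by simp
qed

lemma sum_mem: "(\<And>i. i \<in> I \<Longrightarrow> f i \<in> V) \<Longrightarrow> (\<Sum>i\<in>I. f i) \<in> V"
  by (induction I rule: infinite_finite_induct) (auto simp: zero_mem add_mem)

lemma add_right: "x \<in> V \<Longrightarrow> y \<in> V \<Longrightarrow> z \<in> V \<Longrightarrow> s z (x + y) = s z x + s z y"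
  using add_left[of x y z] hermitian[of z "x + y"] hermitian[of z x] hermitian[of z y]
  by (simp add: add_mem)

lemma scale_right: "x \<in> V \<Longrightarrow> y \<in> V \<Longrightarrow> s y (c *\<^sub>C x) = cnj c * s y x"
  using scale_left[of x y c] hermitian[of y "c *\<^sub>C x"] hermitian[of y x]
  by (simp add: scale_mem)

lemma minus_left: "x \<in> V \<Longrightarrow> y \<in> V \<Longrightarrow> s (- x) y = - s x y"
  by (simp add: scaleC_minus1 scale_left)

lemma minus_right: "x \<in> V \<Longrightarrow> y \<in> V \<Longrightarrow> s x (- y) = - s x y"
  by (simp add: scaleC_minus1 scale_right)

lemma diff_left: "x \<in> V \<Longrightarrow> y \<in> V \<Longrightarrow> z \<in> V \<Longrightarrow> s (x - y) z = s x z - s y z"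
  using add_left[of x "- y" z] by (simp add: minus_left minus_mem)

lemma diff_right: "x \<in> V \<Longrightarrow> y \<in> V \<Longrightarrow> z \<in> V \<Longrightarrow> s z (x - y) = s z x - s z y"
  using add_right[of x "- y" z] by (simp add: minus_right minus_mem)

lemma zero_left: "x \<in> V \<Longrightarrow> s 0 x = 0"
  using scale_left[of x x 0] by simp

lemma zero_right: "x \<in> V \<Longrightarrow> s x 0 = 0"
  using scale_right[of x x 0] by simp

lemma sum_left: "(\<And>i. i \<in> I \<Longrightarrow> f i \<in> V) \<Longrightarrow> z \<in> V \<Longrightarrow> s (\<Sum>i\<in>I. f i) z = (\<Sum>i\<in>I. s (f i) z)"
  by (induction I rule: infinite_finite_induct) (auto simp: zero_left add_left sum_mem)

lemma form_self: "x \<in> V \<Longrightarrow> s x x = of_real (Re (s x x))"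
  using hermitian[of x x] by (metis Reals_cnj_iff complex_is_Real_iff of_real_Re)

lemma form_diff_scale:
  assumes "x \<in> V" "y \<in> V"
  shows "Re (s (x - c *\<^sub>C y) (x - c *\<^sub>C y)) = Re (s x x) - 2 * Re (cnj c * s x y) + (cmod c)\<^sup>2 * Re (s y y)"
proof -
  have "s (x - c *\<^sub>C y) (x - c *\<^sub>C y) = s x x - cnj c * s x y - c * cnj (s x y) + (c * cnj c) * s y y"
    using assms hermitian[OF assms(2,1)]
    by (simp add: diff_left diff_right scale_left scale_right scale_mem diff_mem algebra_simps)
  moreover have "Re (c * cnj c * s y y) = (cmod c)\<^sup>2 * Re (s y y)"
    by (simp add: complex_mult_cnj cmod_power2)
  moreover have "Re (c * cnj (s x y)) = Re (cnj c * s x y)" by simp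
  ultimately show ?thesis by simp
qed

text \<open>If \<open>s y y\<close> vanishes, arbitrarily large multiples of \<open>s x y\<close> as coefficient force \<open>s x y = 0\<close>;
  otherwise the coefficient is that of the orthogonal projection.\<close>

lemma cauchy_schwarz:
  assumes "x \<in> V" "y \<in> V"
  shows "(cmod (s x y))\<^sup>2 \<le> Re (s x x) * Re (s y y)"
proof (cases "Re (s y y) = 0")
  case True
  have *: "2 * r * (cmod (s x y))\<^sup>2 \<le> Re (s x x)" for r :: real
  proof -
    let ?c = "of_real r * s x y"
    have "0 \<le> Re (s (x - ?c *\<^sub>C y) (x - ?c *\<^sub>C y))"
      by (intro nonneg diff_mem scale_mem assms)
    moreover have "Re (cnj ?c * s x y) = r * (cmod (s x y))\<^sup>2"
      unfolding cmod_power2 by (simp add: power2_eq_square algebra_simps)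
    ultimately show ?thesis unfolding form_diff_scale[OF assms] True by simp
  qed
  have "(cmod (s x y))\<^sup>2 = 0"
  proof (rule ccontr)
    assume "(cmod (s x y))\<^sup>2 \<noteq> 0"
    then show False
      using *[of "(Re (s x x) + 1) / (2 * (cmod (s x y))\<^sup>2)"] by simp
  qed
  then show ?thesis using True by simp
next
  case False
  then have y: "Re (s y y) > 0" using nonneg[OF assms(2)] by simp
  let ?c = "s x y / of_real (Re (s y y))"
  have "0 \<le> Re (s (x - ?c *\<^sub>C y) (x - ?c *\<^sub>C y))"
    by (intro nonneg diff_mem scale_mem assms)
  moreover have "Re (cnj ?c * s x y) = (cmod (s x y))\<^sup>2 / Re (s y y)"
  proof -
    have "cnj ?c * s x y = of_real ((cmod (s x y))\<^sup>2) / of_real (Re (s y y))"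
      unfolding complex_norm_square by (simp add: mult.commute)
    then show ?thesis by (metis Re_complex_of_real of_real_divide)
  qed
  moreover have "(cmod ?c)\<^sup>2 * Re (s y y) = (cmod (s x y))\<^sup>2 / Re (s y y)"
    using y by (simp add: norm_divide power_divide power2_eq_square)
  ultimately have "(cmod (s x y))\<^sup>2 / Re (s y y) \<le> Re (s x x)"
    unfolding form_diff_scale[OF assms] by linarith
  then show ?thesis using y by (simp add: pos_divide_le_eq)
qed

lemma cauchy_schwarz_sqrt:
  assumes "x \<in> V" "y \<in> V"
  shows "cmod (s x y) \<le> sqrt (Re (s x x)) * sqrt (Re (s y y))"
  using real_le_rsqrt[OF cauchy_schwarz[OF assms]] by (simp add: real_sqrt_mult)

lemma form_null: "x \<in> V \<Longrightarrow> y \<in> V \<Longrightarrow> Re (s x x) = 0 \<Longrightarrow> s x y = 0"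
  using cauchy_schwarz[of x y] by simp

lemma form_triangle:
  assumes "x \<in> V" "y \<in> V"
  shows "sqrt (Re (s (x + y) (x + y))) \<le> sqrt (Re (s x x)) + sqrt (Re (s y y))"
proof (rule real_le_lsqrt)
  have "Re (s (x + y) (x + y)) = Re (s x x) + Re (s y y) + 2 * Re (s x y)"
    using assms hermitian[OF assms] by (simp add: add_left add_right add_mem)
  also have "\<dots> \<le> Re (s x x) + Re (s y y) + 2 * (sqrt (Re (s x x)) * sqrt (Re (s y y)))"
    using complex_Re_le_cmod[of "s x y"] cauchy_schwarz_sqrt[OF assms] by simp
  also have "\<dots> = (sqrt (Re (s x x)) + sqrt (Re (s y y)))\<^sup>2"
    using nonneg assms by (simp add: power2_sum)
  finally show "Re (s (x + y) (x + y)) \<le> (sqrt (Re (s x x)) + sqrt (Re (s y y)))\<^sup>2" .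
qed (use nonneg assms in auto)

end

lemma psd_form_cinner: "psd_form UNIV (cinner :: 'h::complex_inner \<Rightarrow> 'h \<Rightarrow> complex)"
proof
  show "0 \<le> Re (cinner x x)" for x :: 'h by (simp flip: inner_eq_Re_cinner)
  show "cinner x y = cnj (cinner y x)" for x y :: 'h by (rule cinner_commute)
qed (auto simp: csubspace_def cinner_add_left cinner_scaleC_left)

interpretation cin: psd_form UNIV "cinner :: 'h::complex_inner \<Rightarrow> 'h \<Rightarrow> complex"
  by (rule psd_form_cinner)

lemma cinner_self: "cinner x x = of_real ((norm (x :: 'h::complex_inner))\<^sup>2)"
  using cin.form_self[of x] by (simp add: power2_norm_eq_inner inner_eq_Re_cinner)

lemma norm_cinner_le: "cmod (cinner x y) \<le> norm x * norm (y :: 'h::complex_inner)"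
  using cin.cauchy_schwarz_sqrt[of x y] by (simp add: cinner_self)

lemma norm_scaleC_inner [simp]: "norm (c *\<^sub>C x) = cmod c * norm (x :: 'h::complex_inner)"
proof -
  have "cinner (c *\<^sub>C x) (c *\<^sub>C x) = of_real ((cmod c * norm x)\<^sup>2)"
    by (simp add: cin.scale_left cin.scale_right cinner_self[of x] power_mult_distrib
        mult.assoc[symmetric] del: of_real_power)
      (use complex_norm_square[of c] in \<open>simp add: mult.commute\<close>)
  then have "(norm (c *\<^sub>C x))\<^sup>2 = (cmod c * norm x)\<^sup>2"
    unfolding cinner_self of_real_eq_iff .
  then show ?thesis by (simp add: power2_eq_iff_nonneg)
qed

lemma bounded_bilinear_scaleC_inner:
  "bounded_bilinear (scaleC :: complex \<Rightarrow> 'h::complex_inner \<Rightarrow> 'h)"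
  by unfold_locales
    (auto simp: scaleC_add_left scaleC_add_right scaleR_scaleC scaleC_scaleC mult.commute
      scaleR_conv_of_real intro!: exI[of _ 1])

lemma bounded_bilinear_scaleC_cstar:
  "bounded_bilinear (scaleC :: complex \<Rightarrow> 'a::unital_cstar_algebra \<Rightarrow> 'a)"
  by unfold_locales
    (auto simp: scaleC_add_left scaleC_add_right scaleR_scaleC scaleC_scaleC mult.commute
      scaleR_conv_of_real norm_scaleC intro!: exI[of _ 1])

lemma bounded_bilinear_cinner: "bounded_bilinear (cinner :: 'h::complex_inner \<Rightarrow> 'h \<Rightarrow> complex)"
  by unfold_locales
    (auto simp: cin.add_left cin.add_right scaleR_scaleC cin.scale_left cin.scale_right
      norm_cinner_le scaleR_conv_of_real intro!: exI[of _ 1])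


section \<open>States are bounded and define forms\<close>

lemma linear_functional_simps:
  assumes "clinear_functional \<phi>"
  shows "\<phi> (x + y) = \<phi> x + \<phi> y" "\<phi> (c *\<^sub>C x) = c * \<phi> x" "\<phi> 0 = 0" "\<phi> (- x) = - \<phi> x"
    "\<phi> (x - y) = \<phi> x - \<phi> y" "\<phi> (of_real r) = of_real r * \<phi> 1" "\<phi> (r *\<^sub>R x) = of_real r * \<phi> x"
proof -
  show a: "\<phi> (x + y) = \<phi> x + \<phi> y" and c: "\<phi> (c *\<^sub>C x) = c * \<phi> x" for x y c
    using assms unfolding clinear_functional_def by auto
  show "\<phi> 0 = 0" using c[of 0 0] by simp
  show m: "\<phi> (- x) = - \<phi> x" for x using c[of "-1" x] by (simp add: scaleC_minus1)
  show "\<phi> (x - y) = \<phi> x - \<phi> y" using a[of x "- y"] m by simp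
  show "\<phi> (of_real r) = of_real r * \<phi> 1" by (simp add: of_real_def scaleR_scaleC c)
  show "\<phi> (r *\<^sub>R x) = of_real r * \<phi> x" by (simp add: scaleR_scaleC c)
qed

text \<open>This is the form of the GNS construction. That it is Hermitian follows from its being real on the
  diagonal, by polarization at \<open>x + y\<close> and \<open>x + iy\<close>.\<close>

lemma psd_form_state:
  fixes \<phi> :: "'a::unital_cstar_algebra \<Rightarrow> complex"
  assumes "state \<phi>"
  shows "psd_form UNIV (\<lambda>x y. \<phi> (star y * x))"
proof
  have lin: "clinear_functional \<phi>" and pos: "\<phi> (star x * x) \<in> \<real>\<^sub>\<ge>\<^sub>0" for x
    using assms by (auto simp: state_def)
  note L = linear_functional_simps[OF lin]
  show "csubspace (UNIV :: 'a set)" by (simp add: csubspace_def)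
  show "\<phi> (star z * (x + y)) = \<phi> (star z * x) + \<phi> (star z * y)" for x y z
    by (simp add: distrib_left L)
  show "\<phi> (star y * c *\<^sub>C x) = c * \<phi> (star y * x)" for c x y
    by (simp add: mult_scaleC_right L)
  show "0 \<le> Re (\<phi> (star x * x))" for x using pos[of x] by (auto elim!: nonneg_Reals_cases)
  show "\<phi> (star y * x) = cnj (\<phi> (star x * y))" for x y
  proof -
    have im: "Im (\<phi> (star z * z)) = 0" for z using pos[of z] by (auto elim!: nonneg_Reals_cases)
    have "star (x + y) * (x + y) = star x * x + star y * y + (star y * x + star x * y)"
      by (simp add: star_add algebra_simps)
    then have 1: "Im (\<phi> (star y * x) + \<phi> (star x * y)) = 0"
      using im[of "x + y"] im[of x] im[of y] by (simp add: L)
    have "star (x + \<i> *\<^sub>C y) * (x + \<i> *\<^sub>C y) =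
        star x * x + star y * y + \<i> *\<^sub>C (star x * y) + (- \<i>) *\<^sub>C (star y * x)"
      by (simp add: star_add star_scaleC algebra_simps mult_scaleC_left mult_scaleC_right
          scaleC_scaleC scaleC_add_right)
    then have 2: "Im (\<i> * \<phi> (star x * y) - \<i> * \<phi> (star y * x)) = 0"
      using im[of "x + \<i> *\<^sub>C y"] im[of x] im[of y] by (simp add: L scaleC_minus_left)
    show ?thesis using 1 2 by (simp add: complex_eq_iff)
  qed
qed

lemma state_bounds:
  fixes \<phi> :: "'a::unital_cstar_algebra \<Rightarrow> complex"
  assumes st: "state \<phi>"
  shows state_star_mult_le: "Re (\<phi> (star x * x)) \<le> (norm x)\<^sup>2"
    and state_norm_le: "cmod (\<phi> x) \<le> norm x"
    and state_star: "\<phi> (star x) = cnj (\<phi> x)"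
proof -
  interpret psd_form UNIV "\<lambda>x y. \<phi> (star y * x)" by (rule psd_form_state[OF st])
  have lin: "clinear_functional \<phi>" and one: "\<phi> 1 = 1" using st by (auto simp: state_def)
  note L = linear_functional_simps[OF lin]
  obtain k where k: "of_real ((norm x)\<^sup>2) - star x * x = star k * k"
    using norm_square_minus_star_mult by blast
  have "0 \<le> Re (\<phi> (star k * k))" using nonneg[of k] by simp
  then show 1: "Re (\<phi> (star x * x)) \<le> (norm x)\<^sup>2"
    unfolding k[symmetric] by (simp add: L one del: of_real_power)
  have "(cmod (\<phi> x))\<^sup>2 \<le> Re (\<phi> (star x * x))"
    using cauchy_schwarz[of x 1] by (simp add: one)
  with 1 have "(cmod (\<phi> x))\<^sup>2 \<le> (norm x)\<^sup>2" by (rule order_trans[rotated])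
  then show "cmod (\<phi> x) \<le> norm x" by (rule power2_le_imp_le) simp
  show "\<phi> (star x) = cnj (\<phi> x)" using hermitian[of 1 x] by simp
qed


section \<open>Separability and a faithful state\<close>

text \<open>Elements obtained from \<open>G\<close> in \<open>n\<close> rounds of algebra operations, with scalars from a
  countable dense set. Each stage is countable, and the closure of their union is a C*-algebra.\<close>

primrec words :: "complex set \<Rightarrow> 'a::unital_cstar_algebra set \<Rightarrow> nat \<Rightarrow> 'a set" where
  "words Q G 0 = insert 0 (insert 1 G)"
| "words Q G (Suc n) = words Q G n \<union> (\<lambda>(x, y). x + y) ` (words Q G n \<times> words Q G n)
     \<union> (\<lambda>(x, y). x * y) ` (words Q G n \<times> words Q G n) \<union> star ` words Q G n
     \<union> (\<lambda>(q, x). q *\<^sub>C x) ` (Q \<times> words Q G n)"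

lemma countable_dense_of_generates:
  fixes G :: "'a::unital_cstar_algebra set"
  assumes G: "countable G" "generates G"
  obtains D :: "'a set" where "countable D" "closure D = UNIV"
proof -
  obtain Q :: "complex set" where Q: "countable Q" "\<And>X. open X \<Longrightarrow> X \<noteq> {} \<Longrightarrow> \<exists>d\<in>Q. d \<in> X"
    using countable_dense_exists by (metis (no_types))
  have clQ: "closure Q = UNIV"
    using Q(2)[of "- closure Q"] closure_subset[of Q] by blast
  define D where "D = (\<Union>n. words Q G n)"
  have "countable (words Q G n)" for n
    using G Q by (induction n) auto
  then have cD: "countable D" by (simp add: D_def)
  have mono: "words Q G m \<subseteq> words Q G n" if "m \<le> n" for m n
    using that by (induction rule: dec_induct) auto
  have two: "\<exists>n. x \<in> words Q G n \<and> y \<in> words Q G n" if xy: "x \<in> D" "y \<in> D" for x y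
  proof -
    obtain i j where "x \<in> words Q G i" "y \<in> words Q G j" using xy by (auto simp: D_def)
    then show ?thesis using mono[of i "max i j"] mono[of j "max i j"] by auto
  qed
  have DI: "z \<in> words Q G (Suc n) \<Longrightarrow> z \<in> D" for z n unfolding D_def by blast
  have Dadd: "x + y \<in> D" and Dmult: "x * y \<in> D" if xy: "x \<in> D" "y \<in> D" for x y
  proof -
    obtain n where n: "(x, y) \<in> words Q G n \<times> words Q G n" using two[OF xy] by blast
    show "x + y \<in> D" using imageI[OF n, of "\<lambda>(x, y). x + y"] by (intro DI[of _ n]) simp
    show "x * y \<in> D" using imageI[OF n, of "\<lambda>(x, y). x * y"] by (intro DI[of _ n]) simp
  qed
  have Dstar: "star x \<in> D" if x: "x \<in> D" for x
  proof -
    obtain n where "x \<in> words Q G n" using two[OF x x] by blast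
    then show ?thesis by (intro DI[of _ n]) simp
  qed
  have Dscale: "q *\<^sub>C x \<in> D" if xq: "x \<in> D" "q \<in> Q" for x q
  proof -
    obtain n where n: "(q, x) \<in> Q \<times> words Q G n" using two[OF xq(1) xq(1)] xq(2) by blast
    show ?thesis using imageI[OF n, of "\<lambda>(q, x). q *\<^sub>C x"] by (intro DI[of _ n]) simp
  qed
  have "words Q G 0 \<subseteq> D" unfolding D_def by blast
  then have D01: "0 \<in> D" "1 \<in> D" "G \<subseteq> D" by simp_all
  have "cstar_subalgebra (closure D)"
    unfolding cstar_subalgebra_def csubspace_def
  proof (intro conjI ballI allI)
    show "0 \<in> closure D" using D01 closure_subset by blast
    show "closed (closure D)" by simp
    fix x assume "x \<in> closure D"
    then obtain f where f: "\<And>n. f n \<in> D" "f \<longlonglongrightarrow> x" by (auto simp: closure_sequential)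
    show "star x \<in> closure D"
      unfolding closure_sequential
      by (intro exI[of _ "\<lambda>n. star (f n)"] conjI allI Dstar f bounded_linear.tendsto[OF bounded_linear_star])
    show "c *\<^sub>C x \<in> closure D" for c
    proof -
      have "c \<in> closure Q" using clQ by simp
      then obtain q where q: "\<And>n. q n \<in> Q" "q \<longlonglongrightarrow> c" by (auto simp: closure_sequential)
      show ?thesis
        unfolding closure_sequential
        by (intro exI[of _ "\<lambda>n. q n *\<^sub>C f n"] conjI allI Dscale f q
            bounded_bilinear.tendsto[OF bounded_bilinear_scaleC_cstar])
    qed
    fix y assume "y \<in> closure D"
    then obtain g where g: "\<And>n. g n \<in> D" "g \<longlonglongrightarrow> y" by (auto simp: closure_sequential)
    show "x + y \<in> closure D"
      unfolding closure_sequential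
      by (intro exI[of _ "\<lambda>n. f n + g n"] conjI allI Dadd f g tendsto_add)
    show "x * y \<in> closure D"
      unfolding closure_sequential
      by (intro exI[of _ "\<lambda>n. f n * g n"] conjI allI Dmult f g tendsto_mult)
  qed
  moreover have "G \<subseteq> closure D" "1 \<in> closure D" using D01 closure_subset by blast+
  ultimately have "closure D = UNIV" using G(2) unfolding generates_def by blast
  then show ?thesis using that cD by blast
qed

text \<open>A convex combination, with weights \<open>2 ^ -(n+1)\<close>, of states \<open>\<phi> n\<close> that attain the norms of
  the members \<open>d n\<close> of a dense sequence. If it vanishes at \<open>star x * x\<close>, then so does each \<open>\<phi> n\<close>;
  choosing \<open>d n\<close> closer to \<open>x\<close> than half its norm contradicts the triangle inequality for the form
  of \<open>\<phi> n\<close>. The state separates all elements, so a single GNS space carries a faithful representation.\<close>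

lemma faithful_state_exists:
  fixes G :: "'a::unital_cstar_algebra set"
  assumes "countable G" "generates G"
  obtains \<psi> :: "'a \<Rightarrow> complex" where "state \<psi>" "\<And>x. \<psi> (star x * x) = 0 \<Longrightarrow> x = 0"
proof -
  obtain D :: "'a set" where D: "countable D" "closure D = UNIV"
    using countable_dense_of_generates[OF assms] by blast
  then have "D \<noteq> {}" by auto
  define d where "d = from_nat_into D"
  have "\<exists>\<phi>. state \<phi> \<and> \<phi> (star (d n) * d n) = of_real ((norm (d n))\<^sup>2)" for n
    using state_attaining_norm[of "d n"] by blast
  then obtain \<phi> where st: "\<And>n. state (\<phi> n)"
    and at: "\<And>n. \<phi> n (star (d n) * d n) = of_real ((norm (d n))\<^sup>2)"
    by metis
  have lin: "clinear_functional (\<phi> n)" and one: "\<phi> n 1 = 1" for n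
    using st[of n] by (auto simp: state_def)
  define w :: "nat \<Rightarrow> real" where "w n = (1/2) ^ Suc n" for n
  have w0: "w n > 0" for n by (simp add: w_def)
  have w: "w sums 1" unfolding w_def by (rule power_half_series)
  have sm: "summable (\<lambda>n. of_real (w n) * \<phi> n x)" for x
  proof (rule summable_comparison_test'[of "\<lambda>n. w n * norm x" 0])
    show "summable (\<lambda>n. w n * norm x)" using w by (intro summable_mult2) (rule sums_summable)
    show "norm (of_real (w n) * \<phi> n x) \<le> w n * norm x" for n
      using state_norm_le[OF st[of n], of x] w0[of n] by (simp add: norm_mult)
  qed
  define \<psi> where "\<psi> x = (\<Sum>n. of_real (w n) * \<phi> n x)" for x
  have re: "Re (\<phi> n (star x * x)) \<ge> 0" "Im (\<phi> n (star x * x)) = 0" for n x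
    using st[of n] by (auto simp: state_def elim!: nonneg_Reals_cases)
      (metis complex_nonneg_Reals_iff)+
  have srv: "(\<lambda>n. w n * Re (\<phi> n x)) sums Re (\<psi> x)" "(\<lambda>n. w n * Im (\<phi> n x)) sums Im (\<psi> x)" for x
    using summable_sums[OF sm[of x]] unfolding \<psi>_def sums_complex_iff by simp_all
  have pos: "Im (\<psi> (star x * x)) = 0" "Re (\<psi> (star x * x)) \<ge> 0"
    and zero: "Re (\<psi> (star x * x)) = 0 \<Longrightarrow> Re (\<phi> n (star x * x)) = 0" for x n
  proof -
    show "Im (\<psi> (star x * x)) = 0"
      using srv(2)[of "star x * x"] re(2) sums_unique2[OF _ sums_zero] by simp
    have nn: "w n * Re (\<phi> n (star x * x)) \<ge> 0" for n using w0[of n] re(1) by simp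
    show "Re (\<psi> (star x * x)) \<ge> 0" by (rule sums_le[OF _ sums_zero srv(1)]) (rule nn)
    assume "Re (\<psi> (star x * x)) = 0"
    then show "Re (\<phi> n (star x * x)) = 0"
      using srv(1)[of "star x * x"] suminf_eq_zero_iff[OF sums_summable nn] w0[of n]
      by (auto simp: sums_iff dest!: spec[of _ n])
  qed
  have "state \<psi>"
    unfolding state_def clinear_functional_def
  proof (intro conjI allI)
    show "\<psi> (a + b) = \<psi> a + \<psi> b" for a b
      unfolding \<psi>_def suminf_add[OF sm sm]
      by (simp add: linear_functional_simps[OF lin] distrib_left)
    show "\<psi> (c *\<^sub>C a) = c * \<psi> a" for c a
      unfolding \<psi>_def suminf_mult[OF sm, symmetric]
      by (simp add: linear_functional_simps[OF lin] mult.left_commute)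
    show "\<psi> (star a * a) \<in> \<real>\<^sub>\<ge>\<^sub>0" for a
      using pos[of a] by (simp add: complex_nonneg_Reals_iff)
    have "(\<lambda>n. complex_of_real (w n)) sums of_real 1" using w by (rule sums_of_real)
    then show "\<psi> 1 = 1" unfolding \<psi>_def by (simp add: one sums_iff)
  qed
  moreover have "x = 0" if x: "\<psi> (star x * x) = 0" for x
  proof (rule ccontr)
    assume "x \<noteq> 0"
    then have "norm x / 2 > 0" by simp
    moreover have "x \<in> closure D" using D by simp
    ultimately obtain y where "y \<in> D" and yx: "dist y x < norm x / 2"
      unfolding closure_approachable by blast
    then obtain n where y: "y = d n"
      unfolding d_def using from_nat_into_surj[OF D(1)] by metis
    interpret psd_form UNIV "\<lambda>x y. \<phi> n (star y * x)" by (rule psd_form_state[OF st])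
    have "Re (\<phi> n (star x * x)) = 0" using zero[of x n] x by simp
    then have "sqrt (Re (\<phi> n (star y * y))) \<le> sqrt (Re (\<phi> n (star (y - x) * (y - x))))"
      using form_triangle[of x "y - x"] by simp
    also have "\<dots> \<le> sqrt ((norm (y - x))\<^sup>2)"
      by (intro real_sqrt_le_mono state_star_mult_le[OF st])
    finally have "norm y \<le> norm (y - x)" using at[of n] by (simp add: y)
    then show False
      using yx norm_triangle_ineq4[of y "y - x"] by (simp add: dist_norm)
  qed
  ultimately show ?thesis using that by blast
qed


section \<open>The sequence space is complete\<close>

lemma ell2_nth_diff: "ell2_nth (x - y) n = ell2_nth x n - ell2_nth y n"
  unfolding minus_ell2_def plus_ell2.rep_eq uminus_ell2.rep_eq by (rule add_uminus_conv_diff)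

lemma ell2_norm_sums: "(\<lambda>n. (cmod (ell2_nth x n))\<^sup>2) sums (norm x)\<^sup>2"
proof -
  have sm: "summable (\<lambda>n. ell2_nth x n * cnj (ell2_nth x n))"
    by (intro ell2_summable_mult ell2_nth_summable)
  have "(\<lambda>n. Re (ell2_nth x n * cnj (ell2_nth x n))) sums Re (cinner x x)"
    unfolding cinner_ell2_def by (rule bounded_linear.sums[OF bounded_linear_Re summable_sums[OF sm]])
  moreover have "Re (cinner x x) = (norm x)\<^sup>2" by (simp add: cinner_self)
  ultimately show ?thesis by (simp add: complex_mult_cnj cmod_power2)
qed

lemma ell2_partial_norm: "(\<Sum>n<N. (cmod (ell2_nth x n))\<^sup>2) \<le> (norm x)\<^sup>2"
  using sum_le_suminf[OF ell2_nth_summable, of "{..<N}" x] ell2_norm_sums[of x]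
  by (simp add: sums_iff)

lemma ell2_nth_le_norm: "cmod (ell2_nth x n) \<le> norm x"
proof (rule power2_le_imp_le)
  show "(cmod (ell2_nth x n))\<^sup>2 \<le> (norm x)\<^sup>2"
  proof -
    have "0 \<le> (\<Sum>n<n. (cmod (ell2_nth x n))\<^sup>2)" by (intro sum_nonneg) simp
    then show ?thesis using ell2_partial_norm[of x "Suc n"] unfolding sum.lessThan_Suc by linarith
  qed
qed simp

text \<open>Coordinates converge, and the bounds on partial sums of the norm pass to the limit.\<close>

lemma complete_ell2: "complete (UNIV :: ell2 set)"
  unfolding complete_def
proof (intro allI impI)
  fix X :: "nat \<Rightarrow> ell2" assume "(\<forall>n. X n \<in> UNIV) \<and> Cauchy X"
  then have X: "Cauchy X" by blast
  have "Cauchy (\<lambda>k. ell2_nth (X k) n)" for n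
  proof (rule metric_CauchyI)
    fix e :: real assume "e > 0"
    then obtain M where M: "\<And>k m. k \<ge> M \<Longrightarrow> m \<ge> M \<Longrightarrow> dist (X k) (X m) < e"
      using metric_CauchyD[OF X] by blast
    show "\<exists>M. \<forall>m\<ge>M. \<forall>k\<ge>M. dist (ell2_nth (X m) n) (ell2_nth (X k) n) < e"
    proof (intro exI[of _ M] allI impI)
      fix m k assume "M \<le> m" "M \<le> k"
      from M[OF this] show "dist (ell2_nth (X m) n) (ell2_nth (X k) n) < e"
        using ell2_nth_le_norm[of "X m - X k" n] by (simp add: dist_norm ell2_nth_diff)
    qed
  qed
  then obtain L where L: "\<And>n. (\<lambda>k. ell2_nth (X k) n) \<longlonglongrightarrow> L n"
    unfolding Cauchy_convergent_iff convergent_def by metis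
  have part: "(\<Sum>n<N. (cmod (ell2_nth (X k) n - L n))\<^sup>2) \<le> e\<^sup>2"
    if "e > 0" "\<forall>m\<ge>M. dist (X k) (X m) < e" for e k M N
  proof (rule LIMSEQ_le_const2)
    show "(\<lambda>m. \<Sum>n<N. (cmod (ell2_nth (X k) n - ell2_nth (X m) n))\<^sup>2)
        \<longlonglongrightarrow> (\<Sum>n<N. (cmod (ell2_nth (X k) n - L n))\<^sup>2)"
      by (intro tendsto_intros L)
    show "\<exists>M. \<forall>m\<ge>M. (\<Sum>n<N. (cmod (ell2_nth (X k) n - ell2_nth (X m) n))\<^sup>2) \<le> e\<^sup>2"
    proof (intro exI[of _ M] allI impI)
      fix m assume "M \<le> m"
      have "(\<Sum>n<N. (cmod (ell2_nth (X k) n - ell2_nth (X m) n))\<^sup>2) \<le> (norm (X k - X m))\<^sup>2"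
        using ell2_partial_norm[of "X k - X m" N] by (simp add: ell2_nth_diff)
      also have "\<dots> \<le> e\<^sup>2" using that(2) \<open>M \<le> m\<close> by (intro power_mono) (auto simp: dist_norm intro: less_imp_le)
      finally show "(\<Sum>n<N. (cmod (ell2_nth (X k) n - ell2_nth (X m) n))\<^sup>2) \<le> e\<^sup>2" .
    qed
  qed
  have sm: "summable (\<lambda>n. (cmod (ell2_nth (X k) n - L n))\<^sup>2)"
    and le: "(\<Sum>n. (cmod (ell2_nth (X k) n - L n))\<^sup>2) \<le> e\<^sup>2"
    if "e > 0" "\<forall>m\<ge>M. dist (X k) (X m) < e" for e k M
  proof -
    show s: "summable (\<lambda>n. (cmod (ell2_nth (X k) n - L n))\<^sup>2)"
      by (rule summableI_nonneg_bounded[where x="e\<^sup>2"]) (use part[OF that] in auto)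
    show "(\<Sum>n. (cmod (ell2_nth (X k) n - L n))\<^sup>2) \<le> e\<^sup>2"
      by (rule suminf_le_const[OF s part[OF that]])
  qed
  obtain M0 where M0: "\<And>k m. k \<ge> M0 \<Longrightarrow> m \<ge> M0 \<Longrightarrow> dist (X k) (X m) < 1"
    using metric_CauchyD[OF X, of 1] by auto
  have "summable (\<lambda>n. (cmod (ell2_nth (X M0) n + - (ell2_nth (X M0) n - L n)))\<^sup>2)"
  proof (intro ell2_summable_add ell2_nth_summable)
    have "summable (\<lambda>n. (cmod (ell2_nth (X M0) n - L n))\<^sup>2)"
      by (rule sm[of 1 M0]) (use M0 in auto)
    then show "summable (\<lambda>n. (cmod (- (ell2_nth (X M0) n - L n)))\<^sup>2)"
      by (simp only: norm_minus_cancel)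
  qed
  then have sL: "summable (\<lambda>n. (cmod (L n))\<^sup>2)" by simp
  define l where "l = Abs_ell2 L"
  have l: "ell2_nth l = L" using sL by (simp add: l_def Abs_ell2_inverse)
  have "X \<longlonglongrightarrow> l"
  proof (rule metric_LIMSEQ_I)
    fix e :: real assume "e > 0"
    then have e2: "e / 2 > 0" by simp
    then obtain M where M: "\<And>k m. k \<ge> M \<Longrightarrow> m \<ge> M \<Longrightarrow> dist (X k) (X m) < e / 2"
      using metric_CauchyD[OF X] by blast
    have "dist (X k) l < e" if "k \<ge> M" for k
    proof -
      have "(norm (X k - l))\<^sup>2 = (\<Sum>n. (cmod (ell2_nth (X k) n - L n))\<^sup>2)"
        using ell2_norm_sums[of "X k - l"] by (simp add: ell2_nth_diff l sums_iff)
      also have "\<dots> \<le> (e / 2)\<^sup>2" using le[OF e2, of M k] M[OF that] by blast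
      finally have "norm (X k - l) \<le> e / 2" using e2 power2_le_imp_le by fastforce
      then show ?thesis using \<open>e > 0\<close> by (simp add: dist_norm)
    qed
    then show "\<exists>M. \<forall>k\<ge>M. dist (X k) l < e" by blast
  qed
  then show "\<exists>l\<in>UNIV. X \<longlonglongrightarrow> l" by blast
qed


section \<open>Embedding a separable semidefinite form into the sequence space\<close>

text \<open>The form may be degenerate: a vector that is null modulo its predecessors contributes 0, so that
  the vectors form an orthonormal system padded with zeros.\<close>

fun gram_schmidt :: "('v::complex_vector \<Rightarrow> 'v \<Rightarrow> complex) \<Rightarrow> (nat \<Rightarrow> 'v) \<Rightarrow> nat \<Rightarrow> 'v" where
  "gram_schmidt s d n =
    (let w = d n - (\<Sum>k<n. s (d n) (gram_schmidt s d k) *\<^sub>C gram_schmidt s d k)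
     in if Re (s w w) = 0 then 0 else of_real (1 / sqrt (Re (s w w))) *\<^sub>C w)"

declare gram_schmidt.simps [simp del]

context psd_form
begin

lemma gram_schmidt_mem:
  assumes d: "\<And>n. d n \<in> V"
  shows "gram_schmidt s d n \<in> V"
proof (induction n rule: less_induct)
  case (less n)
  then show ?case
    by (subst gram_schmidt.simps)
      (auto simp: Let_def zero_mem simp del: of_real_divide intro!: scale_mem diff_mem d sum_mem)
qed

lemma gram_schmidt_orthonormal:
  assumes d: "\<And>n. d n \<in> V"
  shows gram_schmidt_self: "s (gram_schmidt s d n) (gram_schmidt s d n) \<in> {0, 1}"
    and gram_schmidt_orthogonal:
      "k \<noteq> n \<Longrightarrow> s (gram_schmidt s d k) (gram_schmidt s d n) = 0"
proof -
  define e where "e = gram_schmidt s d"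
  have eV: "e n \<in> V" for n unfolding e_def by (rule gram_schmidt_mem[of d, OF d])
  define w where "w n = d n - (\<Sum>k<n. s (d n) (e k) *\<^sub>C e k)" for n
  have wV: "w n \<in> V" for n unfolding w_def by (intro diff_mem d sum_mem scale_mem eV)
  have e: "e n = (if Re (s (w n) (w n)) = 0 then 0 else of_real (1 / sqrt (Re (s (w n) (w n)))) *\<^sub>C w n)" for n
    unfolding e_def w_def by (subst gram_schmidt.simps) (simp add: Let_def)
  have self: "s (e n) (e n) \<in> {0, 1}" for n
  proof (cases "Re (s (w n) (w n)) = 0")
    case False
    then have p: "Re (s (w n) (w n)) > 0" using nonneg[OF wV] by (simp add: less_le)
    define r where "r = sqrt (Re (s (w n) (w n)))"
    have r: "r > 0" "Re (s (w n) (w n)) = r * r" using p by (simp_all add: r_def)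
    have "e n = of_real (1 / r) *\<^sub>C w n" using False by (simp add: e r_def)
    then have "s (e n) (e n) = of_real (1 / r) * (of_real (1 / r) * s (w n) (w n))"
      by (simp add: scale_left scale_right scale_mem wV)
    also have "s (w n) (w n) = of_real (r * r)" using form_self[OF wV, of n] r by simp
    finally show ?thesis using r by simp
  qed (simp add: e zero_left zero_mem)
  have orth: "\<forall>k<n. s (e n) (e k) = 0" for n
  proof (induction n rule: less_induct)
    case (less n)
    have ee: "s (e j) (e k) = 0" if "j < n" "k < n" "j \<noteq> k" for j k
    proof (cases "j < k")
      case True
      then have "s (e k) (e j) = 0" using less that by blast
      then show ?thesis using hermitian[OF eV eV, of j k] by simp
    next
      case False
      then show ?thesis using less that by auto
    qed
    have wk: "s (w n) (e k) = 0" if "k < n" for k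
    proof -
      have "s (\<Sum>j<n. s (d n) (e j) *\<^sub>C e j) (e k) = (\<Sum>j<n. s (d n) (e j) * s (e j) (e k))"
        by (simp add: sum_left scale_mem eV scale_left)
      also have "\<dots> = (\<Sum>j<n. if j = k then s (d n) (e k) * s (e k) (e k) else 0)"
        by (intro sum.cong) (auto simp: ee that)
      also have "\<dots> = s (d n) (e k) * s (e k) (e k)" using that by simp
      also have "\<dots> = s (d n) (e k)"
      proof (cases "s (e k) (e k) = 0")
        case True
        then have "s (e k) (d n) = 0" by (intro form_null eV d) simp
        then show ?thesis using hermitian[OF d eV, of n k] by simp
      next
        case False
        then show ?thesis using self[of k] by auto
      qed
      finally show ?thesis
        unfolding w_def by (subst diff_left) (auto intro!: d sum_mem scale_mem eV)
    qed
    show ?case by (auto simp: e[of n] zero_left eV scale_left wV wk)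
  qed
  show "s (gram_schmidt s d n) (gram_schmidt s d n) \<in> {0, 1}"
    using self by (simp add: e_def)
  show "k \<noteq> n \<Longrightarrow> s (gram_schmidt s d k) (gram_schmidt s d n) = 0"
    using orth[of k] orth[of n] hermitian[OF eV eV, of k n]
    by (cases "k < n") (auto simp: e_def)
qed

lemma gram_schmidt_projection:
  assumes d: "\<And>n. d n \<in> V" and u: "u \<in> V"
  defines "P \<equiv> \<lambda>n u. \<Sum>k<n. s u (gram_schmidt s d k) *\<^sub>C gram_schmidt s d k"
  shows gram_schmidt_pythagoras: "Re (s u u) =
      (\<Sum>k<n. (cmod (s u (gram_schmidt s d k)))\<^sup>2) + Re (s (u - P n u) (u - P n u))"
    and gram_schmidt_null: "Re (s (d n - P (Suc n) (d n)) (d n - P (Suc n) (d n))) = 0"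
proof -
  define e where "e = gram_schmidt s d"
  have eV: "e n \<in> V" for n unfolding e_def by (rule gram_schmidt_mem[of d, OF d])
  have orth: "k \<noteq> n \<Longrightarrow> s (e k) (e n) = 0" for k n
    unfolding e_def by (rule gram_schmidt_orthogonal[of d, OF d])
  have self: "s (e n) (e n) \<in> {0, 1}" for n
    unfolding e_def by (rule gram_schmidt_self[of d, OF d])
  have abs: "s v (e k) * s (e k) (e k) = s v (e k)" if v: "v \<in> V" for v k
  proof (cases "s (e k) (e k) = 0")
    case True
    then have "s (e k) v = 0" by (intro form_null eV v) simp
    then show ?thesis using hermitian[OF v eV, of k] by simp
  next
    case False
    then show ?thesis using self[of k] by auto
  qed
  have P: "P n v = (\<Sum>k<n. s v (e k) *\<^sub>C e k)" for n v by (simp add: P_def e_def)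
  have PV: "P n v \<in> V" for n v unfolding P by (intro sum_mem scale_mem eV)
  have Pe: "s (P n v) (e k) = s v (e k)" if v: "v \<in> V" and k: "k < n" for n v k
  proof -
    have "s (P n v) (e k) = (\<Sum>j<n. s v (e j) * s (e j) (e k))"
      by (simp add: P sum_left scale_mem eV scale_left)
    also have "\<dots> = (\<Sum>j<n. if j = k then s v (e k) * s (e k) (e k) else 0)"
      by (intro sum.cong) (auto simp: orth)
    finally show ?thesis using k abs[OF v] by simp
  qed
  have uP: "s (u - P n u) (P n u) = 0"
  proof -
    have "s (P n u) (u - P n u) = 0"
      unfolding P[of n u, THEN arg_cong[where f="\<lambda>z. s z (u - P n u)"]]
    proof (subst sum_left)
      show "(\<Sum>k<n. s (s u (e k) *\<^sub>C e k) (u - P n u)) = 0"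
      proof (rule sum.neutral, rule ballI)
        fix k assume "k \<in> {..<n}"
        then have "s (u - P n u) (e k) = 0"
          using Pe[OF u, of k n] by (simp add: diff_left u PV eV)
        then have "s (e k) (u - P n u) = 0"
          using hermitian[OF eV[of k] diff_mem[OF u PV[of n u]]] by simp
        then show "s (s u (e k) *\<^sub>C e k) (u - P n u) = 0"
          by (simp add: scale_left eV diff_mem u PV)
      qed
    qed (auto intro!: scale_mem diff_mem eV u PV)
    then show ?thesis using hermitian[of "u - P n u" "P n u"] by (simp add: diff_mem u PV)
  qed
  have PP: "s (P n u) (P n u) = of_real (\<Sum>k<n. (cmod (s u (e k)))\<^sup>2)"
  proof -
    have "s (P n u) (P n u) = s u (P n u)"
      using uP by (simp add: diff_left u PV)
    also have "\<dots> = cnj (s (P n u) u)" by (rule hermitian[OF u PV])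
    also have "s (P n u) u = (\<Sum>k<n. s u (e k) * cnj (s u (e k)))"
      using hermitian[OF eV u] by (simp add: P sum_left scale_mem eV u scale_left)
    finally show ?thesis
      by (simp only: cnj_sum complex_cnj_mult complex_cnj_cnj of_real_sum complex_norm_square mult.commute)
  qed
  have "s u u = s (u - P n u) (u - P n u) + s (P n u) (P n u)"
  proof -
    have "s (u - P n u) (u - P n u) = s (u - P n u) u"
      using uP by (simp add: diff_right diff_mem u PV)
    also have "\<dots> = s u u - s (P n u) u" by (simp add: diff_left u PV)
    also have "s (P n u) u = cnj (s u (P n u))" by (rule hermitian[OF PV u])
    also have "s u (P n u) = s (P n u) (P n u)" using uP by (simp add: diff_left u PV)
    finally show ?thesis by (simp add: PP)
  qed
  then show "Re (s u u) = (\<Sum>k<n. (cmod (s u (gram_schmidt s d k)))\<^sup>2) + Re (s (u - P n u) (u - P n u))"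
    by (simp add: PP e_def)
  define w where "w = d n - P n (d n)"
  have wV: "w \<in> V" unfolding w_def by (intro diff_mem d PV)
  have e: "e n = (if Re (s w w) = 0 then 0 else of_real (1 / sqrt (Re (s w w))) *\<^sub>C w)"
    unfolding w_def P unfolding e_def by (subst gram_schmidt.simps) (simp add: Let_def)
  have "d n - P (Suc n) (d n) = w - s (d n) (e n) *\<^sub>C e n"
    by (simp add: w_def P)
  moreover have "s (d n) (e n) = s w (e n)"
  proof -
    have "s (P n (d n)) (e n) = (\<Sum>j<n. s (d n) (e j) * s (e j) (e n))"
      by (simp add: P sum_left scale_mem eV scale_left)
    also have "\<dots> = 0" by (intro sum.neutral) (auto simp: orth)
    finally show ?thesis by (simp add: w_def diff_left d PV eV)
  qed
  ultimately have r: "d n - P (Suc n) (d n) = w - s w (e n) *\<^sub>C e n" by simp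
  show "Re (s (d n - P (Suc n) (d n)) (d n - P (Suc n) (d n))) = 0"
  proof (cases "Re (s w w) = 0")
    case True
    then show ?thesis by (simp add: r e)
  next
    case False
    then have p: "Re (s w w) > 0" using nonneg[OF wV] by (simp add: less_le)
    have "s w (e n) = of_real (1 / sqrt (Re (s w w))) * s w w"
      using False by (simp add: e scale_right wV)
    also have "s w w = of_real (Re (s w w))" by (rule form_self[OF wV])
    finally have "s w (e n) *\<^sub>C e n = w"
      using p by (simp add: e scaleC_scaleC flip: of_real_mult of_real_divide)
    then show ?thesis by (simp add: r zero_left zero_mem)
  qed
qed

text \<open>Each \<open>d n\<close> differs by a null vector from its projection to the first \<open>n + 1\<close> vectors, so the
  defect in Bessel's inequality is at most the squared distance from \<open>u\<close> to \<open>d n\<close>.\<close>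

lemma gram_schmidt_parseval:
  assumes d: "\<And>n. d n \<in> V" and u: "u \<in> V"
    and dense: "\<And>e. e > 0 \<Longrightarrow> \<exists>n. Re (s (u - d n) (u - d n)) < e"
  shows "(\<lambda>k. (cmod (s u (gram_schmidt s d k)))\<^sup>2) sums Re (s u u)"
proof -
  define P where "P n u = (\<Sum>k<n. s u (gram_schmidt s d k) *\<^sub>C gram_schmidt s d k)" for n u
  note pyth = gram_schmidt_pythagoras[of d, OF d, folded P_def]
  have PV: "P n v \<in> V" for n v unfolding P_def by (intro sum_mem scale_mem gram_schmidt_mem[of d, OF d])
  let ?S = "\<lambda>n. \<Sum>k<n. (cmod (s u (gram_schmidt s d k)))\<^sup>2"
  have up: "?S n \<le> Re (s u u)" for n
    using pyth[OF u, of n] nonneg[of "u - P n u"] by (simp add: diff_mem u PV)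
  have sm: "summable (\<lambda>k. (cmod (s u (gram_schmidt s d k)))\<^sup>2)"
    by (rule summableI_nonneg_bounded[OF _ up]) simp
  have "Re (s u u) \<le> (\<Sum>k. (cmod (s u (gram_schmidt s d k)))\<^sup>2)"
  proof (rule field_le_epsilon)
    fix e :: real assume "e > 0"
    then obtain n where n: "Re (s (u - d n) (u - d n)) < e" using dense by blast
    let ?m = "Suc n"
    have PD: "P ?m (u - d n) = P ?m u - P ?m (d n)"
      unfolding P_def
      by (simp add: diff_left u d gram_schmidt_mem scaleC_diff_left sum_subtractf del: sum.lessThan_Suc)
    have eq: "u - P ?m u = ((u - d n) - P ?m (u - d n)) + (d n - P ?m (d n))"
      by (simp add: PD)
    have "sqrt (Re (s (u - P ?m u) (u - P ?m u))) \<le>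
        sqrt (Re (s ((u - d n) - P ?m (u - d n)) ((u - d n) - P ?m (u - d n))))
        + sqrt (Re (s (d n - P ?m (d n)) (d n - P ?m (d n))))"
      unfolding eq by (rule form_triangle) (intro diff_mem u d PV)+
    also have "Re (s (d n - P ?m (d n)) (d n - P ?m (d n))) = 0"
      using gram_schmidt_null[of d, OF d u, of n] unfolding P_def .
    finally have "Re (s (u - P ?m u) (u - P ?m u)) \<le>
        Re (s ((u - d n) - P ?m (u - d n)) ((u - d n) - P ?m (u - d n)))" by simp
    also have "\<dots> \<le> Re (s (u - d n) (u - d n))"
      using pyth[OF diff_mem[OF u d[of n]], of ?m]
        sum_nonneg[of "{..<?m}" "\<lambda>k. (cmod (s (u - d n) (gram_schmidt s d k)))\<^sup>2"]
      by simp
    finally have "Re (s u u) \<le> ?S ?m + e" using pyth[OF u, of ?m] n by simp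
    also have "?S ?m \<le> (\<Sum>k. (cmod (s u (gram_schmidt s d k)))\<^sup>2)"
      by (rule sum_le_suminf[OF sm]) auto
    finally show "Re (s u u) \<le> (\<Sum>k. (cmod (s u (gram_schmidt s d k)))\<^sup>2) + e" by simp
  qed
  moreover have "(\<Sum>k. (cmod (s u (gram_schmidt s d k)))\<^sup>2) \<le> Re (s u u)"
    by (rule suminf_le_const[OF sm up])
  ultimately show ?thesis using sm by (simp add: sums_iff)
qed

lemma polarization:
  assumes "x \<in> V" "y \<in> V"
  shows "s x y = Complex ((Re (s (x + y) (x + y)) - Re (s x x) - Re (s y y)) / 2)
    ((Re (s (x + \<i> *\<^sub>C y) (x + \<i> *\<^sub>C y)) - Re (s x x) - Re (s y y)) / 2)"
proof -
  have 1: "Re (s (u + v) (u + v)) = Re (s u u) + Re (s v v) + 2 * Re (s u v)" if "u \<in> V" "v \<in> V" for u v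
    using that hermitian[of u v] by (simp add: add_left add_right add_mem)
  show ?thesis
    using assms 1[of x y] 1[of x "\<i> *\<^sub>C y"]
    by (simp add: scale_mem scale_left scale_right complex_eq_iff)
qed

text \<open>The Fourier coefficients of a vector. Parseval gives the diagonal, polarization the rest. The
  form may be degenerate: null vectors go to 0.\<close>

theorem ell2_embedding:
  assumes D: "countable D" "D \<subseteq> V"
    and dense: "\<And>u e. u \<in> V \<Longrightarrow> e > 0 \<Longrightarrow> \<exists>d\<in>D. Re (s (u - d) (u - d)) < e"
  obtains J :: "'v \<Rightarrow> ell2" where
    "\<And>x y. x \<in> V \<Longrightarrow> y \<in> V \<Longrightarrow> J (x + y) = J x + J y"
    "\<And>c x. x \<in> V \<Longrightarrow> J (c *\<^sub>C x) = c *\<^sub>C J x"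
    "\<And>x y. x \<in> V \<Longrightarrow> y \<in> V \<Longrightarrow> cinner (J x) (J y) = s x y"
proof -
  have "D \<noteq> {}" using dense[OF zero_mem, of 1] by auto
  define d where "d = from_nat_into D"
  have d: "d n \<in> V" for n using from_nat_into[OF \<open>D \<noteq> {}\<close>] D(2) by (auto simp: d_def)
  have pars: "(\<lambda>k. (cmod (s u (gram_schmidt s d k)))\<^sup>2) sums Re (s u u)" if u: "u \<in> V" for u
  proof (rule gram_schmidt_parseval[of d, OF d u])
    fix e :: real assume "e > 0"
    then obtain x where "x \<in> D" "Re (s (u - x) (u - x)) < e" using dense[OF u] by blast
    then show "\<exists>n. Re (s (u - d n) (u - d n)) < e"
      unfolding d_def using from_nat_into_surj[OF D(1)] by metis
  qed
  define J where "J u = Abs_ell2 (\<lambda>k. s u (gram_schmidt s d k))" for u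
  have J: "ell2_nth (J u) k = s u (gram_schmidt s d k)" if "u \<in> V" for u k
    using sums_summable[OF pars[OF that]] by (simp add: J_def Abs_ell2_inverse)
  have eV: "gram_schmidt s d k \<in> V" for k by (rule gram_schmidt_mem[of d, OF d])
  have add: "J (x + y) = J x + J y" if "x \<in> V" "y \<in> V" for x y
    using that by (simp add: J add_mem plus_ell2.rep_eq add_left eV fun_eq_iff flip: ell2_nth_inject)
  have sc: "J (c *\<^sub>C x) = c *\<^sub>C J x" if "x \<in> V" for c x
    using that by (simp add: J scale_mem scaleC_ell2.rep_eq scale_left eV fun_eq_iff flip: ell2_nth_inject)
  have self: "Re (cinner (J x) (J x)) = Re (s x x)" if "x \<in> V" for x
    using ell2_norm_sums[of "J x"] pars[OF that] that
    by (simp add: J cinner_self sums_unique2)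
  have "cinner (J x) (J y) = s x y" if "x \<in> V" "y \<in> V" for x y
  proof -
    have "Re (cinner (J x + J y) (J x + J y)) = Re (s (x + y) (x + y))"
      using self[of "x + y"] that by (simp add: add add_mem)
    moreover have "Re (cinner (J x + \<i> *\<^sub>C J y) (J x + \<i> *\<^sub>C J y)) = Re (s (x + \<i> *\<^sub>C y) (x + \<i> *\<^sub>C y))"
      using self[of "x + \<i> *\<^sub>C y"] that by (simp add: add sc add_mem scale_mem)
    ultimately show ?thesis
      using cin.polarization[of "J x" "J y"] polarization[OF that] self that by simp
  qed
  with add sc show ?thesis using that by blast
qed

end


section \<open>Bounded operators\<close>

lemma bounded_opsD:
  assumes "T \<in> bounded_ops H K"
  shows bounded_ops_mem: "x \<in> H \<Longrightarrow> T x \<in> K"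
    and bounded_ops_add: "x \<in> H \<Longrightarrow> y \<in> H \<Longrightarrow> T (x + y) = T x + T y"
    and bounded_ops_scale: "x \<in> H \<Longrightarrow> T (c *\<^sub>C x) = c *\<^sub>C T x"
    and bounded_ops_undefined: "x \<notin> H \<Longrightarrow> T x = undefined"
  using assms unfolding bounded_ops_def by (auto simp: PiE_def extensional_def)

lemma bounded_ops_bound:
  assumes "T \<in> bounded_ops H K"
  obtains C where "C \<ge> 0" "\<And>x. x \<in> H \<Longrightarrow> norm (T x) \<le> C * norm x"
proof -
  have "\<exists>C. \<forall>x\<in>H. norm (T x) \<le> C * norm x"
    using assms unfolding bounded_ops_def by blast
  then obtain C where C: "\<And>x. x \<in> H \<Longrightarrow> norm (T x) \<le> C * norm x" by metis
  have "norm (T x) \<le> max C 0 * norm x" if "x \<in> H" for x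
    using C[OF that] mult_right_mono[of C "max C 0" "norm x"] by simp
  then show ?thesis using that[of "max C 0"] by simp
qed

lemma bounded_opsI:
  assumes "\<And>x. x \<in> H \<Longrightarrow> f x \<in> K"
    and "\<And>x y. x \<in> H \<Longrightarrow> y \<in> H \<Longrightarrow> f (x + y) = f x + f y"
    and "\<And>c x. x \<in> H \<Longrightarrow> f (c *\<^sub>C x) = c *\<^sub>C f x"
    and "\<And>x. x \<in> H \<Longrightarrow> norm (f x) \<le> C * norm x"
    and H: "csubspace H"
  shows "restrict f H \<in> bounded_ops H K"
proof -
  have "x + y \<in> H" "c *\<^sub>C x \<in> H" if "x \<in> H" "y \<in> H" for x y c
    using H that unfolding csubspace_def by auto
  then show ?thesis using assms(1-4) unfolding bounded_ops_def by (auto intro: exI[of _ C])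
qed

lemma psd_form_subspace: "csubspace H \<Longrightarrow> psd_form H (cinner :: 'h::complex_inner \<Rightarrow> 'h \<Rightarrow> complex)"
  by unfold_locales
    (auto simp: cin.add_left cin.scale_left cin.nonneg intro: cinner_commute)

lemma bounded_ops_diff:
  assumes "csubspace H" "T \<in> bounded_ops H K" "x \<in> H" "y \<in> H"
  shows "T (x - y) = T x - T y"
proof -
  interpret psd_form H cinner by (rule psd_form_subspace[OF assms(1)])
  have "T (x + (-1) *\<^sub>C y) = T x + (-1) *\<^sub>C T y"
    using assms by (simp add: bounded_opsD[OF assms(2)] scale_mem)
  then show ?thesis by (simp flip: scaleC_minus1)
qed

lemma bounded_ops_tendsto:
  assumes H: "csubspace H" and T: "T \<in> bounded_ops H K"
    and f: "\<And>n. f n \<in> H" "x \<in> H" "f \<longlonglongrightarrow> x"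
  shows "(\<lambda>n. T (f n)) \<longlonglongrightarrow> T x"
proof -
  interpret psd_form H cinner by (rule psd_form_subspace[OF H])
  obtain C where C: "C \<ge> 0" "\<And>x. x \<in> H \<Longrightarrow> norm (T x) \<le> C * norm x"
    using bounded_ops_bound[OF T] by blast
  have "(\<lambda>n. T (f n) - T x) \<longlonglongrightarrow> 0"
  proof (rule Lim_null_comparison)
    show "\<forall>\<^sub>F n in sequentially. norm (T (f n) - T x) \<le> C * norm (f n - x)"
      using C(2)[OF diff_mem[OF f(1) f(2)]]
      by (simp add: bounded_ops_diff[OF H T f(1) f(2)])
    have "(\<lambda>n. f n - x) \<longlonglongrightarrow> 0" using f(3) by (simp add: LIM_zero)
    then show "(\<lambda>n. C * norm (f n - x)) \<longlonglongrightarrow> 0"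
      by (intro tendsto_mult_right_zero tendsto_norm_zero)
  qed
  then show ?thesis by (simp add: LIM_zero_cancel)
qed

lemma bounded_ops_intros:
  assumes H: "csubspace H"
  shows compose_bounded: "S \<in> bounded_ops K L \<Longrightarrow> T \<in> bounded_ops H K \<Longrightarrow> compose H S T \<in> bounded_ops H L"
    and op_id_bounded: "op_id H \<in> bounded_ops H H"
    and op_scale_bounded: "csubspace K \<Longrightarrow> T \<in> bounded_ops H K \<Longrightarrow> op_scale H c T \<in> bounded_ops H K"
    and op_add_bounded: "csubspace K \<Longrightarrow> T \<in> bounded_ops H K \<Longrightarrow> T' \<in> bounded_ops H K
      \<Longrightarrow> op_add H T T' \<in> bounded_ops H K"
proof -
  show "op_id H \<in> bounded_ops H H"
    unfolding op_id_def by (rule bounded_opsI[where C=1]) (auto simp: H)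
next
  assume S: "S \<in> bounded_ops K L" and T: "T \<in> bounded_ops H K"
  obtain C where C: "C \<ge> 0" "\<And>x. x \<in> K \<Longrightarrow> norm (S x) \<le> C * norm x"
    using bounded_ops_bound[OF S] by blast
  obtain D where D: "D \<ge> 0" "\<And>x. x \<in> H \<Longrightarrow> norm (T x) \<le> D * norm x"
    using bounded_ops_bound[OF T] by blast
  have "norm (S (T x)) \<le> (C * D) * norm x" if "x \<in> H" for x
    using C(2)[OF bounded_ops_mem[OF T that]] mult_left_mono[OF D(2)[OF that] C(1)] by simp
  then show "compose H S T \<in> bounded_ops H L"
    unfolding compose_def
    by (intro bounded_opsI[where C="C * D"]) (auto simp: H bounded_opsD[OF S] bounded_opsD[OF T])
next
  assume K: "csubspace K" and T: "T \<in> bounded_ops H K"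
  interpret psd_form K cinner by (rule psd_form_subspace[OF K])
  obtain C where C: "C \<ge> 0" "\<And>x. x \<in> H \<Longrightarrow> norm (T x) \<le> C * norm x"
    using bounded_ops_bound[OF T] by blast
  show "op_scale H c T \<in> bounded_ops H K"
    unfolding op_scale_def
    by (rule bounded_opsI[where C="cmod c * C"])
      (auto simp: H bounded_opsD[OF T] scale_mem scaleC_add_right scaleC_scaleC mult.commute[of c]
        mult.assoc intro!: mult_left_mono C(2))
next
  assume K: "csubspace K" and S: "T \<in> bounded_ops H K" and T: "T' \<in> bounded_ops H K"
  interpret psd_form K cinner by (rule psd_form_subspace[OF K])
  obtain C where C: "C \<ge> 0" "\<And>x. x \<in> H \<Longrightarrow> norm (T x) \<le> C * norm x"
    using bounded_ops_bound[OF S] by blast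
  obtain D where D: "D \<ge> 0" "\<And>x. x \<in> H \<Longrightarrow> norm (T' x) \<le> D * norm x"
    using bounded_ops_bound[OF T] by blast
  have "norm (T x + T' x) \<le> (C + D) * norm x" if "x \<in> H" for x
    using norm_triangle_ineq[of "T x" "T' x"] C(2)[OF that] D(2)[OF that]
    by (simp add: distrib_right)
  then show "op_add H T T' \<in> bounded_ops H K"
    unfolding op_add_def
    by (intro bounded_opsI[where C="C + D"])
      (auto simp: H bounded_opsD[OF S] bounded_opsD[OF T] add_mem scaleC_add_right)
qed

lemma op_norm_bound:
  assumes H: "csubspace H" and T: "T \<in> bounded_ops H K" and x: "x \<in> H"
  shows "norm (T x) \<le> op_norm H T * norm x"
proof -
  interpret psd_form H cinner by (rule psd_form_subspace[OF H])
  obtain C where C: "C \<ge> 0" "\<And>x. x \<in> H \<Longrightarrow> norm (T x) \<le> C * norm x"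
    using bounded_ops_bound[OF T] by blast
  have bdd: "bdd_above ((\<lambda>x. norm (T x)) ` {x \<in> H. norm x \<le> 1})"
    by (rule bdd_aboveI2[where M=C])
      (use C in \<open>auto intro: order_trans mult_left_le\<close>)
  have T0: "T 0 = 0" using bounded_ops_scale[OF T zero_mem, of 0] by simp
  show ?thesis
  proof (cases "x = 0")
    case True
    then show ?thesis using T0 by simp
  next
    case False
    let ?u = "of_real (1 / norm x) *\<^sub>C x"
    have "?u \<in> {x \<in> H. norm x \<le> 1}" using x False by (simp add: scale_mem norm_divide)
    then have "norm (T ?u) \<le> op_norm H T" unfolding op_norm_def by (rule cSUP_upper[OF _ bdd])
    then show ?thesis using False x
      by (simp add: bounded_ops_scale[OF T] norm_divide field_simps)
  qed
qed

lemma op_ext: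
  assumes "S \<in> bounded_ops H K" "T \<in> bounded_ops H K" "\<And>x. x \<in> H \<Longrightarrow> S x = T x"
  shows "S = T"
  using assms bounded_ops_undefined by (metis ext)


section \<open>Operators defined by forms\<close>

text \<open>A semidefinite form \<open>s\<close> on \<open>V\<close> together with its Hilbert space \<open>E\<close>: \<open>J\<close> preserves the form and
  has dense range. Operators on \<open>E\<close> are accessible only through their forms on \<open>V\<close>, and the lemmas
  below build and compare them that way. The identity map of a Hilbert space is the special case
  that yields adjoints.\<close>

locale dense_embedding = psd_form V s
  for V :: "'v::complex_vector set" and s :: "'v \<Rightarrow> 'v \<Rightarrow> complex" +
  fixes J :: "'v \<Rightarrow> 'e::complex_inner" and E :: "'e set"
  assumes J_add: "x \<in> V \<Longrightarrow> y \<in> V \<Longrightarrow> J (x + y) = J x + J y"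
    and J_scale: "x \<in> V \<Longrightarrow> J (c *\<^sub>C x) = c *\<^sub>C J x"
    and J_inner: "x \<in> V \<Longrightarrow> y \<in> V \<Longrightarrow> cinner (J x) (J y) = s x y"
    and E_closure: "E = closure (J ` V)"
    and E_complete: "complete E"
begin

lemma J_mem: "v \<in> V \<Longrightarrow> J v \<in> E"
  unfolding E_closure using closure_subset[of "J ` V"] by blast

lemma J_norm: "v \<in> V \<Longrightarrow> norm (J v) = sqrt (Re (s v v))"
  using J_inner[of v v, symmetric] by (simp add: cinner_self del: of_real_power)

lemma J_diff: "x \<in> V \<Longrightarrow> y \<in> V \<Longrightarrow> J (x - y) = J x - J y"
  using J_add[of x "(-1) *\<^sub>C y"] J_scale[of y "-1"] scale_mem[of y "-1"]
  by (simp flip: scaleC_minus1)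

lemma E_approx:
  assumes "e \<in> E"
  obtains u where "\<And>n. u n \<in> V" "(\<lambda>n. J (u n)) \<longlonglongrightarrow> e"
proof -
  obtain f where f: "\<And>n. f n \<in> J ` V" "f \<longlonglongrightarrow> e"
    using assms unfolding E_closure closure_sequential by blast
  then have "\<forall>n. \<exists>u. u \<in> V \<and> f n = J u" by blast
  then obtain u where "\<And>n. u n \<in> V" "\<And>n. f n = J (u n)" by metis
  moreover have "f = (\<lambda>n. J (u n))" using calculation by auto
  ultimately show ?thesis using that[of u] f(2) by blast
qed

lemma E_subspace: "csubspace E"
  unfolding csubspace_def
proof (intro conjI ballI allI)
  have "J 0 = 0" using J_scale[OF zero_mem, of 0] by simp
  then show "0 \<in> E" using J_mem[OF zero_mem] by simp
  fix x assume x: "x \<in> E"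
  obtain u where u: "\<And>n. u n \<in> V" "(\<lambda>n. J (u n)) \<longlonglongrightarrow> x" using E_approx[OF x] by blast
  show "c *\<^sub>C x \<in> E" for c
    unfolding E_closure closure_sequential
    by (intro exI[of _ "\<lambda>n. J (c *\<^sub>C u n)"] conjI allI imageI scale_mem u)
      (simp add: J_scale u bounded_bilinear.tendsto[OF bounded_bilinear_scaleC_inner])
  fix y assume y: "y \<in> E"
  obtain v where v: "\<And>n. v n \<in> V" "(\<lambda>n. J (v n)) \<longlonglongrightarrow> y" using E_approx[OF y] by blast
  show "x + y \<in> E"
    unfolding E_closure closure_sequential
    by (intro exI[of _ "\<lambda>n. J (u n + v n)"] conjI allI imageI add_mem u v)
      (simp add: J_add u v tendsto_add)
qed

lemma E_hilbert: "hilbert_space E"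
  unfolding hilbert_space_def using E_subspace E_complete by blast

lemma E_norm_le:
  assumes z: "z \<in> E" and M0: "M \<ge> 0"
    and M: "\<And>v. v \<in> V \<Longrightarrow> cmod (cinner (J v) z) \<le> M * norm (J v)"
  shows "norm z \<le> M"
proof -
  obtain u where u: "\<And>n. u n \<in> V" "(\<lambda>n. J (u n)) \<longlonglongrightarrow> z" using E_approx[OF z] by blast
  have "cmod (cinner z z) \<le> M * norm z"
  proof (rule LIMSEQ_le)
    show "(\<lambda>n. cmod (cinner (J (u n)) z)) \<longlonglongrightarrow> cmod (cinner z z)"
      by (intro tendsto_norm bounded_bilinear.tendsto[OF bounded_bilinear_cinner] u tendsto_const)
    show "(\<lambda>n. M * norm (J (u n))) \<longlonglongrightarrow> M * norm z"
      by (intro tendsto_intros u)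
    show "\<exists>N. \<forall>n\<ge>N. cmod (cinner (J (u n)) z) \<le> M * norm (J (u n))"
      using M[OF u(1)] by blast
  qed
  then have "norm z * norm z \<le> M * norm z"
    by (simp add: cinner_self power2_eq_square norm_mult)
  then show ?thesis using M0 by (cases "z = 0") auto
qed

lemma E_diff: "x \<in> E \<Longrightarrow> y \<in> E \<Longrightarrow> x - y \<in> E"
  by (rule psd_form.diff_mem[OF psd_form_subspace[OF E_subspace]])

lemma E_eqI:
  assumes "z \<in> E" "z' \<in> E" and eq: "\<And>v. v \<in> V \<Longrightarrow> cinner (J v) z = cinner (J v) z'"
  shows "z = z'"
proof -
  have "norm (z - z') \<le> 0"
    using assms by (intro E_norm_le E_diff) (simp_all add: cin.diff_right)
  then show ?thesis by simp
qed

lemma E_op_eqI: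
  assumes S: "S \<in> bounded_ops E L" and T: "T \<in> bounded_ops E L"
    and eq: "\<And>v. v \<in> V \<Longrightarrow> S (J v) = T (J v)"
  shows "S = T"
proof (rule op_ext[OF S T])
  fix x assume x: "x \<in> E"
  obtain u where u: "\<And>n. u n \<in> V" "(\<lambda>n. J (u n)) \<longlonglongrightarrow> x" using E_approx[OF x] by blast
  have "(\<lambda>n. S (J (u n))) \<longlonglongrightarrow> S x" "(\<lambda>n. T (J (u n))) \<longlonglongrightarrow> T x"
    by (rule bounded_ops_tendsto[OF E_subspace] S T J_mem u x)+
  then show "S x = T x" unfolding eq[OF u(1)] by (rule LIMSEQ_unique)
qed

text \<open>Minimise \<open>Re (s v v) - 2 Re (f v)\<close> over \<open>V\<close>. By the parallelogram law the images under \<open>J\<close> of a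
  minimising sequence are Cauchy, and the first variation at the limit \<open>w\<close> says that \<open>w\<close>
  represents \<open>f\<close>. Completeness is needed in \<open>E\<close> only, so functionals on the dense part suffice.\<close>

theorem riesz_representation:
  assumes add: "\<And>x y. x \<in> V \<Longrightarrow> y \<in> V \<Longrightarrow> f (x + y) = f x + f y"
    and sc: "\<And>c x. x \<in> V \<Longrightarrow> f (c *\<^sub>C x) = c * f x"
    and bound: "\<And>x. x \<in> V \<Longrightarrow> cmod (f x) \<le> C * norm (J x)"
  obtains w where "w \<in> E" "\<And>v. v \<in> V \<Longrightarrow> f v = cinner (J v) w"
proof -
  define F where "F v = Re (s v v) - 2 * Re (f v)" for v
  have low: "- C\<^sup>2 \<le> F v" if v: "v \<in> V" for v
  proof -
    have "Re (f v) \<le> C * norm (J v)" using bound[OF v] complex_Re_le_cmod order_trans by blast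
    moreover have "Re (s v v) = (norm (J v))\<^sup>2" by (simp add: J_norm v nonneg)
    moreover have "0 \<le> (norm (J v) - C)\<^sup>2" by simp
    ultimately show ?thesis unfolding F_def power2_diff by (simp add: mult.commute[of C])
  qed
  define \<mu> where "\<mu> = (INF v\<in>V. F v)"
  have bdd: "bdd_below (F ` V)" by (rule bdd_belowI2[OF low])
  have mu: "\<mu> \<le> F v" if "v \<in> V" for v unfolding \<mu>_def by (rule cINF_lower[OF bdd that])
  have "\<exists>v\<in>V. F v < \<mu> + 1 / real (Suc n)" for n
  proof -
    have "V \<noteq> {}" using zero_mem by blast
    moreover have "\<mu> < \<mu> + 1 / real (Suc n)" by simp
    ultimately show ?thesis unfolding \<mu>_def using cINF_less_iff[OF _ bdd] by blast
  qed
  then obtain v where v: "\<And>n. v n \<in> V" "\<And>n. F (v n) < \<mu> + 1 / real (Suc n)" by metis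
  have par: "(norm (J x - J y))\<^sup>2 \<le> 2 * (F x + F y - 2 * \<mu>)" if x: "x \<in> V" and y: "y \<in> V" for x y
  proof -
    let ?m = "(1/2) *\<^sub>C (x + y)"
    have "Re (s ?m ?m) = (Re (s x x) + Re (s y y) + 2 * Re (s x y)) / 4"
      using x y hermitian[OF x y]
      by (simp add: scale_left scale_right add_left add_right add_mem scale_mem) (simp add: field_simps)
    moreover have "Re (f ?m) = (Re (f x) + Re (f y)) / 2"
      using x y by (simp add: sc add add_mem)
    moreover have "(norm (J x - J y))\<^sup>2 = Re (s x x) + Re (s y y) - 2 * Re (s x y)"
    proof -
      have "(norm (J x - J y))\<^sup>2 = Re (s (x - y) (x - y))"
        using x y by (simp flip: J_diff add: J_norm diff_mem nonneg)
      then show ?thesis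
        using x y hermitian[OF x y] by (simp add: diff_left diff_right diff_mem)
    qed
    ultimately show ?thesis
      using mu[of ?m] x y by (simp add: F_def add_mem scale_mem)
  qed
  have "Cauchy (\<lambda>n. J (v n))"
  proof (rule metric_CauchyI)
    fix e :: real assume e: "e > 0"
    obtain N where N: "1 / real (Suc N) < e\<^sup>2 / 4"
      using e nat_approx_posE[of "e\<^sup>2 / 4"] by auto
    have "dist (J (v m)) (J (v n)) < e" if mn: "N \<le> m" "N \<le> n" for m n
    proof -
      define d where "d = 1 / real (Suc N)"
      have le: "F (v k) < \<mu> + d" if "N \<le> k" for k
      proof -
        have "1 / real (Suc k) \<le> d" unfolding d_def using that by (simp add: frac_le)
        then show ?thesis using v(2)[of k] by linarith
      qed
      have "(norm (J (v m) - J (v n)))\<^sup>2 \<le> 2 * (F (v m) + F (v n) - 2 * \<mu>)"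
        by (rule par[OF v(1) v(1)])
      also have "\<dots> < e\<^sup>2"
        using le[OF mn(1)] le[OF mn(2)] N[folded d_def] by argo
      finally show ?thesis using e unfolding dist_norm by (metis less_imp_le power2_less_imp_less)
    qed
    then show "\<exists>M. \<forall>m\<ge>M. \<forall>n\<ge>M. dist (J (v m)) (J (v n)) < e" by blast
  qed
  then obtain w where w: "w \<in> E" "(\<lambda>n. J (v n)) \<longlonglongrightarrow> w"
    using completeE[OF E_complete, of "\<lambda>n. J (v n)"] J_mem[OF v(1)] by blast
  have re: "Re (f x) = Re (cinner (J x) w)" if x: "x \<in> V" for x
  proof -
    define a where "a = Re (cinner w (J x)) - Re (f x)"
    define b where "b = Re (s x x)"
    have b: "b \<ge> 0" by (simp add: b_def nonneg x)
    have var: "0 \<le> 2 * t * a + t\<^sup>2 * b" for t :: real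
    proof (rule LIMSEQ_le)
      let ?g = "\<lambda>n. 2 * t * (Re (cinner (J (v n)) (J x)) - Re (f x)) + t\<^sup>2 * b"
      show "?g \<longlonglongrightarrow> 2 * t * a + t\<^sup>2 * b"
        unfolding a_def
        by (intro tendsto_intros bounded_bilinear.tendsto[OF bounded_bilinear_cinner] w)
      show "(\<lambda>n. - (1 / real (Suc n))) \<longlonglongrightarrow> 0"
        using tendsto_minus[OF LIMSEQ_inverse_real_of_nat] by (simp add: inverse_eq_divide)
      have "- (1 / real (Suc n)) \<le> ?g n" for n
      proof -
        let ?y = "v n + of_real t *\<^sub>C x"
        have "Re (s ?y ?y) = Re (s (v n) (v n)) + 2 * t * Re (s (v n) x) + t\<^sup>2 * b"
          using v(1)[of n] x hermitian[OF x v(1)[of n]]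
          by (simp add: add_left add_right scale_left scale_right add_mem scale_mem b_def power2_eq_square)
            (simp add: algebra_simps)
        then have "F ?y = F (v n) + 2 * t * (Re (s (v n) x) - Re (f x)) + t\<^sup>2 * b"
          using v(1)[of n] x by (simp add: F_def add sc scale_mem algebra_simps)
        moreover have "\<mu> \<le> F ?y" using v(1)[of n] x by (intro mu add_mem scale_mem)
        ultimately show ?thesis using v(2)[of n] by (simp add: J_inner v(1) x)
      qed
      then show "\<exists>N. \<forall>n\<ge>N. - (1 / real (Suc n)) \<le> ?g n" by blast
    qed
    have "a = 0"
    proof (rule ccontr)
      assume "a \<noteq> 0"
      \<comment> \<open>at \<open>t = - a / (b + 1)\<close> the quadratic is negative; the summand 1 allows for \<open>b = 0\<close>\<close>
      define r where "r = a / (b + 1)"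
      have ar: "a = r * (b + 1)" using b by (simp add: r_def)
      then have "r \<noteq> 0" using \<open>a \<noteq> 0\<close> by auto
      have "2 * (- r) * a + (- r)\<^sup>2 * b = - (r\<^sup>2 * (b + 2))"
        unfolding ar by (simp add: power2_eq_square algebra_simps)
      moreover have "r\<^sup>2 * (b + 2) > 0" using \<open>r \<noteq> 0\<close> b by simp
      ultimately show False using var[of "- r"] by simp
    qed
    then show ?thesis using cinner_commute[of "J x" w] by (simp add: a_def)
  qed
  have "f x = cinner (J x) w" if x: "x \<in> V" for x
    using re[OF x] re[OF scale_mem[OF x, of "\<i>"]] x
    by (simp add: sc J_scale cin.scale_left complex_eq_iff)
  then show ?thesis using that w(1) by blast
qed

lemma adjoint_of_dense:
  fixes A :: "'v \<Rightarrow> 'k::complex_inner"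
  assumes add: "\<And>x y. x \<in> V \<Longrightarrow> y \<in> V \<Longrightarrow> A (x + y) = A x + A y"
    and sc: "\<And>c x. x \<in> V \<Longrightarrow> A (c *\<^sub>C x) = c *\<^sub>C A x"
    and bound: "\<And>x. x \<in> V \<Longrightarrow> norm (A x) \<le> C * norm (J x)" and C: "C \<ge> 0"
    and K: "csubspace K"
  obtains S where "S \<in> bounded_ops K E" "\<And>v e. v \<in> V \<Longrightarrow> e \<in> K \<Longrightarrow> cinner (A v) e = cinner (J v) (S e)"
proof -
  have bd: "cmod (cinner (A x) e) \<le> (C * norm e) * norm (J x)" if "x \<in> V" for x e
  proof -
    have "cmod (cinner (A x) e) \<le> norm (A x) * norm e" by (rule norm_cinner_le)
    also have "\<dots> \<le> (C * norm (J x)) * norm e" by (intro mult_right_mono bound that) simp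
    finally show ?thesis by (simp add: mult_ac)
  qed
  have "\<exists>w\<in>E. \<forall>v\<in>V. cinner (A v) e = cinner (J v) w" for e
    by (rule riesz_representation[of "\<lambda>v. cinner (A v) e" "C * norm e"])
      (auto simp: add sc cin.add_left cin.scale_left bd)
  then obtain S where S: "\<And>e. S e \<in> E" "\<And>e v. v \<in> V \<Longrightarrow> cinner (A v) e = cinner (J v) (S e)"
    by metis
  interpret EE: psd_form E cinner by (rule psd_form_subspace[OF E_subspace])
  have "restrict S K \<in> bounded_ops K E"
  proof (rule bounded_opsI[where C=C])
    show "S x \<in> E" for x by (rule S)
    show "S (x + y) = S x + S y" for x y
      by (rule E_eqI) (simp_all add: S EE.add_mem cin.add_right flip: S(2))
    show "S (c *\<^sub>C x) = c *\<^sub>C S x" for x c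
      by (rule E_eqI) (simp_all add: S EE.scale_mem cin.scale_right flip: S(2))
    show "norm (S x) \<le> C * norm x" for x
      by (rule E_norm_le) (simp_all add: S C bd flip: S(2))
  qed (rule K)
  moreover have "cinner (A v) e = cinner (J v) (restrict S K e)" if "v \<in> V" "e \<in> K" for v e
    using S that by simp
  ultimately show ?thesis using that by blast
qed

text \<open>Riesz in the second argument gives \<open>A\<close> with \<open>B u v = \<langle>J u, A v\<rangle>\<close>, defined on the dense part only;
  its adjoint is defined on all of \<open>E\<close> and is the operator sought. Taking the adjoint replaces an
  extension by continuity.\<close>

theorem form_operator:
  assumes add_l: "\<And>x y z. x \<in> V \<Longrightarrow> y \<in> V \<Longrightarrow> z \<in> V \<Longrightarrow> B (x + y) z = B x z + B y z"
    and scale_l: "\<And>c x y. x \<in> V \<Longrightarrow> y \<in> V \<Longrightarrow> B (c *\<^sub>C x) y = c * B x y"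
    and add_r: "\<And>x y z. x \<in> V \<Longrightarrow> y \<in> V \<Longrightarrow> z \<in> V \<Longrightarrow> B z (x + y) = B z x + B z y"
    and scale_r: "\<And>c x y. x \<in> V \<Longrightarrow> y \<in> V \<Longrightarrow> B y (c *\<^sub>C x) = cnj c * B y x"
    and bound: "\<And>x y. x \<in> V \<Longrightarrow> y \<in> V \<Longrightarrow> cmod (B x y) \<le> C * norm (J x) * norm (J y)"
    and C: "C \<ge> 0"
  obtains S where "S \<in> bounded_ops E E" "\<And>u v. u \<in> V \<Longrightarrow> v \<in> V \<Longrightarrow> cinner (S (J u)) (J v) = B u v"
proof -
  have "\<exists>w\<in>E. \<forall>u\<in>V. B u v = cinner (J u) w" if v: "v \<in> V" for v
    by (rule riesz_representation[of "\<lambda>u. B u v" "C * norm (J v)"])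
      (use v bound[of _ v] in \<open>auto simp: add_l scale_l mult_ac\<close>)
  then obtain A where A: "\<And>v. v \<in> V \<Longrightarrow> A v \<in> E"
    "\<And>u v. u \<in> V \<Longrightarrow> v \<in> V \<Longrightarrow> B u v = cinner (J u) (A v)"
    by metis
  interpret EE: psd_form E cinner by (rule psd_form_subspace[OF E_subspace])
  obtain S where S: "S \<in> bounded_ops E E"
    "\<And>v e. v \<in> V \<Longrightarrow> e \<in> E \<Longrightarrow> cinner (A v) e = cinner (J v) (S e)"
  proof (rule adjoint_of_dense[of A C E])
    show "A (x + y) = A x + A y" if "x \<in> V" "y \<in> V" for x y
      using that by (intro E_eqI) (simp_all add: A EE.add_mem cin.add_right add_mem add_r flip: A(2))
    show "A (c *\<^sub>C x) = c *\<^sub>C A x" if "x \<in> V" for x c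
      using that by (intro E_eqI) (simp_all add: A EE.scale_mem cin.scale_right scale_mem scale_r flip: A(2))
    show "norm (A x) \<le> C * norm (J x)" if "x \<in> V" for x
      using that bound[of _ x] C by (intro E_norm_le) (simp_all add: A mult_ac flip: A(2))
  qed (auto simp: C E_subspace)
  have "cinner (S (J u)) (J v) = B u v" if "u \<in> V" "v \<in> V" for u v
    using S(2)[OF that(2) J_mem[OF that(1)]] A(2)[OF that]
    by (metis cinner_commute)
  then show ?thesis using that S(1) by blast
qed

end

lemma dense_embedding_self:
  assumes "hilbert_space (H :: 'h::complex_inner set)"
  shows "dense_embedding H cinner (\<lambda>x. x) H"
proof -
  interpret psd_form H cinner
    using assms by (intro psd_form_subspace) (simp add: hilbert_space_def)
  show ?thesis
    using assms by unfold_locales (auto simp: hilbert_space_def complete_imp_closed)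
qed

theorem adjoint_op:
  assumes H: "hilbert_space H" and K: "csubspace K" and T: "T \<in> bounded_ops H K"
  shows adjoint_bounded: "adjoint_op H K T \<in> bounded_ops K H"
    and adjoint_inner: "x \<in> H \<Longrightarrow> y \<in> K \<Longrightarrow> cinner (T x) y = cinner x (adjoint_op H K T y)"
proof -
  interpret dense_embedding H cinner "\<lambda>x. x" H by (rule dense_embedding_self[OF H])
  obtain C where C: "C \<ge> 0" "\<And>x. x \<in> H \<Longrightarrow> norm (T x) \<le> C * norm x"
    using bounded_ops_bound[OF T] by blast
  obtain S where S: "S \<in> bounded_ops K H" "\<And>v e. v \<in> H \<Longrightarrow> e \<in> K \<Longrightarrow> cinner (T v) e = cinner v (S e)"
    by (rule adjoint_of_dense[of T C K]) (auto simp: bounded_opsD[OF T] C K)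
  have uniq: "S' = S" if S': "S' \<in> bounded_ops K H"
    "\<And>x y. x \<in> H \<Longrightarrow> y \<in> K \<Longrightarrow> cinner (T x) y = cinner x (S' y)" for S'
  proof (rule op_ext[OF S'(1) S(1)])
    fix y assume y: "y \<in> K"
    show "S' y = S y"
      by (rule E_eqI) (use y S S' bounded_ops_mem[OF S(1)] bounded_ops_mem[OF S'(1)] in auto)
  qed
  have eq: "adjoint_op H K T = S"
    unfolding adjoint_op_def
  proof (rule the_equality)
    show "S \<in> bounded_ops K H \<and> (\<forall>x\<in>H. \<forall>y\<in>K. cinner (T x) y = cinner x (S y))"
      using S by simp
    fix S' assume S': "S' \<in> bounded_ops K H \<and> (\<forall>x\<in>H. \<forall>y\<in>K. cinner (T x) y = cinner x (S' y))"
    show "S' = S"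
      by (rule uniq) (use S' in simp_all)
  qed
  show "adjoint_op H K T \<in> bounded_ops K H" using S eq by simp
  show "x \<in> H \<Longrightarrow> y \<in> K \<Longrightarrow> cinner (T x) y = cinner x (adjoint_op H K T y)" using S eq by simp
qed

text \<open>Boundedness of each \<open>\<alpha> a\<close> is automatic: \<open>(norm a)\<^sup>2 - star a * a\<close> has the form \<open>star k * k\<close>, and
  therefore acts as a nonnegative operator.\<close>

lemma (in dense_embedding) representation_of_action:
  fixes \<alpha> :: "'a::unital_cstar_algebra \<Rightarrow> 'v \<Rightarrow> 'v"
  assumes mem: "\<And>a v. v \<in> V \<Longrightarrow> \<alpha> a v \<in> V"
    and add_r: "\<And>a u v. u \<in> V \<Longrightarrow> v \<in> V \<Longrightarrow> \<alpha> a (u + v) = \<alpha> a u + \<alpha> a v"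
    and scale_r: "\<And>a c v. v \<in> V \<Longrightarrow> \<alpha> a (c *\<^sub>C v) = c *\<^sub>C \<alpha> a v"
    and add_l: "\<And>a b v. v \<in> V \<Longrightarrow> \<alpha> (a + b) v = \<alpha> a v + \<alpha> b v"
    and scale_l: "\<And>a c v. v \<in> V \<Longrightarrow> \<alpha> (c *\<^sub>C a) v = c *\<^sub>C \<alpha> a v"
    and mult: "\<And>a b v. v \<in> V \<Longrightarrow> \<alpha> (a * b) v = \<alpha> a (\<alpha> b v)"
    and one: "\<And>v. v \<in> V \<Longrightarrow> \<alpha> 1 v = v"
    and star: "\<And>a u v. u \<in> V \<Longrightarrow> v \<in> V \<Longrightarrow> s (\<alpha> a u) v = s u (\<alpha> (star a) v)"
  obtains \<sigma> where "representation E \<sigma>" "\<And>a v. v \<in> V \<Longrightarrow> \<sigma> a (J v) = J (\<alpha> a v)"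
proof -
  have bound: "norm (J (\<alpha> a u)) \<le> norm a * norm (J u)" if u: "u \<in> V" for a u
  proof -
    obtain k where k: "of_real ((norm a)\<^sup>2) - star a * a = star k * k"
      using norm_square_minus_star_mult by blast
    have sq: "s (\<alpha> (star c * c) u) u = s (\<alpha> c u) (\<alpha> c u)" for c
      using u by (simp add: mult mem star star_star)
    have "of_real ((norm a)\<^sup>2) = of_real ((norm a)\<^sup>2) *\<^sub>C (1 :: 'a)"
      by (simp only: of_real_def scaleR_scaleC)
    moreover have "star a * a + star k * k = of_real ((norm a)\<^sup>2)"
      by (simp only: k[symmetric]) simp
    ultimately have "\<alpha> (star a * a) u + \<alpha> (star k * k) u = of_real ((norm a)\<^sup>2) *\<^sub>C u"
      using u by (simp only: add_l[symmetric]) (simp only: scale_l one)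
    then have "s (\<alpha> (star a * a) u) u + s (\<alpha> (star k * k) u) u = of_real ((norm a)\<^sup>2) * s u u"
      using u by (simp only: add_left[symmetric] mem scale_left)
    then have "Re (s (\<alpha> a u) (\<alpha> a u)) + Re (s (\<alpha> k u) (\<alpha> k u)) = (norm a)\<^sup>2 * Re (s u u)"
      unfolding sq by (metis Re_complex_of_real of_real_mult plus_complex.simps(1) form_self u)
    then have "Re (s (\<alpha> a u) (\<alpha> a u)) \<le> (norm a)\<^sup>2 * Re (s u u)"
      using nonneg[OF mem[OF u, of k]] by linarith
    then have "sqrt (Re (s (\<alpha> a u) (\<alpha> a u))) \<le> sqrt ((norm a)\<^sup>2 * Re (s u u))"
      by (rule real_sqrt_le_mono)
    then show ?thesis using u by (simp add: J_norm mem real_sqrt_mult)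
  qed
  have "\<exists>S\<in>bounded_ops E E. \<forall>u\<in>V. \<forall>v\<in>V. cinner (S (J u)) (J v) = s (\<alpha> a u) v" for a
  proof -
    have "cmod (s (\<alpha> a x) y) \<le> norm a * norm (J x) * norm (J y)" if "x \<in> V" "y \<in> V" for x y
    proof -
      have "cmod (s (\<alpha> a x) y) \<le> norm (J (\<alpha> a x)) * norm (J y)"
        using that norm_cinner_le[of "J (\<alpha> a x)" "J y"] by (simp add: J_inner mem)
      also have "\<dots> \<le> norm a * norm (J x) * norm (J y)"
        by (intro mult_right_mono bound that) simp
      finally show ?thesis .
    qed
    then obtain S where "S \<in> bounded_ops E E"
      "\<And>u v. u \<in> V \<Longrightarrow> v \<in> V \<Longrightarrow> cinner (S (J u)) (J v) = s (\<alpha> a u) v"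
      using form_operator[of "\<lambda>u v. s (\<alpha> a u) v" "norm a" thesis]
      by (simp add: add_r scale_r mem add_left add_right scale_left scale_right)
    then show ?thesis by blast
  qed
  then obtain \<sigma> where \<sigma>: "\<And>a. \<sigma> a \<in> bounded_ops E E"
    "\<And>a u v. u \<in> V \<Longrightarrow> v \<in> V \<Longrightarrow> cinner (\<sigma> a (J u)) (J v) = s (\<alpha> a u) v"
    by metis
  have \<sigma>J: "\<sigma> a (J v) = J (\<alpha> a v)" if v: "v \<in> V" for a v
  proof (rule E_eqI)
    show "\<sigma> a (J v) \<in> E" by (rule bounded_ops_mem[OF \<sigma>(1) J_mem[OF v]])
    show "J (\<alpha> a v) \<in> E" by (intro J_mem mem v)
    show "cinner (J u) (\<sigma> a (J v)) = cinner (J u) (J (\<alpha> a v))" if u: "u \<in> V" for u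
      using \<sigma>(2)[OF v u, of a] J_inner[OF mem[OF v] u, of a] by (metis cinner_commute)
  qed
  have "representation E \<sigma>"
    unfolding representation_def
  proof (intro conjI allI)
    show "\<sigma> a \<in> bounded_ops E E" for a by (rule \<sigma>)
    show "\<sigma> (a + b) = op_add E (\<sigma> a) (\<sigma> b)" for a b
      by (rule E_op_eqI[OF \<sigma>(1) op_add_bounded[OF E_subspace E_subspace \<sigma>(1) \<sigma>(1)]])
        (simp add: \<sigma>J op_add_def J_mem add_l J_add mem)
    show "\<sigma> (c *\<^sub>C a) = op_scale E c (\<sigma> a)" for c a
      by (rule E_op_eqI[OF \<sigma>(1) op_scale_bounded[OF E_subspace E_subspace \<sigma>(1)]])
        (simp add: \<sigma>J op_scale_def J_mem scale_l J_scale mem)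
    show "\<sigma> (a * b) = compose E (\<sigma> a) (\<sigma> b)" for a b
      by (rule E_op_eqI[OF \<sigma>(1) compose_bounded[OF E_subspace \<sigma>(1) \<sigma>(1)]])
        (simp add: \<sigma>J compose_def J_mem mult mem)
    show "\<sigma> 1 = op_id E"
      by (rule E_op_eqI[OF \<sigma>(1) op_id_bounded[OF E_subspace]]) (simp add: \<sigma>J op_id_def J_mem one)
    have adj: "adjoint_op E E (\<sigma> a) \<in> bounded_ops E E" for a
      by (rule adjoint_bounded[OF E_hilbert E_subspace \<sigma>(1)])
    show "\<sigma> (star a) = adjoint_op E E (\<sigma> a)" for a
    proof (rule E_op_eqI[OF \<sigma>(1) adj])
      fix v assume v: "v \<in> V"
      show "\<sigma> (star a) (J v) = adjoint_op E E (\<sigma> a) (J v)"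
      proof (rule E_eqI)
        show "\<sigma> (star a) (J v) \<in> E" "adjoint_op E E (\<sigma> a) (J v) \<in> E"
          by (rule bounded_ops_mem[OF _ J_mem[OF v]], rule \<sigma> adj)+
        show "cinner (J u) (\<sigma> (star a) (J v)) = cinner (J u) (adjoint_op E E (\<sigma> a) (J v))"
          if u: "u \<in> V" for u
          using adjoint_inner[OF E_hilbert E_subspace \<sigma>(1) J_mem[OF u] J_mem[OF v], of a]
          by (simp add: \<sigma>J u v J_inner mem star)
      qed
    qed
  qed
  then show ?thesis using that \<sigma>J by blast
qed


section \<open>A completely positive map from a compression\<close>

lemma nonneg_Reals_limit:
  assumes "f \<longlonglongrightarrow> z" "\<And>n. f n \<in> \<real>\<^sub>\<ge>\<^sub>0"
  shows "(z :: complex) \<in> \<real>\<^sub>\<ge>\<^sub>0"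
  using closed_sequentially[OF closed_nonneg_Reals_complex] assms by blast

context dense_embedding
begin

lemma E_form_eqI:
  assumes S: "S \<in> bounded_ops E E" and T: "T \<in> bounded_ops E E"
    and eq: "\<And>u v. u \<in> V \<Longrightarrow> v \<in> V \<Longrightarrow> cinner (S (J u)) (J v) = cinner (T (J u)) (J v)"
  shows "S = T"
proof (rule E_op_eqI[OF S T])
  fix u assume u: "u \<in> V"
  show "S (J u) = T (J u)"
  proof (rule E_eqI)
    show "S (J u) \<in> E" "T (J u) \<in> E"
      using bounded_ops_mem[OF S J_mem[OF u]] bounded_ops_mem[OF T J_mem[OF u]] by auto
    show "cinner (J v) (S (J u)) = cinner (J v) (T (J u))" if "v \<in> V" for v
      using eq[OF u that] cinner_commute[of "J v" "S (J u)"] cinner_commute[of "J v" "T (J u)"] by simp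
  qed
qed

lemma positive_matrix_dense:
  assumes T: "\<And>i j. i < n \<Longrightarrow> j < n \<Longrightarrow> T i j \<in> bounded_ops E E"
    and pos: "\<And>u. (\<And>i. i < n \<Longrightarrow> u i \<in> V) \<Longrightarrow>
      (\<Sum>i<n. \<Sum>j<n. cinner (T i j (J (u j))) (J (u i))) \<in> \<real>\<^sub>\<ge>\<^sub>0"
  shows "positive_matrix E n T"
  unfolding positive_matrix_def
proof (intro allI impI)
  fix x assume x: "\<forall>i<n. x i \<in> E"
  have "\<exists>u. (\<forall>k. u k \<in> V) \<and> (\<lambda>k. J (u k)) \<longlonglongrightarrow> x i" if "i < n" for i
    using E_approx[of "x i"] x that by blast
  then obtain u where u: "\<And>i k. i < n \<Longrightarrow> u i k \<in> V"
    "\<And>i. i < n \<Longrightarrow> (\<lambda>k. J (u i k)) \<longlonglongrightarrow> x i"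
    by metis
  show "(\<Sum>i<n. \<Sum>j<n. cinner (T i j (x j)) (x i)) \<in> \<real>\<^sub>\<ge>\<^sub>0"
  proof (rule nonneg_Reals_limit)
    show "(\<Sum>i<n. \<Sum>j<n. cinner (T i j (J (u j k))) (J (u i k))) \<in> \<real>\<^sub>\<ge>\<^sub>0" for k
      by (rule pos) (rule u)
    show "(\<lambda>k. \<Sum>i<n. \<Sum>j<n. cinner (T i j (J (u j k))) (J (u i k)))
        \<longlonglongrightarrow> (\<Sum>i<n. \<Sum>j<n. cinner (T i j (x j)) (x i))"
    proof (intro tendsto_sum bounded_bilinear.tendsto[OF bounded_bilinear_cinner])
      fix i j assume ij: "i \<in> {..<n}" "j \<in> {..<n}"
      show "(\<lambda>k. J (u i k)) \<longlonglongrightarrow> x i" using u(2) ij by simp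
      show "(\<lambda>k. T i j (J (u j k))) \<longlonglongrightarrow> T i j (x j)"
        using u ij x by (intro bounded_ops_tendsto[OF E_subspace T] J_mem) auto
    qed
  qed
qed

lemma sum_nonneg_Reals: "(\<And>i. i \<in> I \<Longrightarrow> f i \<in> \<real>\<^sub>\<ge>\<^sub>0) \<Longrightarrow> (\<Sum>i\<in>I. f i) \<in> (\<real>\<^sub>\<ge>\<^sub>0 :: complex set)"
  by (induction I rule: infinite_finite_induct) auto

text \<open>The entrywise product of two positive matrices is positive. Realising \<open>q\<close> in the sequence space
  writes \<open>q (u j) (u i)\<close> as a sum of rank one matrices \<open>a j * cnj (a i)\<close>, and for each of them the sum is the
  value of the positive matrix \<open>T\<close> at the vectors \<open>a i w\<close>.\<close>

lemma schur_positive: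
  assumes q: "psd_form V q" and D: "countable D" "D \<subseteq> V"
    and dense: "\<And>u e. u \<in> V \<Longrightarrow> e > 0 \<Longrightarrow> \<exists>d\<in>D. Re (q (u - d) (u - d)) < e"
    and T: "\<And>i j. i < n \<Longrightarrow> j < n \<Longrightarrow> T i j \<in> bounded_ops E E"
    and pos: "positive_matrix E n T" and w: "w \<in> E" and u: "\<And>i. i < n \<Longrightarrow> u i \<in> V"
  shows "(\<Sum>i<n. \<Sum>j<n. cinner (T i j w) w * q (u j) (u i)) \<in> \<real>\<^sub>\<ge>\<^sub>0"
proof -
  interpret q: psd_form V q by (rule q)
  interpret EE: psd_form E cinner by (rule psd_form_subspace[OF E_subspace])
  have "\<exists>L :: 'v \<Rightarrow> ell2. \<forall>x\<in>V. \<forall>y\<in>V. cinner (L x) (L y) = q x y"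
  proof (rule q.ell2_embedding[OF D])
    show "\<exists>d\<in>D. Re (q (u - d) (u - d)) < e" if "u \<in> V" "e > 0" for u e
      by (rule dense[OF that])
  qed blast
  then obtain L :: "'v \<Rightarrow> ell2" where L: "\<And>x y. x \<in> V \<Longrightarrow> y \<in> V \<Longrightarrow> cinner (L x) (L y) = q x y"
    by blast
  define a where "a i k = ell2_nth (L (u i)) k" for i k
  have coord: "(\<Sum>i<n. \<Sum>j<n. cinner (T i j w) w * (a j k * cnj (a i k))) \<in> \<real>\<^sub>\<ge>\<^sub>0" for k
  proof -
    have "(\<Sum>i<n. \<Sum>j<n. cinner (T i j (a j k *\<^sub>C w)) (a i k *\<^sub>C w)) \<in> \<real>\<^sub>\<ge>\<^sub>0"
      using pos[unfolded positive_matrix_def, rule_format, of "\<lambda>i. a i k *\<^sub>C w"]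
      by (simp add: EE.scale_mem w)
    also have "(\<Sum>i<n. \<Sum>j<n. cinner (T i j (a j k *\<^sub>C w)) (a i k *\<^sub>C w)) =
        (\<Sum>i<n. \<Sum>j<n. cinner (T i j w) w * (a j k * cnj (a i k)))"
      by (intro sum.cong refl)
        (simp add: bounded_ops_scale[OF T] w cin.scale_left cin.scale_right mult_ac)
    finally show ?thesis .
  qed
  have "(\<lambda>k. \<Sum>i<n. \<Sum>j<n. cinner (T i j w) w * (a j k * cnj (a i k))) sums
      (\<Sum>i<n. \<Sum>j<n. cinner (T i j w) w * q (u j) (u i))"
  proof (intro sums_sum sums_mult)
    fix i j assume "i \<in> {..<n}" "j \<in> {..<n}"
    then have "q (u j) (u i) = (\<Sum>k. a j k * cnj (a i k))"
      using L[of "u j" "u i"] u by (simp add: a_def cinner_ell2_def)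
    moreover have "summable (\<lambda>k. a j k * cnj (a i k))"
      unfolding a_def by (intro ell2_summable_mult ell2_nth_summable)
    ultimately show "(\<lambda>k. a j k * cnj (a i k)) sums q (u j) (u i)" by (simp add: sums_iff)
  qed
  then show ?thesis unfolding sums_def
    by (rule nonneg_Reals_limit) (intro sum_nonneg_Reals coord)
qed

text \<open>In operator terms \<open>\<Psi> T = P\<^sup>*TP + P'\<^sup>*TP' + \<langle>Tw, w\<rangle>q\<close>. The identity \<open>split\<close> makes it unital and
  supplies all norm bounds.\<close>

theorem compression_ucp:
  assumes P: "\<And>u. u \<in> V \<Longrightarrow> P u \<in> V" "\<And>u v. u \<in> V \<Longrightarrow> v \<in> V \<Longrightarrow> P (u + v) = P u + P v"
      "\<And>c u. u \<in> V \<Longrightarrow> P (c *\<^sub>C u) = c *\<^sub>C P u"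
    and P': "\<And>u. u \<in> V \<Longrightarrow> P' u \<in> V" "\<And>u v. u \<in> V \<Longrightarrow> v \<in> V \<Longrightarrow> P' (u + v) = P' u + P' v"
      "\<And>c u. u \<in> V \<Longrightarrow> P' (c *\<^sub>C u) = c *\<^sub>C P' u"
    and q: "psd_form V q" and w: "w \<in> E" "norm w = 1"
    and D: "countable D" "D \<subseteq> V"
    and dense: "\<And>u e. u \<in> V \<Longrightarrow> e > 0 \<Longrightarrow> \<exists>d\<in>D. Re (s (u - d) (u - d)) < e"
    and split: "\<And>u v. u \<in> V \<Longrightarrow> v \<in> V \<Longrightarrow> s (P u) (P v) + s (P' u) (P' v) + q u v = s u v"
  obtains \<Psi> where "ucp E \<Psi>"
    "\<And>T u v. T \<in> bounded_ops E E \<Longrightarrow> u \<in> V \<Longrightarrow> v \<in> V \<Longrightarrow> cinner (\<Psi> T (J u)) (J v) =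
      cinner (T (J (P u))) (J (P v)) + cinner (T (J (P' u))) (J (P' v)) + cinner (T w) w * q u v"
proof -
  interpret q: psd_form V q by (rule q)
  interpret EE: psd_form E cinner by (rule psd_form_subspace[OF E_subspace])
  define B where "B T u v = cinner (T (J (P u))) (J (P v)) + cinner (T (J (P' u))) (J (P' v))
    + cinner (T w) w * q u v" for T u v
  have sP: "Re (s (P u) (P u)) \<le> Re (s u u)" and sP': "Re (s (P' u) (P' u)) \<le> Re (s u u)"
    and sq: "Re (q u u) \<le> Re (s u u)" if u: "u \<in> V" for u
  proof -
    have "Re (s u u) = Re (s (P u) (P u)) + Re (s (P' u) (P' u)) + Re (q u u)"
      by (simp flip: split[OF u u])
    then show "Re (s (P u) (P u)) \<le> Re (s u u)" "Re (s (P' u) (P' u)) \<le> Re (s u u)"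
      "Re (q u u) \<le> Re (s u u)"
      using nonneg[OF P(1)[OF u]] nonneg[OF P'(1)[OF u]] q.nonneg[OF u] by linarith+
  qed
  have nP: "norm (J (P u)) \<le> norm (J u)" and nP': "norm (J (P' u)) \<le> norm (J u)"
    and nq: "sqrt (Re (q u u)) \<le> norm (J u)" if "u \<in> V" for u
    using sP[OF that] sP'[OF that] sq[OF that] that by (simp_all add: J_norm P P')
  have ex: "\<exists>S\<in>bounded_ops E E. \<forall>u\<in>V. \<forall>v\<in>V. cinner (S (J u)) (J v) = B T u v"
    if T: "T \<in> bounded_ops E E" for T
  proof -
    obtain C where C: "C \<ge> 0" "\<And>x. x \<in> E \<Longrightarrow> norm (T x) \<le> C * norm x"
      using bounded_ops_bound[OF T] by blast
    have inn: "cmod (cinner (T x) y) \<le> C * (a * b)"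
      if "x \<in> E" "norm x \<le> a" "norm y \<le> b" for x y a b
    proof -
      have "cmod (cinner (T x) y) \<le> norm (T x) * norm y" by (rule norm_cinner_le)
      also have "\<dots> \<le> (C * norm x) * norm y" by (intro mult_right_mono C that) simp
      also have "\<dots> = C * (norm x * norm y)" by simp
      also have "\<dots> \<le> C * (a * b)"
        using order_trans[OF norm_ge_zero that(2)] that C(1) by (intro mult_left_mono mult_mono) auto
      finally show ?thesis .
    qed
    have bound: "cmod (B T u v) \<le> (3 * C) * norm (J u) * norm (J v)" if u: "u \<in> V" and v: "v \<in> V" for u v
    proof -
      have 1: "cmod (cinner (T (J (P u))) (J (P v))) \<le> C * (norm (J u) * norm (J v))"
        by (intro inn J_mem P u nP v)
      have 2: "cmod (cinner (T (J (P' u))) (J (P' v))) \<le> C * (norm (J u) * norm (J v))"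
        by (intro inn J_mem P' u nP' v)
      have "cmod (cinner (T w) w) \<le> C * (1 * 1)" by (intro inn) (simp_all add: w)
      moreover have "cmod (q u v) \<le> norm (J u) * norm (J v)"
        using q.cauchy_schwarz_sqrt[OF u v] mult_mono[OF nq[OF u] nq[OF v]] q.nonneg[OF v] by force
      ultimately have 3: "cmod (cinner (T w) w * q u v) \<le> C * (norm (J u) * norm (J v))"
        unfolding norm_mult using C(1) by (intro mult_mono) auto
      show ?thesis unfolding B_def
        by (rule order_trans[OF norm_triangle_ineq order_trans[OF add_mono[OF norm_triangle_ineq order_refl]]])
          (use 1 2 3 in simp)
    qed
    obtain S where "S \<in> bounded_ops E E" "\<And>u v. u \<in> V \<Longrightarrow> v \<in> V \<Longrightarrow> cinner (S (J u)) (J v) = B T u v"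
    proof (rule form_operator[of "B T" "3 * C"])
      show "B T (x + y) z = B T x z + B T y z" if "x \<in> V" "y \<in> V" "z \<in> V" for x y z
        using that
        by (simp add: B_def P P' J_add J_mem bounded_ops_add[OF T] cin.add_left q.add_left algebra_simps)
      show "B T z (x + y) = B T z x + B T z y" if "x \<in> V" "y \<in> V" "z \<in> V" for x y z
        using that
        by (simp add: B_def P P' J_add cin.add_right q.add_right algebra_simps)
      show "B T (c *\<^sub>C x) y = c * B T x y" if "x \<in> V" "y \<in> V" for c x y
        using that
        by (simp add: B_def P P' J_scale J_mem bounded_ops_scale[OF T] cin.scale_left q.scale_left algebra_simps)
      show "B T y (c *\<^sub>C x) = cnj c * B T y x" if "x \<in> V" "y \<in> V" for c x y
        using that by (simp add: B_def P P' J_scale cin.scale_right q.scale_right algebra_simps)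
    qed (use bound C in auto)
    then show ?thesis by blast
  qed
  define \<Psi> where "\<Psi> T = (SOME S. S \<in> bounded_ops E E \<and> (\<forall>u\<in>V. \<forall>v\<in>V. cinner (S (J u)) (J v) = B T u v))"
    for T
  have \<Psi>: "\<Psi> T \<in> bounded_ops E E" "\<And>u v. u \<in> V \<Longrightarrow> v \<in> V \<Longrightarrow> cinner (\<Psi> T (J u)) (J v) = B T u v"
    if "T \<in> bounded_ops E E" for T
    using someI_ex[OF ex[OF that, unfolded Bex_def]] unfolding \<Psi>_def by blast+
  have "ucp E \<Psi>"
    unfolding ucp_def
  proof (intro conjI ballI allI impI)
    show "\<Psi> T \<in> bounded_ops E E" if "T \<in> bounded_ops E E" for T by (rule \<Psi>(1)[OF that])
    show "\<Psi> (op_add E S T) = op_add E (\<Psi> S) (\<Psi> T)"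
      if S: "S \<in> bounded_ops E E" and T: "T \<in> bounded_ops E E" for S T
    proof -
      have ST: "op_add E S T \<in> bounded_ops E E"
        by (rule op_add_bounded[OF E_subspace E_subspace S T])
      show ?thesis
      proof (rule E_form_eqI[OF \<Psi>(1)[OF ST]])
        show "op_add E (\<Psi> S) (\<Psi> T) \<in> bounded_ops E E"
          by (intro op_add_bounded E_subspace \<Psi> S T)
        show "cinner (\<Psi> (op_add E S T) (J u)) (J v) = cinner (op_add E (\<Psi> S) (\<Psi> T) (J u)) (J v)"
          if "u \<in> V" "v \<in> V" for u v
          using that \<Psi>(2)[OF S that] \<Psi>(2)[OF T that] w unfolding \<Psi>(2)[OF ST that]
          by (simp add: op_add_def J_mem P P' cin.add_left B_def algebra_simps)
      qed
    qed
    show "\<Psi> (op_scale E c T) = op_scale E c (\<Psi> T)" if T: "T \<in> bounded_ops E E" for c T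
    proof -
      have cT: "op_scale E c T \<in> bounded_ops E E"
        by (rule op_scale_bounded[OF E_subspace E_subspace T])
      show ?thesis
      proof (rule E_form_eqI[OF \<Psi>(1)[OF cT]])
        show "op_scale E c (\<Psi> T) \<in> bounded_ops E E"
          by (intro op_scale_bounded E_subspace \<Psi> T)
        show "cinner (\<Psi> (op_scale E c T) (J u)) (J v) = cinner (op_scale E c (\<Psi> T) (J u)) (J v)"
          if "u \<in> V" "v \<in> V" for u v
          using that \<Psi>(2)[OF T that] w unfolding \<Psi>(2)[OF cT that]
          by (simp add: op_scale_def J_mem P P' cin.scale_left B_def algebra_simps)
      qed
    qed
    have id: "op_id E \<in> bounded_ops E E" by (rule op_id_bounded[OF E_subspace])
    show "\<Psi> (op_id E) = op_id E"
    proof (rule E_form_eqI[OF \<Psi>(1)[OF id] id])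
      show "cinner (\<Psi> (op_id E) (J u)) (J v) = cinner (op_id E (J u)) (J v)" if "u \<in> V" "v \<in> V" for u v
        using that w unfolding \<Psi>(2)[OF id that]
        by (simp add: B_def op_id_def J_mem P P' J_inner cinner_self[of w] split)
    qed
    fix n T assume T: "\<forall>i<n. \<forall>j<n. T i j \<in> bounded_ops E E" and pos: "positive_matrix E n T"
    have T': "T i j \<in> bounded_ops E E" if "i < n" "j < n" for i j using T that by blast
    show "positive_matrix E n (\<lambda>i j. \<Psi> (T i j))"
    proof (rule positive_matrix_dense)
      show "\<Psi> (T i j) \<in> bounded_ops E E" if "i < n" "j < n" for i j using T that by (intro \<Psi>) blast
      fix u assume u: "\<And>i. i < n \<Longrightarrow> u i \<in> V"
      have "(\<Sum>i<n. \<Sum>j<n. cinner (\<Psi> (T i j) (J (u j))) (J (u i))) =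
          (\<Sum>i<n. \<Sum>j<n. cinner (T i j (J (P (u j)))) (J (P (u i)))) +
          (\<Sum>i<n. \<Sum>j<n. cinner (T i j (J (P' (u j)))) (J (P' (u i)))) +
          (\<Sum>i<n. \<Sum>j<n. cinner (T i j w) w * q (u j) (u i))"
        unfolding sum.distrib[symmetric]
        by (intro sum.cong refl) (simp add: \<Psi>(2)[OF T'] u B_def)
      moreover have "(\<Sum>i<n. \<Sum>j<n. cinner (T i j (J (P (u j)))) (J (P (u i)))) \<in> \<real>\<^sub>\<ge>\<^sub>0"
        using pos[unfolded positive_matrix_def, rule_format, of "\<lambda>i. J (P (u i))"] by (simp add: J_mem P u)
      moreover have "(\<Sum>i<n. \<Sum>j<n. cinner (T i j (J (P' (u j)))) (J (P' (u i)))) \<in> \<real>\<^sub>\<ge>\<^sub>0"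
        using pos[unfolded positive_matrix_def, rule_format, of "\<lambda>i. J (P' (u i))"] by (simp add: J_mem P' u)
      moreover have "(\<Sum>i<n. \<Sum>j<n. cinner (T i j w) w * q (u j) (u i)) \<in> \<real>\<^sub>\<ge>\<^sub>0"
      proof (rule schur_positive[OF q D _ T' pos w(1) u])
        fix x and e :: real assume x: "x \<in> V" and "e > 0"
        then obtain d where d: "d \<in> D" "Re (s (x - d) (x - d)) < e" using dense by blast
        then have "Re (q (x - d) (x - d)) < e" using sq[of "x - d"] x D(2) by (force simp: diff_mem)
        then show "\<exists>d\<in>D. Re (q (x - d) (x - d)) < e" using d by blast
      qed
      ultimately show "(\<Sum>i<n. \<Sum>j<n. cinner (\<Psi> (T i j) (J (u j))) (J (u i))) \<in> \<real>\<^sub>\<ge>\<^sub>0"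
        by (simp add: nonneg_Reals_add_I)
    qed
  qed
  then show ?thesis using that \<Psi>(2) unfolding B_def by blast
qed

end


section \<open>Separable Hilbert spaces\<close>

lemma separable_dense:
  assumes "separable_hilbert_space H"
  obtains D where "countable D" "D \<subseteq> H" "H \<subseteq> closure D"
proof -
  obtain D where D: "countable D" "D \<subseteq> topspace (top_of_set H)"
    "top_of_set H closure_of D = topspace (top_of_set H)"
    using assms unfolding separable_hilbert_space_def separable_space_def by blast
  have "H \<subseteq> closure D"
    using D(3) closure_of_subtopology_subset[of euclidean H D] by auto
  with D show ?thesis using that by simp
qed

lemma separable_hilbert_spaceI:
  assumes "hilbert_space E" "countable D" "D \<subseteq> E" "E \<subseteq> closure D"
  shows "separable_hilbert_space E"
proof -
  have "top_of_set E closure_of D = E"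
    using assms(3,4) by (simp add: closure_of_subtopology Int_absorb1 Int_absorb2)
  then show ?thesis
    using assms unfolding separable_hilbert_space_def separable_space_def by auto
qed


section \<open>Products of complex vector spaces\<close>

instantiation prod :: (complex_vector, complex_vector) complex_vector
begin

definition scaleC_prod :: "complex \<Rightarrow> 'a \<times> 'b \<Rightarrow> 'a \<times> 'b" where
  "scaleC_prod c p = (c *\<^sub>C fst p, c *\<^sub>C snd p)"

instance
  by standard
    (simp_all add: scaleC_prod_def scaleC_add_left scaleC_add_right scaleC_scaleC scaleR_prod_def
      scaleR_scaleC)

end

lemma scaleC_Pair [simp]: "c *\<^sub>C (x, y) = (c *\<^sub>C x, c *\<^sub>C y)"
  by (simp add: scaleC_prod_def)


section \<open>Representations\<close>

lemma representationD:
  assumes "representation H \<pi>" and H: "hilbert_space H"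
  shows rep_bounded: "\<pi> a \<in> bounded_ops H H"
    and rep_mem: "x \<in> H \<Longrightarrow> \<pi> a x \<in> H"
    and rep_add: "x \<in> H \<Longrightarrow> \<pi> (a + b) x = \<pi> a x + \<pi> b x"
    and rep_scale: "x \<in> H \<Longrightarrow> \<pi> (c *\<^sub>C a) x = c *\<^sub>C \<pi> a x"
    and rep_mult: "x \<in> H \<Longrightarrow> \<pi> (a * b) x = \<pi> a (\<pi> b x)"
    and rep_one: "x \<in> H \<Longrightarrow> \<pi> 1 x = x"
    and rep_star: "x \<in> H \<Longrightarrow> y \<in> H \<Longrightarrow> cinner (\<pi> a x) y = cinner x (\<pi> (star a) y)"
proof -
  have rep: "\<pi> a \<in> bounded_ops H H" "\<pi> (a + b) = op_add H (\<pi> a) (\<pi> b)"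
    "\<pi> (c *\<^sub>C a) = op_scale H c (\<pi> a)" "\<pi> (a * b) = compose H (\<pi> a) (\<pi> b)"
    "\<pi> (star a) = adjoint_op H H (\<pi> a)" "\<pi> 1 = op_id H" for a b c
    using assms(1) unfolding representation_def by blast+
  show "\<pi> a \<in> bounded_ops H H" by (rule rep)
  then show "x \<in> H \<Longrightarrow> \<pi> a x \<in> H" by (rule bounded_ops_mem)
  show "x \<in> H \<Longrightarrow> \<pi> (a + b) x = \<pi> a x + \<pi> b x" by (simp add: rep op_add_def)
  show "x \<in> H \<Longrightarrow> \<pi> (c *\<^sub>C a) x = c *\<^sub>C \<pi> a x" by (simp add: rep op_scale_def)
  show "x \<in> H \<Longrightarrow> \<pi> (a * b) x = \<pi> a (\<pi> b x)" by (simp add: rep compose_def)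
  show "x \<in> H \<Longrightarrow> \<pi> 1 x = x" by (simp add: rep op_id_def)
  have "csubspace H" using H by (simp add: hilbert_space_def)
  then show "x \<in> H \<Longrightarrow> y \<in> H \<Longrightarrow> cinner (\<pi> a x) y = cinner x (\<pi> (star a) y)"
    unfolding rep(5) by (intro adjoint_inner H rep)
qed


section \<open>Compressions of representations\<close>

locale compression =
  fixes H :: "'h::complex_inner set" and K :: "'k::complex_inner set"
    and \<pi> :: "'a::unital_cstar_algebra \<Rightarrow> 'h \<Rightarrow> 'h" and \<rho> :: "'a \<Rightarrow> 'k \<Rightarrow> 'k" and R :: "'h \<Rightarrow> 'k"
  assumes H: "hilbert_space H" and K: "hilbert_space K"
    and \<pi>: "representation H \<pi>" and \<rho>: "representation K \<rho>"
    and R: "contraction H K R"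
begin

lemma subspaces: "csubspace H" "csubspace K"
  using H K by (simp_all add: hilbert_space_def)

sublocale HH: psd_form H cinner by (rule psd_form_subspace[OF subspaces(1)])
sublocale KK: psd_form K cinner by (rule psd_form_subspace[OF subspaces(2)])

lemma R_bounded: "R \<in> bounded_ops H K"
  using R by (simp add: contraction_def)

lemmas R_simps = bounded_ops_mem[OF R_bounded] bounded_ops_add[OF R_bounded] bounded_ops_scale[OF R_bounded]

lemmas \<pi>_simps = rep_mem[OF \<pi> H] bounded_ops_add[OF rep_bounded[OF \<pi> H]]
  bounded_ops_scale[OF rep_bounded[OF \<pi> H]] rep_add[OF \<pi> H] rep_scale[OF \<pi> H] rep_mult[OF \<pi> H] rep_one[OF \<pi> H]

lemmas \<rho>_simps = rep_mem[OF \<rho> K] bounded_ops_add[OF rep_bounded[OF \<rho> K]]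
  bounded_ops_scale[OF rep_bounded[OF \<rho> K]] rep_add[OF \<rho> K] rep_scale[OF \<rho> K] rep_mult[OF \<rho> K] rep_one[OF \<rho> K]

lemma R_norm_le: "x \<in> H \<Longrightarrow> norm (R x) \<le> norm x"
proof -
  assume x: "x \<in> H"
  have "norm (R x) \<le> op_norm H R * norm x" by (rule op_norm_bound[OF subspaces(1) R_bounded x])
  also have "\<dots> \<le> 1 * norm x" using R by (intro mult_right_mono) (auto simp: contraction_def)
  finally show ?thesis by simp
qed

text \<open>The form of the operator \<open>I - R\<^sup>*R\<close>; it is nonnegative because \<open>R\<close> is a contraction, and nonzero
  exactly when \<open>R\<close> is not isometric.\<close>

definition defect :: "'h \<Rightarrow> 'h \<Rightarrow> complex" where
  "defect x y = cinner x y - cinner (R x) (R y)"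

sublocale Q: psd_form H defect
proof
  show "csubspace H" by (rule subspaces)
  show "defect (x + y) z = defect x z + defect y z" if "x \<in> H" "y \<in> H" "z \<in> H" for x y z
    using that by (simp add: defect_def R_simps cin.add_left)
  show "defect (c *\<^sub>C x) y = c * defect x y" if "x \<in> H" "y \<in> H" for c x y
    using that by (simp add: defect_def R_simps cin.scale_left algebra_simps)
  show "defect x y = cnj (defect y x)" for x y
    unfolding defect_def using cinner_commute[of x y] cinner_commute[of "R x" "R y"] by simp
  show "0 \<le> Re (defect x x)" if "x \<in> H" for x
    using power_mono[OF R_norm_le[OF that] norm_ge_zero, of 2] by (simp add: defect_def cinner_self)
qed

abbreviation compressed :: "'a \<Rightarrow> 'h \<Rightarrow> 'h" where
  "compressed a \<equiv> compose H (adjoint_op H K R) (compose H (\<rho> a) R)"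

lemma compressed_bounded: "compressed a \<in> bounded_ops H H"
  by (rule compose_bounded[OF subspaces(1) adjoint_bounded[OF H subspaces(2) R_bounded]
        compose_bounded[OF subspaces(1) rep_bounded[OF \<rho> K] R_bounded]])

lemma cinner_adjoint_R:
  assumes "x \<in> H" "y \<in> K"
  shows "cinner (adjoint_op H K R y) x = cinner y (R x)"
  using adjoint_inner[OF H subspaces(2) R_bounded assms] cinner_commute
  by metis

lemma cinner_compressed:
  assumes "x \<in> H" "y \<in> H"
  shows "cinner (compressed a x) y = cinner (\<rho> a (R x)) (R y)"
  using assms by (simp add: compose_def cinner_adjoint_R R_simps \<rho>_simps)

lemma op_eq_iff_cinner:
  assumes S: "S \<in> bounded_ops H H" and T: "T \<in> bounded_ops H H"
  shows "S = T \<longleftrightarrow> (\<forall>x\<in>H. \<forall>y\<in>H. cinner (S x) y = cinner (T x) y)"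
proof
  assume *: "\<forall>x\<in>H. \<forall>y\<in>H. cinner (S x) y = cinner (T x) y"
  show "S = T"
  proof (rule op_ext[OF S T])
    fix x assume x: "x \<in> H"
    have "S x - T x \<in> H" by (intro HH.diff_mem bounded_ops_mem[OF S] bounded_ops_mem[OF T] x)
    then have "cinner (S x - T x) (S x - T x) = 0" using * x by (simp add: cin.diff_left)
    then show "S x = T x" by (simp add: cinner_self)
  qed
qed simp

lemma agreement_iff:
  "\<pi> a = compressed a \<longleftrightarrow> (\<forall>x\<in>H. \<forall>y\<in>H. cinner (\<pi> a x) y = cinner (\<rho> a (R x)) (R y))"
  unfolding op_eq_iff_cinner[OF rep_bounded[OF \<pi> H] compressed_bounded]
  by (simp add: cinner_compressed)

lemma defect_nonzero:
  assumes "\<not> isometric H K R"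
  obtains x where "x \<in> H" "defect x x \<noteq> 0"
proof -
  have "\<exists>x\<in>H. defect x x \<noteq> 0"
  proof (rule ccontr)
    assume "\<not> ?thesis"
    then have z: "defect x y = 0" if "x \<in> H" "y \<in> H" for x y
      using Q.form_null[OF that] that by simp
    have "compose H (adjoint_op H K R) R = op_id H"
    proof (subst op_eq_iff_cinner)
      show "compose H (adjoint_op H K R) R \<in> bounded_ops H H"
        by (rule compose_bounded[OF subspaces(1) adjoint_bounded[OF H subspaces(2) R_bounded] R_bounded])
      show "op_id H \<in> bounded_ops H H" by (intro op_id_bounded subspaces)
      show "\<forall>x\<in>H. \<forall>y\<in>H. cinner (compose H (adjoint_op H K R) R x) y = cinner (op_id H x) y"
        using z by (simp add: compose_def op_id_def cinner_adjoint_R R_simps defect_def)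
    qed
    then show False using assms by (simp add: isometric_def)
  qed
  then show ?thesis using that by blast
qed

text \<open>The completely positive map \<open>a \<mapsto> R\<^sup>*\<rho>(a)R + \<phi>(a)(I - R\<^sup>*R)\<close> agrees with \<open>\<pi>\<close> on \<open>G\<close>. To use
  hyperrigidity it must become part of a map on all operators of a space with a faithful
  representation. The space is the closure \<open>E\<close> of \<open>H \<times> K \<times> A \<times> A\<close>, embedded in the sequence space; the
  first copy of the algebra carries the GNS form of \<open>\<phi>\<close>, with cyclic vector \<open>\<omega>\<close>, and the second that of
  a faithful state \<open>\<psi>\<close>, which makes the action \<open>\<sigma>\<close> injective. The map \<open>\<Psi>\<close> keeps the corner of an operator at
  \<open>K \<times> A \<times> A\<close> and replaces the corner at \<open>H\<close> by the displayed expression, read off from the corners at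
  \<open>K\<close> and \<open>\<omega>\<close>. It fixes \<open>\<sigma> g\<close> for \<open>g \<in> G\<close>, hence fixes every \<open>\<sigma> a\<close>; the corner at \<open>H\<close> of this
  equation is the claim.\<close>

theorem hyperrigid_extension:
  assumes hyp: "hyperrigid G" and sepH: "separable_hilbert_space H" and sepK: "separable_hilbert_space K"
    and st: "state \<phi>" and ker: "\<And>g. g \<in> G \<Longrightarrow> \<phi> g = 0"
    and agree: "\<And>g. g \<in> G \<Longrightarrow> \<pi> g = compressed g"
    and x: "x \<in> H" and y: "y \<in> H"
  shows "cinner (\<pi> a x) y = cinner (\<rho> a (R x)) (R y) + \<phi> a * defect x y"
proof -
  have G: "countable G" "generates G" using hyp by (auto simp: hyperrigid_def)
  obtain \<psi> :: "'a \<Rightarrow> complex" where \<psi>: "state \<psi>" "\<And>x. \<psi> (star x * x) = 0 \<Longrightarrow> x = 0"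
    using faithful_state_exists[OF G] by blast
  obtain DA :: "'a set" where DA: "countable DA" "closure DA = UNIV"
    using countable_dense_of_generates[OF G] by blast
  obtain DH where DH: "countable DH" "DH \<subseteq> H" "H \<subseteq> closure DH" using separable_dense[OF sepH] by blast
  obtain DK where DK: "countable DK" "DK \<subseteq> K" "K \<subseteq> closure DK" using separable_dense[OF sepK] by blast
  interpret F: psd_form UNIV "\<lambda>b c. \<phi> (star c * b)" by (rule psd_form_state[OF st])
  interpret N: psd_form UNIV "\<lambda>b c. \<psi> (star c * b)" by (rule psd_form_state[OF \<psi>(1)])
  define V :: "('h \<times> 'k \<times> 'a \<times> 'a) set" where "V = H \<times> K \<times> UNIV \<times> UNIV"
  define s :: "'h \<times> 'k \<times> 'a \<times> 'a \<Rightarrow> 'h \<times> 'k \<times> 'a \<times> 'a \<Rightarrow> complex" where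
    "s = (\<lambda>(x, y, b, c) (x', y', b', c').
       cinner x x' + cinner y y' + \<phi> (star b' * b) + \<psi> (star c' * c))"
  have s: "s (x, y, b, c) (x', y', b', c') =
      cinner x x' + cinner y y' + \<phi> (star b' * b) + \<psi> (star c' * c)" for x y b c x' y' b' c'
    by (simp add: s_def)
  have sV: "psd_form V s"
  proof
    show "csubspace V" using subspaces by (auto simp: V_def csubspace_def zero_prod_def)
    show "s (u + v) w = s u w + s v w" if "u \<in> V" "v \<in> V" "w \<in> V" for u v w
      by (cases u; cases v; cases w)
        (simp add: s cin.add_left F.add_left[OF UNIV_I UNIV_I UNIV_I] N.add_left[OF UNIV_I UNIV_I UNIV_I])
    show "s (c *\<^sub>C u) v = c * s u v" if "u \<in> V" "v \<in> V" for c u v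
      by (cases u; cases v)
        (simp add: s cin.scale_left F.scale_left[OF UNIV_I UNIV_I] N.scale_left[OF UNIV_I UNIV_I] algebra_simps)
    show "s u v = cnj (s v u)" if "u \<in> V" "v \<in> V" for u v
    proof (cases u; cases v)
      fix x y b c x' y' b' c' assume "u = (x, y, b, c)" "v = (x', y', b', c')"
      then show ?thesis
        using cinner_commute[of x x'] cinner_commute[of y y']
          F.hermitian[OF UNIV_I UNIV_I, of b b'] N.hermitian[OF UNIV_I UNIV_I, of c c']
        by (simp add: s)
    qed
    show "0 \<le> Re (s u u)" if "u \<in> V" for u
      by (cases u) (simp add: s cin.nonneg F.nonneg[OF UNIV_I] N.nonneg[OF UNIV_I])
  qed
  interpret S: psd_form V s by (rule sV)
  define D where "D = DH \<times> DK \<times> DA \<times> DA"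
  have D: "countable D" "D \<subseteq> V" using DA DH DK by (auto simp: D_def V_def)
  have dense: "\<exists>d\<in>D. Re (s (u - d) (u - d)) < e" if u: "u \<in> V" and e: "e > 0" for u e
  proof -
    obtain x y b c where uu: "u = (x, y, b, c)" "x \<in> H" "y \<in> K" using u by (auto simp: V_def)
    \<comment> \<open>four components, each contributing less than \<open>e / 4\<close> to the squared distance\<close>
    define r where "r = sqrt (e / 4)"
    have r: "r > 0" "r\<^sup>2 = e / 4" using e by (simp_all add: r_def)
    obtain x' where x': "x' \<in> DH" "dist x' x < r"
      using DH(3) uu(2) r closure_approachable[of x DH] by blast
    obtain y' where y': "y' \<in> DK" "dist y' y < r"
      using DK(3) uu(3) r closure_approachable[of y DK] by blast
    obtain b' where b': "b' \<in> DA" "dist b' b < r"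
      using DA(2) r closure_approachable[of b DA] by blast
    obtain c' where c': "c' \<in> DA" "dist c' c < r"
      using DA(2) r closure_approachable[of c DA] by blast
    have lt: "t\<^sup>2 < e / 4" if "0 \<le> t" "t < r" for t
      using power_strict_mono[OF that(2,1), of 2] r by simp
    have "Re (s (u - (x', y', b', c')) (u - (x', y', b', c'))) \<le>
        (norm (x - x'))\<^sup>2 + (norm (y - y'))\<^sup>2 + (norm (b - b'))\<^sup>2 + (norm (c - c'))\<^sup>2"
      using state_star_mult_le[OF st, of "b - b'"] state_star_mult_le[OF \<psi>(1), of "c - c'"]
      by (simp add: uu s cinner_self)
    also have "\<dots> < e"
      using lt[of "norm (x - x')"] lt[of "norm (y - y')"] lt[of "norm (b - b')"] lt[of "norm (c - c')"]
        x' y' b' c' by (simp add: dist_norm norm_minus_commute)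
    finally show ?thesis using x' y' b' c' by (auto simp: D_def)
  qed
  have "\<exists>J :: 'h \<times> 'k \<times> 'a \<times> 'a \<Rightarrow> ell2. (\<forall>u\<in>V. \<forall>v\<in>V. J (u + v) = J u + J v) \<and>
      (\<forall>c. \<forall>u\<in>V. J (c *\<^sub>C u) = c *\<^sub>C J u) \<and> (\<forall>u\<in>V. \<forall>v\<in>V. cinner (J u) (J v) = s u v)"
  proof (rule S.ell2_embedding[OF D])
    show "\<exists>d\<in>D. Re (s (u - d) (u - d)) < e" if "u \<in> V" "e > 0" for u e by (rule dense[OF that])
  qed blast
  then obtain J :: "'h \<times> 'k \<times> 'a \<times> 'a \<Rightarrow> ell2" where
    J: "\<And>u v. u \<in> V \<Longrightarrow> v \<in> V \<Longrightarrow> J (u + v) = J u + J v" "\<And>c u. u \<in> V \<Longrightarrow> J (c *\<^sub>C u) = c *\<^sub>C J u"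
      "\<And>u v. u \<in> V \<Longrightarrow> v \<in> V \<Longrightarrow> cinner (J u) (J v) = s u v"
    by blast
  define E where "E = closure (J ` V)"
  interpret JE: dense_embedding V s J E
  proof
    show "complete E" unfolding E_def
      using complete_ell2 closed_closure by (metis complete_closed_subset subset_UNIV)
  qed (simp_all add: J E_def)
  have sepE: "separable_hilbert_space E"
  proof (rule separable_hilbert_spaceI[OF JE.E_hilbert, of "J ` D"])
    show "countable (J ` D)" using D by simp
    show "J ` D \<subseteq> E" using D JE.J_mem by blast
    have "J ` V \<subseteq> closure (J ` D)"
    proof
      fix z assume "z \<in> J ` V"
      then obtain u where u: "u \<in> V" "z = J u" by blast
      show "z \<in> closure (J ` D)"
        unfolding closure_approachable
      proof (intro allI impI)
        fix e :: real assume e: "e > 0"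
        obtain d where d: "d \<in> D" "Re (s (u - d) (u - d)) < e\<^sup>2" using dense[OF u(1), of "e\<^sup>2"] e by auto
        have dV: "d \<in> V" using d D by blast
        have "dist (J d) z = norm (J (u - d))"
          by (simp add: u JE.J_diff dV dist_norm norm_minus_commute)
        also have "\<dots> = sqrt (Re (s (u - d) (u - d)))" using u dV by (intro JE.J_norm S.diff_mem)
        also have "\<dots> < e" using d(2) e by (intro real_less_lsqrt) (auto intro: S.nonneg S.diff_mem u dV)
        finally show "\<exists>w\<in>J ` D. dist w z < e" using d by blast
      qed
    qed
    then show "E \<subseteq> closure (J ` D)" unfolding E_def by (simp add: closure_minimal)
  qed
  define \<alpha> :: "'a \<Rightarrow> 'h \<times> 'k \<times> 'a \<times> 'a \<Rightarrow> 'h \<times> 'k \<times> 'a \<times> 'a" where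
    "\<alpha> a = (\<lambda>(x, y, b, c). (\<pi> a x, \<rho> a y, a * b, a * c))" for a
  have \<alpha>: "\<alpha> a (x, y, b, c) = (\<pi> a x, \<rho> a y, a * b, a * c)" for a x y b c by (simp add: \<alpha>_def)
  have \<alpha>V: "\<alpha> a u \<in> V" if "u \<in> V" for a u
    using that by (auto simp: V_def \<alpha> \<pi>_simps \<rho>_simps)
  have "\<exists>\<sigma>. representation E \<sigma> \<and> (\<forall>a. \<forall>v\<in>V. \<sigma> a (J v) = J (\<alpha> a v))"
  proof (rule JE.representation_of_action[of \<alpha>])
    show "\<alpha> a u \<in> V" if "u \<in> V" for a u by (rule \<alpha>V[OF that])
    show "\<alpha> a (u + v) = \<alpha> a u + \<alpha> a v" if "u \<in> V" "v \<in> V" for a u v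
      using that by (auto simp: V_def \<alpha> \<pi>_simps \<rho>_simps distrib_left)
    show "\<alpha> a (c *\<^sub>C u) = c *\<^sub>C \<alpha> a u" if "u \<in> V" for a c u
      using that by (auto simp: V_def \<alpha> \<pi>_simps \<rho>_simps mult_scaleC_right)
    show "\<alpha> (a + b) u = \<alpha> a u + \<alpha> b u" if "u \<in> V" for a b u
      using that by (auto simp: V_def \<alpha> \<pi>_simps \<rho>_simps distrib_right)
    show "\<alpha> (c *\<^sub>C a) u = c *\<^sub>C \<alpha> a u" if "u \<in> V" for a c u
      using that by (auto simp: V_def \<alpha> \<pi>_simps \<rho>_simps mult_scaleC_left)
    show "\<alpha> (a * b) u = \<alpha> a (\<alpha> b u)" if "u \<in> V" for a b u
      using that by (auto simp: V_def \<alpha> \<pi>_simps \<rho>_simps mult.assoc)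
    show "\<alpha> 1 u = u" if "u \<in> V" for u
      using that by (auto simp: V_def \<alpha> \<pi>_simps \<rho>_simps)
    show "s (\<alpha> a u) v = s u (\<alpha> (star a) v)" if "u \<in> V" "v \<in> V" for a u v
      using that
      by (auto simp: V_def \<alpha> s rep_star[OF \<pi> H] rep_star[OF \<rho> K] star_mult star_star mult.assoc)
  qed blast
  then obtain \<sigma> where \<sigma>: "representation E \<sigma>" "\<And>a v. v \<in> V \<Longrightarrow> \<sigma> a (J v) = J (\<alpha> a v)" by blast
  have "inj \<sigma>"
  proof (rule injI)
    fix a b assume eq: "\<sigma> a = \<sigma> b"
    let ?e = "(0, 0, 0, 1) :: 'h \<times> 'k \<times> 'a \<times> 'a"
    have eV: "?e \<in> V" by (simp add: V_def HH.zero_mem KK.zero_mem)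
    have dV: "\<alpha> a ?e - \<alpha> b ?e \<in> V" by (intro S.diff_mem \<alpha>V eV)
    have "J (\<alpha> a ?e - \<alpha> b ?e) = 0"
      using eq eV \<sigma>(2)[OF eV, of a] \<sigma>(2)[OF eV, of b] by (simp add: JE.J_diff \<alpha>V)
    then have "s (\<alpha> a ?e - \<alpha> b ?e) (\<alpha> a ?e - \<alpha> b ?e) = 0"
      using J(3)[OF dV dV] by (simp add: cin.zero_left)
    moreover have "\<alpha> a ?e - \<alpha> b ?e = (0, 0, 0, a - b)"
    proof -
      have "\<pi> c 0 = 0" "\<rho> c 0 = 0" for c
        using bounded_ops_scale[OF rep_bounded[OF \<pi> H] HH.zero_mem, of c 0]
          bounded_ops_scale[OF rep_bounded[OF \<rho> K] KK.zero_mem, of c 0] by simp_all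
      then show ?thesis by (simp add: \<alpha>)
    qed
    ultimately have "\<psi> (star (a - b) * (a - b)) = 0" by (simp add: s cin.zero_left F.zero_left[OF UNIV_I, of 0, simplified])
    then show "a = b" using \<psi>(2)[of "a - b"] by simp
  qed
  \<comment> \<open>\<open>P\<close> drops the component in \<open>H\<close>, and \<open>P'\<close> moves it to \<open>K\<close> by \<open>R\<close>\<close>
  define P :: "'h \<times> 'k \<times> 'a \<times> 'a \<Rightarrow> 'h \<times> 'k \<times> 'a \<times> 'a" where "P = (\<lambda>(x, y). (0, y))"
  define P' :: "'h \<times> 'k \<times> 'a \<times> 'a \<Rightarrow> 'h \<times> 'k \<times> 'a \<times> 'a" where "P' = (\<lambda>(x, y). (0, R x, 0, 0))"
  define q :: "'h \<times> 'k \<times> 'a \<times> 'a \<Rightarrow> 'h \<times> 'k \<times> 'a \<times> 'a \<Rightarrow> complex"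
    where "q = (\<lambda>u v. defect (fst u) (fst v))"
  have P: "P (x, y) = (0, y)" "P' (x, y) = (0, R x, 0, 0)" for x y by (simp_all add: P_def P'_def)
  define \<omega> :: "'h \<times> 'k \<times> 'a \<times> 'a" where "\<omega> = (0, 0, 1, 0)"
  have \<omega>V: "\<omega> \<in> V" by (simp add: V_def \<omega>_def HH.zero_mem KK.zero_mem)
  have one: "\<phi> 1 = 1" using st by (simp add: state_def)
  have z\<phi>: "\<phi> 0 = 0" and z\<psi>: "\<psi> 0 = 0"
    using F.zero_left[OF UNIV_I, of 0] N.zero_left[OF UNIV_I, of 0] by simp_all
  have R0: "R 0 = 0" using bounded_ops_scale[OF R_bounded HH.zero_mem, of 0] by simp
  have q: "psd_form V q"
  proof
    show "csubspace V" by (rule S.V)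
  qed (auto simp: q_def V_def Q.add_left Q.scale_left Q.nonneg intro: Q.hermitian)
  have "\<exists>\<Psi>. ucp E \<Psi> \<and> (\<forall>T\<in>bounded_ops E E. \<forall>u\<in>V. \<forall>v\<in>V. cinner (\<Psi> T (J u)) (J v) =
      cinner (T (J (P u))) (J (P v)) + cinner (T (J (P' u))) (J (P' v)) + cinner (T (J \<omega>)) (J \<omega>) * q u v)"
  proof (rule JE.compression_ucp[of P P' q "J \<omega>" D])
    show "P u \<in> V" "P' u \<in> V" if "u \<in> V" for u
      using that by (auto simp: V_def P HH.zero_mem R_simps)
    show "P (u + v) = P u + P v" "P' (u + v) = P' u + P' v" if "u \<in> V" "v \<in> V" for u v
      using that by (auto simp: V_def P R_simps)
    show "P (c *\<^sub>C u) = c *\<^sub>C P u" "P' (c *\<^sub>C u) = c *\<^sub>C P' u" if "u \<in> V" for c u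
      using that by (auto simp: V_def P R_simps)
    show "psd_form V q" by (rule q)
    show "J \<omega> \<in> E" by (rule JE.J_mem[OF \<omega>V])
    show "norm (J \<omega>) = 1" by (simp add: JE.J_norm \<omega>V) (simp add: \<omega>_def s one z\<psi> cin.zero_left)
    show "countable D" "D \<subseteq> V" by (rule D)+
    show "\<exists>d\<in>D. Re (s (u - d) (u - d)) < e" if "u \<in> V" "e > 0" for u e by (rule dense[OF that])
    show "s (P u) (P v) + s (P' u) (P' v) + q u v = s u v" if "u \<in> V" "v \<in> V" for u v
      using that by (auto simp: V_def P s q_def defect_def cin.zero_left z\<phi> z\<psi>)
  qed blast
  then obtain \<Psi> where \<Psi>: "ucp E \<Psi>"
    "\<And>T u v. T \<in> bounded_ops E E \<Longrightarrow> u \<in> V \<Longrightarrow> v \<in> V \<Longrightarrow> cinner (\<Psi> T (J u)) (J v) =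
      cinner (T (J (P u))) (J (P v)) + cinner (T (J (P' u))) (J (P' v)) + cinner (T (J \<omega>)) (J \<omega>) * q u v"
    by blast
  have \<sigma>b: "\<sigma> a \<in> bounded_ops E E" for a by (rule rep_bounded[OF \<sigma>(1) JE.E_hilbert])
  have \<Psi>b: "\<Psi> T \<in> bounded_ops E E" if "T \<in> bounded_ops E E" for T
    using \<Psi>(1) that by (simp add: ucp_def)
  have PV: "P u \<in> V" "P' u \<in> V" if "u \<in> V" for u
    using that by (auto simp: V_def P HH.zero_mem R_simps)
  have \<Psi>\<sigma>: "cinner (\<Psi> (\<sigma> a) (J u)) (J v) =
      s (\<alpha> a (P u)) (P v) + s (\<alpha> a (P' u)) (P' v) + \<phi> a * q u v" if "u \<in> V" "v \<in> V" for a u v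
  proof -
    have "s (\<alpha> a \<omega>) \<omega> = \<phi> a"
      by (simp add: \<omega>_def \<alpha> s cin.zero_right z\<psi>)
    then show ?thesis
      using that by (simp add: \<Psi>(2)[OF \<sigma>b] \<sigma>(2) PV \<omega>V J(3) \<alpha>V)
  qed
  have \<pi>0: "\<pi> a 0 = 0" and \<rho>0: "\<rho> a 0 = 0" for a
    using bounded_ops_scale[OF rep_bounded[OF \<pi> H] HH.zero_mem, of a 0]
      bounded_ops_scale[OF rep_bounded[OF \<rho> K] KK.zero_mem, of a 0] by simp_all
  \<comment> \<open>the term with \<open>\<phi> g\<close> disappears, and \<open>\<pi> g\<close> is the compression of \<open>\<rho> g\<close>\<close>
  have fixG: "\<Psi> (\<sigma> g) = \<sigma> g" if g: "g \<in> G" for g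
  proof (rule JE.E_form_eqI[OF \<Psi>b[OF \<sigma>b] \<sigma>b])
    fix u v assume u: "u \<in> V" and v: "v \<in> V"
    obtain x y b c where uu: "u = (x, y, b, c)" "x \<in> H" "y \<in> K" using u by (auto simp: V_def)
    obtain x' y' b' c' where vv: "v = (x', y', b', c')" "x' \<in> H" "y' \<in> K" using v by (auto simp: V_def)
    have "cinner (\<pi> g x) x' = cinner (\<rho> g (R x)) (R x')"
      using agree[OF g] uu vv unfolding agreement_iff by blast
    then have "s (\<alpha> g (P u)) (P v) + s (\<alpha> g (P' u)) (P' v) + \<phi> g * q u v = s (\<alpha> g u) v"
      by (simp add: uu vv P \<alpha> s \<pi>0 \<rho>0 cin.zero_left z\<phi> z\<psi> ker[OF g])
    then show "cinner (\<Psi> (\<sigma> g) (J u)) (J v) = cinner (\<sigma> g (J u)) (J v)"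
      using u v by (simp add: \<Psi>\<sigma> \<sigma>(2) J(3) \<alpha>V)
  qed
  have "op_norm E (op_diff E (\<Psi> (\<sigma> g)) (\<sigma> g)) = 0" if "g \<in> G" for g
  proof -
    have "op_norm E (op_diff E (\<sigma> g) (\<sigma> g)) = (SUP x\<in>{x \<in> E. norm x \<le> 1}. 0)"
      unfolding op_norm_def by (intro SUP_cong) (auto simp: op_diff_def)
    also have "\<dots> = 0"
      using JE.E_subspace by (intro cSUP_const) (auto simp: csubspace_def intro!: exI[of _ 0])
    finally show ?thesis by (simp add: fixG[OF that])
  qed
  then have "\<forall>g\<in>G. (\<lambda>k. op_norm E (op_diff E (\<Psi> (\<sigma> g)) (\<sigma> g))) \<longlonglongrightarrow> 0"
    by simp
  \<comment> \<open>hyperrigidity, for the constant sequence \<open>\<Psi>\<close>\<close>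
  then have "(\<lambda>k::nat. op_norm E (op_diff E (\<Psi> (\<sigma> a)) (\<sigma> a))) \<longlonglongrightarrow> 0"
    using hyp[unfolded hyperrigid_def, THEN conjunct2, THEN conjunct2, rule_format,
        of E \<sigma> "\<lambda>k. \<Psi>"] sepE \<sigma>(1) \<open>inj \<sigma>\<close> \<Psi>(1) by blast
  then have n0: "op_norm E (op_diff E (\<Psi> (\<sigma> a)) (\<sigma> a)) = 0"
    by (simp add: LIMSEQ_const_iff)
  let ?u = "(x, 0, 0, 0) :: 'h \<times> 'k \<times> 'a \<times> 'a" and ?v = "(y, 0, 0, 0) :: 'h \<times> 'k \<times> 'a \<times> 'a"
  have uv: "?u \<in> V" "?v \<in> V" using x y by (auto simp: V_def KK.zero_mem)
  have "op_diff E (\<Psi> (\<sigma> a)) (\<sigma> a) = op_add E (\<Psi> (\<sigma> a)) (op_scale E (-1) (\<sigma> a))"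
    unfolding op_diff_def op_add_def op_scale_def
    by (intro restrict_ext) (simp flip: scaleC_minus1)
  also have "\<dots> \<in> bounded_ops E E"
    by (intro op_add_bounded op_scale_bounded JE.E_subspace \<Psi>b \<sigma>b)
  finally have "norm (op_diff E (\<Psi> (\<sigma> a)) (\<sigma> a) (J ?u)) \<le> 0"
    using op_norm_bound[OF JE.E_subspace _ JE.J_mem[OF uv(1)]] n0 by fastforce
  then have "\<Psi> (\<sigma> a) (J ?u) = \<sigma> a (J ?u)"
    using JE.J_mem[OF uv(1)] by (simp add: op_diff_def)
  then have "s (\<alpha> a (P ?u)) (P ?v) + s (\<alpha> a (P' ?u)) (P' ?v) + \<phi> a * q ?u ?v = s (\<alpha> a ?u) ?v"
    using \<Psi>\<sigma>[OF uv, of a] by (simp add: \<sigma>(2) uv J(3) \<alpha>V)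
  then show ?thesis
    by (simp add: P \<alpha> s \<pi>0 \<rho>0 cin.zero_left z\<phi> z\<psi> q_def)
qed

end


section \<open>The dichotomy\<close>

text \<open>Vector states are states, and states are bounded.\<close>

lemma representation_norm_le:
  fixes \<pi> :: "'a::unital_cstar_algebra \<Rightarrow> 'h::complex_inner \<Rightarrow> 'h"
  assumes \<pi>: "representation H \<pi>" and H: "hilbert_space H" and x: "x \<in> H"
  shows "norm (\<pi> a x) \<le> norm a * norm x"
proof (cases "x = 0")
  case True
  then show ?thesis
    using bounded_ops_scale[OF rep_bounded[OF \<pi> H] x, of a 0] by simp
next
  case False
  define \<tau> where "\<tau> b = cinner (\<pi> b x) x / of_real ((norm x)\<^sup>2)" for b
  have sq: "\<tau> (star b * b) = of_real ((norm (\<pi> b x))\<^sup>2 / (norm x)\<^sup>2)" for b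
    using rep_star[OF \<pi> H rep_mem[OF \<pi> H x, of b] x, of "star b"]
    by (simp add: \<tau>_def rep_mult[OF \<pi> H x] star_star cinner_self)
  have "state \<tau>"
    unfolding state_def clinear_functional_def
  proof (intro conjI allI)
    show "\<tau> (b + c) = \<tau> b + \<tau> c" for b c
      by (simp add: \<tau>_def rep_add[OF \<pi> H x] cin.add_left add_divide_distrib)
    show "\<tau> (c *\<^sub>C b) = c * \<tau> b" for c b
      by (simp add: \<tau>_def rep_scale[OF \<pi> H x] cin.scale_left)
    show "\<tau> (star b * b) \<in> \<real>\<^sub>\<ge>\<^sub>0" for b unfolding sq nonneg_Reals_of_real_iff by simp
    show "\<tau> 1 = 1" using False by (simp add: \<tau>_def rep_one[OF \<pi> H x] cinner_self)
  qed
  from state_star_mult_le[OF this, of a] have "(norm (\<pi> a x))\<^sup>2 / (norm x)\<^sup>2 \<le> (norm a)\<^sup>2"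
    unfolding sq by simp
  then have "(norm (\<pi> a x))\<^sup>2 \<le> (norm a * norm x)\<^sup>2"
    using False by (simp add: power_mult_distrib pos_divide_le_eq)
  then show ?thesis by (rule power2_le_imp_le) simp
qed

lemma bounded_linear_rep_coefficient:
  assumes \<pi>: "representation H \<pi>" and H: "hilbert_space H" and x: "x \<in> H"
  shows "bounded_linear (\<lambda>a. cinner (\<pi> a x) y)"
proof (rule bounded_linear_intro[where K="norm x * norm y"])
  show "cmod (cinner (\<pi> a x) y) \<le> norm a * (norm x * norm y)" for a
  proof -
    have "cmod (cinner (\<pi> a x) y) \<le> norm (\<pi> a x) * norm y" by (rule norm_cinner_le)
    also have "\<dots> \<le> (norm a * norm x) * norm y"
      by (intro mult_right_mono representation_norm_le[OF \<pi> H x]) simp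
    finally show ?thesis by (simp add: mult.assoc)
  qed
qed (simp_all add: rep_add[OF \<pi> H x] rep_scale[OF \<pi> H x] scaleR_scaleC cin.add_left cin.scale_left
    scaleR_conv_of_real)

text \<open>The form of \<open>\<phi>\<close> vanishes at \<open>d = b - \<phi> b\<close>, so \<open>\<phi> (a * d) = 0\<close> for all \<open>a\<close> by Cauchy-Schwarz.\<close>

lemma character_of_multiplicative_squares:
  assumes st: "state \<phi>" and sq: "\<And>a. Re (\<phi> (star a * a)) \<le> (cmod (\<phi> a))\<^sup>2"
  shows "character \<phi>"
proof -
  interpret psd_form UNIV "\<lambda>x y. \<phi> (star y * x)" by (rule psd_form_state[OF st])
  have lin: "clinear_functional \<phi>" and one: "\<phi> 1 = 1" using st by (auto simp: state_def)
  note L = linear_functional_simps[OF lin]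
  have "\<phi> (a * b) = \<phi> a * \<phi> b" for a b
  proof -
    let ?d = "b - \<phi> b *\<^sub>C 1"
    have "\<phi> ?d = 0" by (simp add: L one)
    then have "Re (\<phi> (star ?d * ?d)) = 0"
      using sq[of ?d] nonneg[of ?d] by simp
    then have "\<phi> (star (star a) * ?d) = 0" by (intro form_null) auto
    then show ?thesis by (simp add: star_star algebra_simps L mult_scaleC_right)
  qed
  then show ?thesis
    using lin one state_star[OF st] unfolding character_def by blast
qed

lemma kernel_of_state_closed:
  assumes st: "state \<phi>"
  shows "closed (ker \<phi>)"
proof -
  have L: "clinear_functional \<phi>" using st by (simp add: state_def)
  have "bounded_linear \<phi>"
    by (rule bounded_linear_intro[where K=1])
      (simp_all add: linear_functional_simps(1,7)[OF L] state_norm_le[OF st]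
        scaleR_conv_of_real[where 'a = complex])
  then have "continuous_on UNIV \<phi>" by (rule linear_continuous_on)
  then show ?thesis
    unfolding ker_def using continuous_closed_preimage_constant[of UNIV \<phi> 0] by simp
qed

lemma kernel_of_character_ideal: "character \<phi> \<Longrightarrow> two_sided_ideal (ker \<phi>)"
  unfolding character_def two_sided_ideal_def csubspace_def ker_def
  by (auto simp: linear_functional_simps)

context compression
begin

definition agreement :: "'a set" where
  "agreement = {a. \<pi> a = compressed a}"

lemma agreement_mem:
  "a \<in> agreement \<longleftrightarrow> (\<forall>x\<in>H. \<forall>y\<in>H. cinner (\<pi> a x) y = cinner (\<rho> a (R x)) (R y))"
  by (simp add: agreement_def agreement_iff)

lemma agreement_star: "a \<in> agreement \<Longrightarrow> star a \<in> agreement"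
  unfolding agreement_mem
proof (intro ballI)
  fix x y assume a: "\<forall>x\<in>H. \<forall>y\<in>H. cinner (\<pi> a x) y = cinner (\<rho> a (R x)) (R y)" and xy: "x \<in> H" "y \<in> H"
  have "cinner (\<pi> (star a) x) y = cnj (cinner (\<pi> a y) x)"
    using rep_star[OF \<pi> H xy(2,1), of a] cinner_commute by metis
  also have "\<dots> = cnj (cinner (\<rho> a (R y)) (R x))" using a xy by simp
  also have "\<dots> = cinner (\<rho> (star a) (R x)) (R y)"
    using rep_star[OF \<rho> K, of "R y" "R x" a] xy cinner_commute R_simps by metis
  finally show "cinner (\<pi> (star a) x) y = cinner (\<rho> (star a) (R x)) (R y)" .
qed

lemma bounded_linear_coefficient:
  assumes x: "x \<in> H"
  shows "bounded_linear (\<lambda>a. cinner (\<pi> a x) y - cinner (\<rho> a (R x)) (R y))"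
  by (intro bounded_linear_sub bounded_linear_rep_coefficient[OF \<pi> H x]
      bounded_linear_rep_coefficient[OF \<rho> K] R_simps x)

lemma agreement_closed: "closed agreement"
proof -
  have "agreement = (\<Inter>x\<in>H. \<Inter>y\<in>H. {a. cinner (\<pi> a x) y - cinner (\<rho> a (R x)) (R y) = 0})"
    using agreement_mem by auto
  moreover have "closed {a. cinner (\<pi> a x) y - cinner (\<rho> a (R x)) (R y) = 0}" if "x \<in> H" for x y
    using continuous_closed_preimage_constant[OF
        linear_continuous_on[OF bounded_linear_coefficient[OF that, of y]] closed_UNIV, of 0] by simp
  ultimately show ?thesis by (simp add: closed_INT)
qed

lemma agreement_subspace: "csubspace agreement"
  unfolding csubspace_def
proof (intro conjI ballI allI)
  have "\<pi> 0 x = 0" if "x \<in> H" for x using \<pi>_simps(5)[OF that, of 0 0] by simp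
  moreover have "\<rho> 0 y = 0" if "y \<in> K" for y using \<rho>_simps(5)[OF that, of 0 0] by simp
  ultimately
  show "0 \<in> agreement" by (simp add: agreement_mem R_simps cin.zero_left)
  show "a + b \<in> agreement" if "a \<in> agreement" "b \<in> agreement" for a b
    using that unfolding agreement_mem by (simp add: \<pi>_simps \<rho>_simps R_simps cin.add_left)
  show "c *\<^sub>C a \<in> agreement" if "a \<in> agreement" for c a
    using that unfolding agreement_mem by (simp add: \<pi>_simps \<rho>_simps R_simps cin.scale_left)
qed

text \<open>Choose \<open>x\<close> with \<open>defect x x \<noteq> 0\<close>; the functional \<open>\<theta>\<close> is continuous, vanishes on the agreement set
  \<open>J\<close> and takes the value 1 at the unit. The elements \<open>a\<close> with \<open>a - \<theta> a \<in> J\<close> are those of \<open>J + \<complex>1\<close>, and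
  the description through \<open>\<theta>\<close> makes closedness evident. They form a C*-algebra that contains \<open>G\<close> and the
  unit, hence everything, and \<open>\<theta>\<close> is multiplicative because \<open>J\<close> is an ideal.\<close>

theorem state_of_ideal:
  assumes ideal: "two_sided_ideal agreement" and G: "G \<subseteq> agreement" "generates G"
    and iso: "\<not> isometric H K R"
  obtains \<phi> where "state \<phi>" "G \<subseteq> ker \<phi>"
proof -
  obtain x where x: "x \<in> H" "defect x x \<noteq> 0" using defect_nonzero[OF iso] by blast
  define \<theta> where "\<theta> a = (cinner (\<pi> a x) x - cinner (\<rho> a (R x)) (R x)) / defect x x" for a
  have Rx: "R x \<in> K" using x by (simp add: R_simps)
  have lin: "clinear_functional \<theta>"
    unfolding clinear_functional_def
    by (auto simp: \<theta>_def \<pi>_simps \<rho>_simps x Rx cin.add_left cin.scale_left diff_divide_distrib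
        add_divide_distrib right_diff_distrib)
  note L = linear_functional_simps[OF lin]
  have one: "\<theta> 1 = 1" using x by (simp add: \<theta>_def \<pi>_simps \<rho>_simps Rx defect_def)
  have zero: "\<theta> a = 0" if "a \<in> agreement" for a
    using that x unfolding agreement_mem by (simp add: \<theta>_def)
  note J = agreement_subspace[unfolded csubspace_def]
  have mult: "a * b \<in> agreement" "b * a \<in> agreement" if "b \<in> agreement" for a b
    using ideal that unfolding two_sided_ideal_def by auto
  have J_diff: "a - b \<in> agreement" if "a \<in> agreement" "b \<in> agreement" for a b
    using J that scaleC_minus1[of b] by (metis diff_conv_add_uminus)
  define B where "B = {a. a - \<theta> a *\<^sub>C 1 \<in> agreement}"
  have BI: "a \<in> B" if "a - c *\<^sub>C 1 \<in> agreement" for a c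
  proof -
    have "\<theta> (a - c *\<^sub>C 1) = 0" by (rule zero[OF that])
    then have "\<theta> a = c" by (simp add: L one)
    then show ?thesis using that by (simp add: B_def)
  qed
  have cont: "continuous_on UNIV \<theta>"
    unfolding \<theta>_def[abs_def]
    using x(2) by (intro continuous_on_divide continuous_on_const
        linear_continuous_on[OF bounded_linear_coefficient[OF x(1)]]) auto
  have "cstar_subalgebra B"
    unfolding cstar_subalgebra_def csubspace_def
  proof (intro conjI ballI allI)
    show "0 \<in> B" using J by (intro BI[of 0 0]) simp
    show "a + b \<in> B" if "a \<in> B" "b \<in> B" for a b
    proof (rule BI)
      have "(a - \<theta> a *\<^sub>C 1) + (b - \<theta> b *\<^sub>C 1) \<in> agreement" using that J by (simp add: B_def)
      then show "a + b - (\<theta> a + \<theta> b) *\<^sub>C 1 \<in> agreement"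
        by (simp add: scaleC_add_left algebra_simps)
    qed
    show "c *\<^sub>C a \<in> B" if "a \<in> B" for c a
    proof (rule BI)
      have "c *\<^sub>C (a - \<theta> a *\<^sub>C 1) \<in> agreement" using that J by (simp add: B_def)
      then show "c *\<^sub>C a - (c * \<theta> a) *\<^sub>C 1 \<in> agreement"
        by (simp add: scaleC_diff_right scaleC_scaleC)
    qed
    show "a * b \<in> B" if "a \<in> B" "b \<in> B" for a b
    proof (rule BI)
      have "(a - \<theta> a *\<^sub>C 1) * b + \<theta> a *\<^sub>C (b - \<theta> b *\<^sub>C 1) \<in> agreement"
        using that J mult by (simp add: B_def)
      then show "a * b - (\<theta> a * \<theta> b) *\<^sub>C 1 \<in> agreement"
        by (simp add: scaleC_diff_right scaleC_scaleC left_diff_distrib mult_scaleC_left)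
    qed
    show "star a \<in> B" if "a \<in> B" for a
    proof (rule BI)
      have "star (a - \<theta> a *\<^sub>C 1) \<in> agreement" using that by (intro agreement_star) (simp add: B_def)
      then show "star a - cnj (\<theta> a) *\<^sub>C 1 \<in> agreement" by (simp add: star_diff star_scaleC)
    qed
    have "continuous_on UNIV (\<lambda>a. a - \<theta> a *\<^sub>C (1 :: 'a))"
      by (intro continuous_intros bounded_bilinear.continuous_on[OF bounded_bilinear_scaleC_cstar] cont)
    then have "closed ((\<lambda>a. a - \<theta> a *\<^sub>C (1 :: 'a)) -` agreement)"
      by (rule closed_vimage[OF agreement_closed])
    then show "closed B" by (simp add: B_def vimage_def)
  qed
  moreover have "G \<subseteq> B"
  proof
    fix g assume "g \<in> G"
    then show "g \<in> B" using G(1) by (intro BI[of g 0]) auto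
  qed
  moreover have "1 \<in> B" using J by (intro BI[of 1 1]) simp
  ultimately have B: "a \<in> B" for a using G(2) unfolding generates_def by blast
  have eqI: "\<theta> a = c" if "a - c *\<^sub>C 1 \<in> agreement" for a c
    using zero[OF that] by (simp add: L one)
  have \<theta>_mult: "\<theta> (a * b) = \<theta> a * \<theta> b" for a b
  proof (rule eqI)
    have "(a - \<theta> a *\<^sub>C 1) * b + \<theta> a *\<^sub>C (b - \<theta> b *\<^sub>C 1) \<in> agreement"
      using B[of a] B[of b] J mult by (simp add: B_def)
    then show "a * b - (\<theta> a * \<theta> b) *\<^sub>C 1 \<in> agreement"
      by (simp add: scaleC_diff_right scaleC_scaleC left_diff_distrib mult_scaleC_left)
  qed
  have \<theta>_star: "\<theta> (star a) = cnj (\<theta> a)" for a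
  proof (rule eqI)
    have "star (a - \<theta> a *\<^sub>C 1) \<in> agreement" using B[of a] by (intro agreement_star) (simp add: B_def)
    then show "star a - cnj (\<theta> a) *\<^sub>C 1 \<in> agreement" by (simp add: star_diff star_scaleC)
  qed
  have "\<theta> (star a * a) = of_real ((cmod (\<theta> a))\<^sup>2)" for a
    by (simp add: \<theta>_mult \<theta>_star complex_norm_square mult.commute del: of_real_power)
  then have "state \<theta>" using lin one by (simp add: state_def)
  moreover have "G \<subseteq> ker \<theta>" using G(1) zero by (auto simp: ker_def)
  ultimately show ?thesis using that by blast
qed

text \<open>If \<open>R\<close> intertwines, then \<open>R\<^sup>*\<rho>(a)R = R\<^sup>*R\<pi>(a)\<close>, and \<open>I - R\<^sup>*R\<close> commutes with every \<open>\<pi>(b)\<close>. So \<open>J\<close>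
  consists of the \<open>a\<close> with \<open>(I - R\<^sup>*R)\<pi>(a) = 0\<close>, a condition stable under multiplication on both
  sides.\<close>

lemma ideal_of_intertwining:
  assumes int: "\<And>a x. x \<in> H \<Longrightarrow> R (\<pi> a x) = \<rho> a (R x)"
  shows "two_sided_ideal agreement"
proof -
  have iff: "a \<in> agreement \<longleftrightarrow> (\<forall>x\<in>H. \<forall>y\<in>H. defect (\<pi> a x) y = 0)" for a
    by (simp add: agreement_mem defect_def int)
  have move: "defect (\<pi> b x) y = defect x (\<pi> (star b) y)" if "x \<in> H" "y \<in> H" for b x y
    using that by (simp add: defect_def int rep_star[OF \<pi> H] rep_star[OF \<rho> K] R_simps)
  show ?thesis
    unfolding two_sided_ideal_def
  proof (intro conjI allI ballI agreement_subspace)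
    fix a b assume b: "b \<in> agreement"
    show "a * b \<in> agreement" using b unfolding iff by (simp add: \<pi>_simps move)
    show "b * a \<in> agreement" using b unfolding iff by (simp add: \<pi>_simps)
  qed
qed

text \<open>Apply the formula for \<open>\<pi>\<close> to \<open>star a * a\<close>, and to \<open>a\<close> with second vector \<open>\<pi> a x\<close>. Since \<open>\<pi>\<close> is
  multiplicative, the results combine to a vanishing sum of three nonnegative terms (the fact \<open>key\<close>
  below). The first term gives the intertwining relation; the second, at a vector where the defect is
  nonzero, gives \<open>\<phi> (star a * a) = \<bar>\<phi> a\<bar>\<^sup>2\<close>.\<close>

theorem consequences_of_extension:
  assumes ext: "\<And>a x y. x \<in> H \<Longrightarrow> y \<in> H \<Longrightarrow>
      cinner (\<pi> a x) y = cinner (\<rho> a (R x)) (R y) + \<phi> a * defect x y"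
    and st: "state \<phi>" and iso: "\<not> isometric H K R"
  shows intertwining_of_extension: "x \<in> H \<Longrightarrow> R (\<pi> a x) = \<rho> a (R x)"
    and character_of_extension: "character \<phi>"
    and kernel_of_extension: "ker \<phi> = agreement"
    and compression_formula: "\<pi> a = op_add H (compressed a)
      (op_scale H (\<phi> a) (op_diff H (op_id H) (compose H (adjoint_op H K R) R)))"
proof -
  interpret F: psd_form UNIV "\<lambda>b c. \<phi> (star c * b)" by (rule psd_form_state[OF st])
  \<comment> \<open>the square of the distance between the images of \<open>x\<close> under \<open>(\<rho> \<oplus> \<sigma>)(a)V\<close> and \<open>V\<pi>(a)\<close>, where
    \<open>\<sigma>\<close> is the GNS representation of \<open>\<phi>\<close> and \<open>V\<close> the isometry of the Stinespring dilation\<close>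
  have key: "(norm (\<rho> a (R x) - R (\<pi> a x)))\<^sup>2 + (Re (\<phi> (star a * a)) - (cmod (\<phi> a))\<^sup>2) * Re (defect x x)
      + Re (defect (\<phi> a *\<^sub>C x - \<pi> a x) (\<phi> a *\<^sub>C x - \<pi> a x)) = 0" if x: "x \<in> H" for a x
  proof -
    let ?y = "\<pi> a x"
    have y: "?y \<in> H" using x by (simp add: \<pi>_simps)
    have Rx: "R x \<in> K" "R ?y \<in> K" "\<rho> a (R x) \<in> K" using x y by (simp_all add: R_simps \<rho>_simps)
    have 1: "cinner ?y ?y = cinner (\<rho> a (R x)) (\<rho> a (R x)) + \<phi> (star a * a) * defect x x"
      using ext[OF x x, of "star a * a"] x y Rx rep_star[OF \<pi> H y x, of "star a"]
        rep_star[OF \<rho> K Rx(3) Rx(1), of "star a"]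
      by (simp add: \<pi>_simps \<rho>_simps star_star)
    have 2: "cinner ?y ?y = cinner (\<rho> a (R x)) (R ?y) + \<phi> a * defect x ?y"
      by (rule ext[OF x y])
    have 3: "cinner ?y ?y = cinner (R ?y) (R ?y) + defect ?y ?y"
      by (simp add: defect_def)
    have n: "(norm (\<rho> a (R x) - R ?y))\<^sup>2 = Re (cinner (\<rho> a (R x)) (\<rho> a (R x)))
        - 2 * Re (cinner (\<rho> a (R x)) (R ?y)) + Re (cinner (R ?y) (R ?y))"
      using cin.form_diff_scale[of "\<rho> a (R x)" "R ?y" 1] by (simp add: cinner_self)
    have d: "Re (defect (\<phi> a *\<^sub>C x - ?y) (\<phi> a *\<^sub>C x - ?y)) =
        (cmod (\<phi> a))\<^sup>2 * Re (defect x x) - 2 * Re (\<phi> a * defect x ?y) + Re (defect ?y ?y)"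
      unfolding cmod_power2 using Q.form_diff_scale[of "\<phi> a *\<^sub>C x" ?y 1] x y
      by (simp add: Q.scale_left Q.scale_right Q.scale_mem power2_eq_square algebra_simps)
    have r: "Re (\<phi> (star a * a) * defect x x) = Re (\<phi> (star a * a)) * Re (defect x x)"
      by (subst Q.form_self[OF x]) simp
    show ?thesis
      using arg_cong[OF 1, of Re] arg_cong[OF 2, of Re] arg_cong[OF 3, of Re]
      unfolding n d plus_complex.sel r left_diff_distrib by linarith
  qed
  have sq: "(cmod (\<phi> a))\<^sup>2 \<le> Re (\<phi> (star a * a))" for a
    using F.cauchy_schwarz[of a 1] st by (simp add: state_def)
  have parts: "(norm (\<rho> a (R x) - R (\<pi> a x)))\<^sup>2 = 0"
    "(Re (\<phi> (star a * a)) - (cmod (\<phi> a))\<^sup>2) * Re (defect x x) = 0" if x: "x \<in> H" for a x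
  proof -
    have "0 \<le> (norm (\<rho> a (R x) - R (\<pi> a x)))\<^sup>2" by simp
    moreover have "0 \<le> (Re (\<phi> (star a * a)) - (cmod (\<phi> a))\<^sup>2) * Re (defect x x)"
      using sq[of a] Q.nonneg[OF x] by simp
    moreover have "0 \<le> Re (defect (\<phi> a *\<^sub>C x - \<pi> a x) (\<phi> a *\<^sub>C x - \<pi> a x))"
      using x by (intro Q.nonneg Q.diff_mem Q.scale_mem) (simp_all add: \<pi>_simps)
    ultimately show "(norm (\<rho> a (R x) - R (\<pi> a x)))\<^sup>2 = 0"
      "(Re (\<phi> (star a * a)) - (cmod (\<phi> a))\<^sup>2) * Re (defect x x) = 0"
      using key[OF x, of a] by linarith+
  qed
  show "x \<in> H \<Longrightarrow> R (\<pi> a x) = \<rho> a (R x)" using parts(1)[of x a] by simp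
  obtain z where z: "z \<in> H" "defect z z \<noteq> 0" using defect_nonzero[OF iso] by blast
  have "Re (defect z z) \<noteq> 0" using z Q.form_self[OF z(1)] by force
  then show "character \<phi>"
    using parts(2)[OF z(1)] by (intro character_of_multiplicative_squares[OF st]) simp
  show "ker \<phi> = agreement"
    unfolding ker_def set_eq_iff agreement_mem using ext z by (auto dest!: bspec[OF _ z(1)])
  have RR: "compose H (adjoint_op H K R) R \<in> bounded_ops H H"
    by (rule compose_bounded[OF subspaces(1) adjoint_bounded[OF H subspaces(2) R_bounded] R_bounded])
  have "op_diff H (op_id H) (compose H (adjoint_op H K R) R) =
      op_add H (op_id H) (op_scale H (-1) (compose H (adjoint_op H K R) R))"
    unfolding op_diff_def op_add_def op_scale_def
    by (intro restrict_ext) (simp flip: scaleC_minus1)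
  then have "op_diff H (op_id H) (compose H (adjoint_op H K R) R) \<in> bounded_ops H H"
    using op_add_bounded[OF subspaces(1) subspaces(1) op_id_bounded[OF subspaces(1)]
        op_scale_bounded[OF subspaces(1) subspaces(1) RR]] by simp
  then have bd: "op_add H (compressed a)
      (op_scale H (\<phi> a) (op_diff H (op_id H) (compose H (adjoint_op H K R) R))) \<in> bounded_ops H H"
    by (intro op_add_bounded op_scale_bounded subspaces compressed_bounded)
  show "\<pi> a = op_add H (compressed a)
      (op_scale H (\<phi> a) (op_diff H (op_id H) (compose H (adjoint_op H K R) R)))"
    unfolding op_eq_iff_cinner[OF rep_bounded[OF \<pi> H] bd]
  proof (intro ballI)
    fix x y assume x: "x \<in> H" and y: "y \<in> H"
    have "cinner (x - adjoint_op H K R (R x)) y = defect x y"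
      using x y by (simp add: defect_def cin.diff_left cinner_adjoint_R R_simps)
    then show "cinner (\<pi> a x) y = cinner (op_add H (compressed a)
        (op_scale H (\<phi> a) (op_diff H (op_id H) (compose H (adjoint_op H K R) R))) x) y"
      using ext[OF x y, of a] cinner_compressed[OF x y, of a] x
      by (simp add: op_add_def op_scale_def op_diff_def op_id_def compose_def cin.add_left cin.scale_left)
  qed
qed

lemma intertwining_iff:
  "compose H R (\<pi> a) = compose H (\<rho> a) R \<longleftrightarrow> (\<forall>x\<in>H. R (\<pi> a x) = \<rho> a (R x))"
proof
  assume *: "compose H R (\<pi> a) = compose H (\<rho> a) R"
  show "\<forall>x\<in>H. R (\<pi> a x) = \<rho> a (R x)"
  proof
    fix x assume "x \<in> H"
    then show "R (\<pi> a x) = \<rho> a (R x)" using fun_cong[OF *, of x] by (simp add: compose_def)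
  qed
qed (auto simp: compose_def intro: restrict_ext)

end

theorem theorem2p2:
  fixes G J :: "'a::unital_cstar_algebra set"
    and H :: "'h::complex_inner set" and K :: "'k::complex_inner set"
    and \<pi> :: "'a \<Rightarrow> 'h \<Rightarrow> 'h" and \<rho> :: "'a \<Rightarrow> 'k \<Rightarrow> 'k" and R :: "'h \<Rightarrow> 'k"
  assumes "hyperrigid G"
    and "separable_hilbert_space H" and "separable_hilbert_space K"
    and "representation H \<pi>" and "representation K \<rho>"
    and "contraction H K R" and "\<not> isometric H K R"
    and "\<forall>g\<in>G. \<pi> g = compose H (adjoint_op H K R) (compose H (\<rho> g) R)"
    and J: "J = {a. \<pi> a = compose H (adjoint_op H K R) (compose H (\<rho> a) R)}"
  shows "(((\<exists>\<phi>. state \<phi> \<and> G \<subseteq> ker \<phi>) \<and>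
            (\<forall>a. compose H R (\<pi> a) = compose H (\<rho> a) R) \<and> closed J \<and> two_sided_ideal J)
         \<or> ((\<forall>\<phi>. state \<phi> \<longrightarrow> \<not> G \<subseteq> ker \<phi>) \<and>
            \<not> (\<forall>a. compose H R (\<pi> a) = compose H (\<rho> a) R) \<and> \<not> two_sided_ideal J))
       \<and> (\<forall>\<phi>. state \<phi> \<and> G \<subseteq> ker \<phi> \<longrightarrow>
            ker \<phi> = J \<and> character \<phi> \<and>
            (\<forall>a. \<pi> a = op_add H (compose H (adjoint_op H K R) (compose H (\<rho> a) R))
                         (op_scale H (\<phi> a)
                           (op_diff H (op_id H) (compose H (adjoint_op H K R) R)))))"
proof -
  interpret compression H K \<pi> \<rho> R
    using assms(2-6) by unfold_locales (simp_all add: separable_hilbert_space_def)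
  have J': "J = agreement" by (simp add: J agreement_def)
  have GJ: "G \<subseteq> agreement" using assms(8) by (auto simp: agreement_def)
  have gen: "generates G" using assms(1) by (simp add: hyperrigid_def)
  have ext: "cinner (\<pi> a x) y = cinner (\<rho> a (R x)) (R y) + \<phi> a * defect x y"
    if "state \<phi>" "G \<subseteq> ker \<phi>" "x \<in> H" "y \<in> H" for \<phi> a x y
    using hyperrigid_extension[OF assms(1-3) that(1) _ _ that(3,4)] that(2) assms(8)
    by (auto simp: ker_def)
  have alpha: "ker \<phi> = agreement" "character \<phi>" "compose H R (\<pi> a) = compose H (\<rho> a) R"
    "\<pi> a = op_add H (compressed a)
      (op_scale H (\<phi> a) (op_diff H (op_id H) (compose H (adjoint_op H K R) R)))"
    if st: "state \<phi>" "G \<subseteq> ker \<phi>" for \<phi> a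
  proof -
    have e: "cinner (\<pi> a x) y = cinner (\<rho> a (R x)) (R y) + \<phi> a * defect x y"
      if "x \<in> H" "y \<in> H" for a x y by (rule ext[OF st that])
    note c = consequences_of_extension[OF e st(1) assms(7)]
    show "ker \<phi> = agreement" by (rule c(3))
    show "character \<phi>" by (rule c(2))
    show "compose H R (\<pi> a) = compose H (\<rho> a) R" unfolding intertwining_iff using c(1) by blast
    show "\<pi> a = op_add H (compressed a)
      (op_scale H (\<phi> a) (op_diff H (op_id H) (compose H (adjoint_op H K R) R)))" by (rule c(4))
  qed
  show ?thesis
  proof (intro conjI allI impI)
    show "((\<exists>\<phi>. state \<phi> \<and> G \<subseteq> ker \<phi>) \<and>
            (\<forall>a. compose H R (\<pi> a) = compose H (\<rho> a) R) \<and> closed J \<and> two_sided_ideal J)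
         \<or> ((\<forall>\<phi>. state \<phi> \<longrightarrow> \<not> G \<subseteq> ker \<phi>) \<and>
            \<not> (\<forall>a. compose H R (\<pi> a) = compose H (\<rho> a) R) \<and> \<not> two_sided_ideal J)"
    proof (cases "\<exists>\<phi>. state \<phi> \<and> G \<subseteq> ker \<phi>")
      case True
      then obtain \<phi> where \<phi>: "state \<phi>" "G \<subseteq> ker \<phi>" by blast
      have "closed J" "two_sided_ideal J"
        using kernel_of_state_closed[OF \<phi>(1)] kernel_of_character_ideal[OF alpha(2)[OF \<phi>]]
        by (simp_all add: J' alpha(1)[OF \<phi>])
      then show ?thesis using True alpha(3)[OF \<phi>] by blast
    next
      case False
      have nI: "\<not> two_sided_ideal agreement"
        using state_of_ideal[OF _ GJ gen assms(7)] False by blast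
      moreover have "\<not> (\<forall>a. compose H R (\<pi> a) = compose H (\<rho> a) R)"
        using ideal_of_intertwining nI unfolding intertwining_iff by blast
      ultimately show ?thesis using False J' by blast
    qed
  next
    fix \<phi> a assume "state \<phi> \<and> G \<subseteq> ker \<phi>"
    then have \<phi>: "state \<phi>" "G \<subseteq> ker \<phi>" by auto
    show "ker \<phi> = J" using alpha(1)[OF \<phi>] J' by simp
    show "character \<phi>" by (rule alpha(2)[OF \<phi>])
    show "\<pi> a = op_add H (compressed a)
      (op_scale H (\<phi> a) (op_diff H (op_id H) (compose H (adjoint_op H K R) R)))" by (rule alpha(4)[OF \<phi>])
  qed
qed

end
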